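(* Notation ($F$, $\mathscr{K}_a,\mathscr{E}_a,\mathscr{K},\mathscr{E}$, $\alpha,\beta,\eta$, $\Lambda,\Lambda_1$, $f_1,f_2$, $a_k^{(1)}$, $a_k^{(2)}$) is as in the context. (1) The conjecture that, for each $a>0$, $r\in(0,1)$ and $b\in(0,\infty)$, $$\frac{\partial}{\partial b}\left[\frac{F(a+1,b+1;a+b+1;r)}{F(a,b;a+b;r)}\right]<0$$ is not true if $b>\sqrt{a(a+1)}$ (that is, for such $a,b$ the inequality does not hold for all $r\in(0,1)$). In particular, the inequality $$\frac{F(a+1,2-a;2;r)}{F(a,1-a;1;r)}>\frac{F(a+1,5/2-a;5/2;r)}{F(a,3/2-a;3/2;r)}$$ (conjectured for all $a,r\in(0,1)$) does not hold if $a\in(0,1/3)$ (that is, for such $a$ it does not hold for all $r\in(0,1)$). (2) If $a\in(0,3/7)$, then there exists a number $r_1\in(0,1)$ such that $f_1$ is strictly decreasing in $r\in(0,r_1]$, so that $\Lambda(a,r)<1$ for $r\in(0,r_1]$. If $a\in(3/7,1)$, then there exists a number $r_2\in(0,1)$ such that $f_1$ is strictly increasing in $r\in(0,r_2]$, so that $\Lambda(a,r)>1$ for $r\in(0,r_2]$. Moreover, for each $a\in(0,1)$ there exists a number $r_3\in(0,1)$ such that $f_1$ is positive and strictly increasing in $r\in[r_3,1)$ with $f_1(a,1^-)=\infty$, so that $\Lambda(a,r)>1$ for $r\in[r_3,1)$. In particular, neither the inequality $\Lambda(a,r)>1$ (equivalently, $\Lambda_1(a,r)>F(a,1-a;1;r)$)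 nor its reversed one is always valid for all $a,r\in(0,1)$. (3) For $n\in\mathbb{N}_0$ and $a,r\in(0,1)$, write $f_2(a,r)=\sum_{k=0}^\infty a_kr^k$ (where $a_k=a_k(a)$ depends on $a$), $P_n(a,r)=\sum_{k=0}^{n+1}a_kr^{2k}$ and $\delta_n=\alpha\beta-\sum_{k=0}^{n+1}a_k$. Then $f_2(a,0)=a_0=\alpha-1=a/[3(1-a)]$, $f_2(a,1^-)=\alpha\beta$, and for $k\in\mathbb{N}$ $$a_k=a_k(a)=\frac1k\sum_{i=0}^{k-1}\frac{(i+1)(a)_{k-i-1}(3/2-a)_{k-i-1}}{(3/2)_{k-i-1}(k-i-1)!}\bigl|a_{i+1}^{(1)}\bigr|>0,$$ with $a_1=a(a+1)/10$, $a_2=a(a+1)(-41a^2+24a+100)/2100$, and $a_k(0^+)=0$ for $k\in\mathbb{N}_0$. In particular, for each $a\in(0,1)$, $f_2$ is absolutely monotone in $r$ from $(0,1)$ onto $(a/[3(1-a)],\alpha\beta)$; $\delta_n$ is strictly decreasing to $0$ in $n\in\mathbb{N}_0$; and for all $a,r\in(0,1)$ $$\alpha\mathscr{K}_a(r)=\frac{\mathscr{E}_a(r)-(1-r^2)\mathscr{K}_a(r)}{ar^2}\cdot\frac{F(a,3/2-a;3/2;r^2)}{F(a,3/2-a;5/2;r^2)}+\frac\pi2\sum_{k=0}^\infty a_kr^{2k}$$ and $$\mathscr{K}(r)=\frac{\mathscr{E}(r)-(1-r^2)\mathscr{K}(r)}{1-\bigl((1-r^2)\operatorname{artanh} r\bigr)/r}\cdot\frac{\operatorname{artanh}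 r}{r}+\frac{3\pi}{8}\sum_{k=0}^\infty a_k(1/2)r^{2k}=\frac{3\pi}{8}\left[\left(\sum_{k=0}^\infty a_k^{(2)}r^{2k}\right)\frac{\operatorname{artanh} r}{r}+\sum_{k=0}^\infty a_k(1/2)r^{2k}\right].$$ Moreover, for each $n\in\mathbb{N}_0$ and for all $a,r\in(0,1)$: (A) $$0<\frac{2\alpha}{\pi}\mathscr{K}_a(r)-2\,\frac{\mathscr{E}_a(r)-(1-r^2)\mathscr{K}_a(r)}{\pi ar^2}\cdot\frac{F(a,3/2-a;3/2;r^2)}{F(a,3/2-a;5/2;r^2)}-P_n(a,r)<\delta_nr^{2(n+2)};$$ (B) $$a_{n+2}r^{n+2}<\alpha F(a,1-a;1;r)-P_n(a,\sqrt r)-\Lambda_1(a,r)<\delta_nr^{n+2};$$ (C) $$-\delta_nr^{n+1}<\frac{\Lambda_1(a,r)-F(a,1-a;1;r)}{r}-\frac{a(7a-3)}{30}-Q_n(a,r)<-a_{n+2}r^{n+1},$$ where $$Q_n(a,r)=\frac{a}{3(1-a)}\sum_{k=1}^\infty\frac{(a)_{k+1}(1-a)_{k+1}}{[(k+1)!]^2}r^k-\sum_{k=1}^na_{k+1}r^k=a\,\frac{F(a,1-a;1;r)-1-a(1-a)r}{3(1-a)r}-\sum_{k=1}^na_{k+1}r^k;$$ (D) with $F=F(a,1-a;1;r)$, $$\alpha(1-\beta)<\alpha\left[1-\frac{\beta}{F}\right]<\alpha-\frac{\alpha\beta r^{n+2}}{F}<\alpha-\frac{P_n(a,\sqrt r)+\delta_nr^{n+2}}{F}<\Lambda(a,r)<\alpha-\frac{P_{n+1}(a,\sqrt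 r)}{F}$$ $$<\alpha-\frac{r^{n+2}\sum_{k=0}^{n+2}a_k+a_0(1-r^{n+2})}{F}<\alpha-\frac{\eta}{F}<\alpha.$$ The double inequality (A) is sharp as $r\to0$ (or $r\to1$ or $a\to0$), each inequality in (D) is sharp as $a\to0$, and as constant depending only on $a$, each $\alpha$ in (A), (B) and (D) is best possible.
   Context: $\mathbb{N}=\{1,2,\dots\}$, $\mathbb{N}_0=\mathbb{N}\cup\{0\}$. $\Gamma$ is the gamma function, $\psi=\Gamma'/\Gamma$, $B(x,y)=\Gamma(x)\Gamma(y)/\Gamma(x+y)$. $(a)_0=1$, $(a)_n=a(a+1)\cdots(a+n-1)$. For $|x|<1$, $F(a,b;c;x)=\sum_{n=0}^\infty\frac{(a)_n(b)_n}{(c)_n\,n!}x^n$ (Gaussian hypergeometric function). For $a,r\in(0,1)$: $\mathscr{K}_a(r)=\frac\pi2F(a,1-a;1;r^2)$, $\mathscr{E}_a(r)=\frac\pi2F(a-1,1-a;1;r^2)$, $\mathscr{K}=\mathscr{K}_{1/2}$, $\mathscr{E}=\mathscr{E}_{1/2}$. For $a\in(0,1)$: $\alpha=\alpha(a)=\frac{3-2a}{3(1-a)}$, $\eta=\eta(a)=\frac{a}{3-2a}$, $\beta=\beta(a)=\frac{\psi(3/2-a)-\psi(1-a)}{B(a,1-a)}$. For $a,r\in(0,1)$: $$\Lambda(a,r)=\frac{F(a,1-a;2;r)F(a,3/2-a;3/2;r)}{F(a,1-a;1;r)F(a,3/2-a;5/2;r)},\quad \Lambda_1(a,r)=\Lambda(a,r)F(a,1-a;1;r),$$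 $$f_1(a,r)=\Lambda_1(a,r)-F(a,1-a;1;r),\qquad f_2(a,r)=\alpha F(a,1-a;1;r)-\Lambda_1(a,r).$$ Values at $r=0$ are obtained from the power series. The numbers $a_n^{(1)}=a_n^{(1)}(a,1-a,3/2-a)$ are the Maclaurin coefficients in $r$ of $\frac{F(a,1-a;2;r)}{F(a,3/2-a;5/2;r)}=\sum_{n=0}^\infty a_n^{(1)}r^n$. The numbers $a_k^{(2)}$ are defined by $a_0^{(2)}=1$ and, for $k\in\mathbb{N}$, $a_k^{(2)}=\frac{1}{k+1}\left[\frac{(1/2)_k}{k!}\right]^2-3\sum_{j=0}^{k-1}\frac{a_j^{(2)}}{[2(k-j)+1][2(k-j)+3]}$. A function is absolutely monotone on an interval if it and all its derivatives are nonnegative there. $g(1^-)$ denotes the left limit at $1$ and $g(0^+)$ the right limit at $0$.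
   Formalization: In (D) the third printed "<", between α−αβr^{n+2}/F and α−(P_n+δ_n r^{n+2})/F, always fails; it is reversed, α[1−β/F]<α−(P_n+δ_n r^{n+2})/F is added, and the first term does not enter below Λ via it. In (A), sharpness as r→1 is for the upper bound only, since the middle tends to δ_n>0. *)

theory Defs
  imports "HOL-Analysis.Analysis"
begin

definition hypF :: "real \<Rightarrow> real \<Rightarrow> real \<Rightarrow> real \<Rightarrow> real" where
  "hypF a b c x = (\<Sum>n. pochhammer a n * pochhammer b n / (pochhammer c n * fact n) * x ^ n)"

lemma hypF_eq_eval_fps: "hypF a b c x = eval_fps (fps_hypergeo [a, b] [c] 1) x"
  by (simp add: hypF_def eval_fps_def)

definition ellK :: "real \<Rightarrow> real \<Rightarrow> real" where
  "ellK a r = pi / 2 * hypF a (1 - a) 1 (r\<^sup>2)"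

definition ellE :: "real \<Rightarrow> real \<Rightarrow> real" where
  "ellE a r = pi / 2 * hypF (a - 1) (1 - a) 1 (r\<^sup>2)"

definition alpha :: "real \<Rightarrow> real" where
  "alpha a = (3 - 2 * a) / (3 * (1 - a))"

definition eta :: "real \<Rightarrow> real" where
  "eta a = a / (3 - 2 * a)"

definition beta :: "real \<Rightarrow> real" where
  "beta a = (Digamma (3 / 2 - a) - Digamma (1 - a)) / Beta a (1 - a)"

definition Lambda :: "real \<Rightarrow> real \<Rightarrow> real" where
  "Lambda a r = (hypF a (1 - a) 2 r * hypF a (3 / 2 - a) (3 / 2) r) /
                (hypF a (1 - a) 1 r * hypF a (3 / 2 - a) (5 / 2) r)"

definition Lambda1 :: "real \<Rightarrow> real \<Rightarrow> real" where
  "Lambda1 a r = Lambda a r * hypF a (1 - a) 1 r"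

definition f1 :: "real \<Rightarrow> real \<Rightarrow> real" where
  "f1 a r = Lambda1 a r - hypF a (1 - a) 1 r"

definition f2 :: "real \<Rightarrow> real \<Rightarrow> real" where
  "f2 a r = alpha a * hypF a (1 - a) 1 r - Lambda1 a r"

definition maclaurin_coeff :: "(real \<Rightarrow> real) \<Rightarrow> nat \<Rightarrow> real" where
  "maclaurin_coeff g n = (deriv ^^ n) g 0 / fact n"

definition acoeff1 :: "real \<Rightarrow> nat \<Rightarrow> real" where
  "acoeff1 a = maclaurin_coeff (\<lambda>r. hypF a (1 - a) 2 r / hypF a (3 / 2 - a) (5 / 2) r)"

fun acoeff2 :: "nat \<Rightarrow> real" where
  "acoeff2 0 = 1"
| "acoeff2 (Suc k) =
     1 / (real (Suc k) + 1) * (pochhammer (1 / 2) (Suc k) / fact (Suc k))\<^sup>2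
     - 3 * (\<Sum>j<Suc k. acoeff2 j / ((2 * real (Suc k - j) + 1) * (2 * real (Suc k - j) + 3)))"

definition acoeff :: "real \<Rightarrow> nat \<Rightarrow> real" where
  "acoeff a = maclaurin_coeff (f2 a)"

definition P :: "nat \<Rightarrow> real \<Rightarrow> real \<Rightarrow> real" where
  "P n a r = (\<Sum>k\<le>n + 1. acoeff a k * r ^ (2 * k))"

definition delta :: "nat \<Rightarrow> real \<Rightarrow> real" where
  "delta n a = alpha a * beta a - (\<Sum>k\<le>n + 1. acoeff a k)"

text \<open>The infinite sum over \<open>k \<ge> 1\<close> is reindexed to start at \<open>0\<close>.\<close>

definition Q :: "nat \<Rightarrow> real \<Rightarrow> real \<Rightarrow> real" where
  "Q n a r =
     a / (3 * (1 - a)) *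
       (\<Sum>k. pochhammer a (k + 2) * pochhammer (1 - a) (k + 2) / (fact (k + 2))\<^sup>2 * r ^ (k + 1))
     - (\<Sum>k=1..n. acoeff a (k + 1) * r ^ k)"

definition absolutely_monotone_on :: "real set \<Rightarrow> (real \<Rightarrow> real) \<Rightarrow> bool" where
  "absolutely_monotone_on S g \<longleftrightarrow>
     (\<forall>n. \<forall>x\<in>S. (deriv ^^ n) g differentiable (at x) \<and> 0 \<le> (deriv ^^ n) g x)"

text \<open>
  The parameter \<open>c\<close> stands for the explicitly written occurrences of \<open>\<alpha>\<close>, which the
  optimality claims vary; the inequalities themselves are about \<open>c = alpha a\<close>.
  The quantities \<open>P\<close> and \<open>delta\<close> are not varied.
\<close>

definition A_mid :: "nat \<Rightarrow> real \<Rightarrow> real \<Rightarrow> real \<Rightarrow> real" where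
  "A_mid n c a r =
     2 * c / pi * ellK a r
     - 2 * ((ellE a r - (1 - r\<^sup>2) * ellK a r) / (pi * a * r\<^sup>2)) *
         (hypF a (3 / 2 - a) (3 / 2) (r\<^sup>2) / hypF a (3 / 2 - a) (5 / 2) (r\<^sup>2))
     - P n a r"

definition B_mid :: "nat \<Rightarrow> real \<Rightarrow> real \<Rightarrow> real \<Rightarrow> real" where
  "B_mid n c a r = c * hypF a (1 - a) 1 r - P n a (sqrt r) - Lambda1 a r"

definition D_terms :: "nat \<Rightarrow> real \<Rightarrow> real \<Rightarrow> real \<Rightarrow> real list" where
  "D_terms n c a r =
    (let F = hypF a (1 - a) 1 r in
     [c * (1 - beta a),
      c * (1 - beta a / F),
      c - c * beta a * r ^ (n + 2) / F,
      c - (P n a (sqrt r) + delta n a * r ^ (n + 2)) / F,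
      Lambda a r,
      c - P (n + 1) a (sqrt r) / F,
      c - (r ^ (n + 2) * (\<Sum>k\<le>n + 2. acoeff a k) + acoeff a 0 * (1 - r ^ (n + 2))) / F,
      c - eta a / F,
      c])"

text \<open>
  The pairs \<open>(i, j)\<close> for which \<open>D_terms ! i < D_terms ! j\<close> is asserted.

  The source prints one chain \<open>0 < 1 < 2 < 3 < 4 < 5 < 6 < 7 < 8\<close> (by position). Its link
  \<open>2 < 3\<close> is false for every \<open>n\<close>, \<open>a\<close>, \<open>r\<close>: by lemma \<open>D_printed_link_reversed\<close> below, the
  positivity of the coefficients, which the same theorem claims, gives \<open>3 < 2\<close>. (Also
  \<open>2 < 4\<close> fails: term 2 tends to \<open>\<alpha> > 1\<close> and \<open>\<Lambda>\<close> to 1 as \<open>r \<rightarrow> 0\<close>.) Hence that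
  one link is reversed here, and \<open>1 < 3\<close>, which the printed chain obtained through term 2, is
  listed explicitly. All other links are as printed.
\<close>

definition D_links :: "(nat \<times> nat) set" where
  "D_links = {(0, 1), (1, 2), (3, 2), (1, 3), (3, 4), (4, 5), (5, 6), (6, 7), (7, 8)}"

lemma D_printed_link_reversed:
  assumes r: "0 < r" "r < 1" and F: "hypF a (1 - a) 1 r > 0" and pos: "\<And>k. acoeff a k > 0"
  shows "D_terms n (alpha a) a r ! 3 < D_terms n (alpha a) a r ! 2"
proof -
  have "P n a (sqrt r) = (\<Sum>k\<le>n + 1. acoeff a k * r ^ k)"
    using r by (simp add: P_def power_mult)
  moreover have "(\<Sum>k\<le>n + 1. acoeff a k) * r ^ (n + 2) < (\<Sum>k\<le>n + 1. acoeff a k * r ^ k)"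
    unfolding sum_distrib_right
  proof (rule sum_strict_mono)
    fix k assume "k \<in> {..n + 1}"
    then have "r ^ (n + 2) < r ^ k"
      using r by (intro power_strict_decreasing) auto
    then show "acoeff a k * r ^ (n + 2) < acoeff a k * r ^ k"
      using pos by simp
  qed auto
  ultimately have "alpha a * beta a * r ^ (n + 2) < P n a (sqrt r) + delta n a * r ^ (n + 2)"
    by (simp add: delta_def algebra_simps)
  then show ?thesis
    using F by (simp add: D_terms_def Let_def divide_strict_right_mono numeral_eq_Suc)
qed

end

theory Submission
  imports Defs "HOL-Real_Asymp.Real_Asymp"
begin

text \<open>
  Write \<open>G, H, M, N\<close> for \<open>F(a,1-a;1;r)\<close>, \<open>F(a,1-a;2;r)\<close>, \<open>F(a,3/2-a;3/2;r)\<close>, \<open>F(a,3/2-a;5/2;r)\<close> and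
  \<open>q = H / N\<close>, so that \<open>f\<^sub>2 = \<alpha> G - q M\<close> and \<open>f\<^sub>1 = (\<alpha> - 1) G - f\<^sub>2\<close>. Euler's transformation gives
  \<open>\<alpha> G' = q M'\<close>, hence \<open>f\<^sub>2' = - M q'\<close>. The coefficients of \<open>N\<close> are log-convex and those of \<open>H\<close>
  decrease relative to them, so by an argument of Kaluza all coefficients of \<open>q\<close> but the first are
  negative, and those of \<open>f\<^sub>2\<close> are positive.

  The series \<open>G\<close> and \<open>M\<close> are zero-balanced, and the coefficients of \<open>B(a,1-a) G - B(a,3/2-a) M\<close> are
  nonnegative with sum \<open>\<psi>(3/2-a) - \<psi>(1-a)\<close>. Since \<open>q\<close> decreases, \<open>f\<^sub>2 \<le> \<alpha> G - q(1) M \<le> \<alpha> \<beta>\<close>; conversely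
  \<open>(q(x) - q(1)) M(x) \<le> f\<^sub>2(1) - f\<^sub>2(x)\<close> because \<open>M\<close> increases, and so \<open>f\<^sub>2(1) = \<alpha> \<beta>\<close>.
  All of (A)-(D) are bounds for the tails of the positive series \<open>f\<^sub>2\<close>; optimality of \<open>\<alpha>\<close> follows from
  \<open>G(1) = \<infinity>\<close>, except for the first link of (D), where \<open>r \<rightarrow> 0\<close> and \<open>\<beta> < 1\<close> decide.

  In (1) the derivative with respect to \<open>b\<close> is, up to a positive factor, a power series in \<open>r\<close> with
  leading term \<open>(a (a + 1) / (a + b + 1)\<^sup>2 - a\<^sup>2 / (a + b)\<^sup>2) r\<close>, which is positive if \<open>b\<^sup>2 > a (a + 1)\<close>; the second
  claim of (1) says that \<open>\<Lambda> > 1\<close> fails near \<open>0\<close>.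
\<close>

unbundle no vec_syntax and fps_syntax

subsection \<open>Power series\<close>

lemma nth_deriv_eq_eval_fps:
  fixes F :: "real fps"
  assumes "open S" "\<And>x. x \<in> S \<Longrightarrow> f x = eval_fps F x"
    and "\<And>x. x \<in> S \<Longrightarrow> ereal \<bar>x\<bar> < fps_conv_radius F" and "x \<in> S"
  shows "(deriv ^^ n) f x = eval_fps (fps_nth_deriv n F) x"
  using assms
proof (induction n arbitrary: f F)
  case (Suc n)
  have "deriv f y = eval_fps (fps_deriv F) y" if "y \<in> S" for y
  proof (rule DERIV_imp_deriv)
    have "(eval_fps F has_field_derivative eval_fps (fps_deriv F) y) (at y)"
      using Suc.prems that by (intro has_field_derivative_eval_fps) auto
    then show "(f has_field_derivative eval_fps (fps_deriv F) y) (at y)"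
      by (rule has_field_derivative_transform_within_open) (use Suc.prems that in auto)
  qed
  moreover have "ereal \<bar>y\<bar> < fps_conv_radius (fps_deriv F)" if "y \<in> S" for y
    using Suc.prems(3)[OF that] fps_conv_radius_deriv[of F] by (rule less_le_trans)
  ultimately have "(deriv ^^ n) (deriv f) x = eval_fps (fps_nth_deriv n (fps_deriv F)) x"
    using Suc.prems by (intro Suc.IH)
  then show ?case
    by (simp add: funpow_Suc_right del: funpow.simps)
qed auto

lemma fps_nth_deriv_nth_0: "fps_nth_deriv n F $ 0 = fact n * (F $ n :: real)"
  by (induction n arbitrary: F) (simp_all add: algebra_simps)

lemma maclaurin_coeff_eqI:
  fixes F :: "real fps"
  assumes "e > 0" "\<And>x. \<bar>x\<bar> < e \<Longrightarrow> f x = eval_fps F x" "fps_conv_radius F > 0"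
  shows "maclaurin_coeff f n = F $ n"
proof -
  obtain d where d: "0 < ereal d" "ereal d < fps_conv_radius F"
    using ereal_dense2[OF assms(3)] by auto
  have "(deriv ^^ n) f 0 = eval_fps (fps_nth_deriv n F) 0"
  proof (rule nth_deriv_eq_eval_fps)
    show "open {-min d e<..<min d e}" by simp
    show "ereal \<bar>x\<bar> < fps_conv_radius F" if "x \<in> {-min d e<..<min d e}" for x
      using that d(2) by (intro less_trans[OF _ d(2)]) auto
  qed (use assms d in auto)
  then show ?thesis
    by (simp add: maclaurin_coeff_def eval_fps_at_0 fps_nth_deriv_nth_0)
qed

lemma fps_nth_deriv_nonneg:
  fixes F :: "real fps"
  assumes "\<And>k. F $ k \<ge> 0"
  shows "fps_nth_deriv n F $ k \<ge> 0"
  using assms by (induction n arbitrary: F) auto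

lemma fps_conv_radius_nth_deriv:
  fixes F :: "real fps"
  shows "fps_conv_radius F \<le> fps_conv_radius (fps_nth_deriv n F)"
  by (induction n arbitrary: F) (auto intro: order_trans fps_conv_radius_deriv)

lemma fps_conv_radius_ge_1I:
  fixes F :: "real fps"
  assumes "\<And>n. \<bar>F $ n\<bar> \<le> C"
  shows "fps_conv_radius F \<ge> 1"
  unfolding fps_conv_radius_def
proof (rule conv_radius_geI_ex)
  fix r :: real assume r: "0 < r" "ereal r < 1"
  have "summable (\<lambda>n. F $ n * r ^ n)"
  proof (rule summable_comparison_test)
    show "\<exists>N. \<forall>n\<ge>N. norm (F $ n * r ^ n) \<le> C * r ^ n"
      using assms r by (auto simp: abs_mult intro!: mult_right_mono)
    show "summable (\<lambda>n. C * r ^ n)" 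
      using r by (auto intro!: summable_mult summable_geometric)
  qed
  then show "\<exists>z. norm z = r \<and> summable (\<lambda>n. F $ n * z ^ n)"
    using r by (intro exI[of _ r]) auto
qed

lemma eval_fps_nonneg:
  fixes F :: "real fps"
  assumes "\<And>k. F $ k \<ge> 0" "0 \<le> x" "ereal x < fps_conv_radius F"
  shows "eval_fps F x \<ge> 0"
  unfolding eval_fps_def using assms summable_fps[of x F] by (intro suminf_nonneg) auto

lemma eval_fps_mono:
  fixes F :: "real fps"
  assumes "\<And>k. F $ k \<ge> 0" "0 \<le> x" "x \<le> y" "ereal y < fps_conv_radius F"
  shows "eval_fps F x \<le> eval_fps F y"
proof -
  have "ereal x < fps_conv_radius F"
    using assms by (intro le_less_trans[OF _ assms(4)]) auto
  then show ?thesis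
    unfolding eval_fps_def using assms summable_fps[of x F] summable_fps[of y F]
    by (intro suminf_le mult_left_mono power_mono) auto
qed

lemma eventually_at_left_1: "\<forall>\<^sub>F x in at_left (1::real). 0 < x \<and> x < 1"
  using eventually_at_left_real[of 0 "1::real"] by (simp add: eventually_mono)

lemma eval_fps_tendsto_at_left_1:
  fixes F :: "real fps"
  assumes "\<And>k. F $ k \<ge> 0" "summable (fps_nth F)"
  shows "(eval_fps F \<longlongrightarrow> (\<Sum>k. F $ k)) (at_left 1)"
proof -
  have "((\<lambda>x::real. \<Sum>k. F $ k * x ^ k) \<longlongrightarrow> (\<Sum>k. F $ k * 1 ^ k)) (at_left 1)"
  proof (rule tannerys_theorem[THEN conjunct2, THEN conjunct2])
    show "((\<lambda>x::real. F $ k * x ^ k) \<longlongrightarrow> F $ k * 1 ^ k) (at_left 1)" for k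
      by (intro tendsto_intros)
    have "eventually (\<lambda>x::real. x \<in> {0<..<1}) (at_left 1)"
      by (rule eventually_at_left_real) simp
    moreover have "norm (F $ k * x ^ k) \<le> F $ k" if "x \<in> {0<..<1}" for x k
      using assms(1)[of k] that by (auto simp: abs_mult intro!: mult_left_le power_le_one)
    ultimately show "\<forall>\<^sub>F (k, x) in sequentially \<times>\<^sub>F at_left 1. norm (F $ k * x ^ k) \<le> F $ k"
      unfolding eventually_prod_filter
      by (intro exI[of _ "\<lambda>_. True"] exI[of _ "\<lambda>x. x \<in> {0<..<1::real}"]) auto
  qed (use assms in \<open>auto simp: eventually_prod_filter\<close>)
  then show ?thesis
    by (simp add: eval_fps_def[abs_def])
qed

lemma eval_fps_le_suminf:
  fixes F :: "real fps"
  assumes "\<And>k. F $ k \<ge> 0" "summable (fps_nth F)" "0 \<le> x" "x \<le> 1"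
  shows "eval_fps F x \<le> (\<Sum>k. F $ k)"
proof -
  have le: "F $ k * x ^ k \<le> F $ k" for k
    using assms by (intro mult_left_le power_le_one) auto
  have "summable (\<lambda>k. F $ k * x ^ k)"
    by (rule summable_comparison_test'[OF assms(2), of 0]) (use le assms in auto)
  then show ?thesis
    unfolding eval_fps_def using le assms by (intro suminf_le) auto
qed

lemma summable_fps_nth_if_bounded:
  fixes F :: "real fps"
  assumes "\<And>k. F $ k \<ge> 0" "fps_conv_radius F \<ge> 1" "\<And>x. 0 < x \<Longrightarrow> x < 1 \<Longrightarrow> eval_fps F x \<le> L"
  shows "summable (fps_nth F)" "(\<Sum>k. F $ k) \<le> L"
proof -
  have le: "(\<Sum>k<n. F $ k) \<le> L" for n
  proof (rule tendsto_upperbound)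
    show "((\<lambda>x::real. \<Sum>k<n. F $ k * x ^ k) \<longlongrightarrow> (\<Sum>k<n. F $ k)) (at_left 1)"
      by (auto intro!: tendsto_eq_intros)
    have "eventually (\<lambda>x::real. x \<in> {0<..<1}) (at_left 1)"
      by (rule eventually_at_left_real) simp
    then show "\<forall>\<^sub>F x in at_left 1. (\<Sum>k<n. F $ k * x ^ k) \<le> L"
    proof eventually_elim
      case (elim x)
      have "ereal (norm x) < fps_conv_radius F"
        using elim by (intro less_le_trans[OF _ assms(2)]) auto
      then have "(\<Sum>k<n. F $ k * x ^ k) \<le> eval_fps F x"
        unfolding eval_fps_def using assms elim summable_fps[of x F]
        by (intro sum_le_suminf) auto
      also have "\<dots> \<le> L" using assms elim by auto
      finally show ?case .
    qed
  qed auto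
  show "summable (fps_nth F)"
    by (rule summableI_nonneg_bounded[OF assms(1) le])
  then show "(\<Sum>k. F $ k) \<le> L"
    by (intro suminf_le_const le)
qed

lemma filterlim_eval_fps_at_top:
  fixes F :: "real fps"
  assumes "\<And>k. F $ k \<ge> 0" "fps_conv_radius F \<ge> 1" "\<not> summable (fps_nth F)"
  shows "filterlim (eval_fps F) at_top (at_left 1)"
  unfolding filterlim_at_top
proof
  fix K
  obtain x0 where x0: "0 < x0" "x0 < 1" "eval_fps F x0 > K"
    using summable_fps_nth_if_bounded(1)[of F K] assms by (meson not_less)
  have "K \<le> eval_fps F x" if "x \<in> {x0<..<1}" for x
  proof -
    have "ereal x < fps_conv_radius F"
      using that by (intro less_le_trans[OF _ assms(2)]) auto
    then have "eval_fps F x0 \<le> eval_fps F x"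
      using that x0 by (intro eval_fps_mono assms) auto
    then show ?thesis using x0 by simp
  qed
  moreover have "eventually (\<lambda>x. x \<in> {x0<..<1}) (at_left 1)"
    using x0 by (intro eventually_at_left_real) auto
  ultimately show "\<forall>\<^sub>F x in at_left 1. K \<le> eval_fps F x"
    by (auto elim: eventually_mono)
qed

context
  fixes h v :: "real fps"
  assumes h0: "h $ 0 = 1" and v0: "v $ 0 = 1"
    and h_pos: "\<And>n. h $ n > 0" and v_pos: "\<And>n. v $ n > 0"
    and v_ratio: "incseq (\<lambda>n. v $ Suc n / v $ n)"
    and hv_ratio: "\<And>n. h $ Suc n / v $ Suc n < h $ n / v $ n"
begin

unbundle no vec_syntax and fps_syntax

private lemma quotient_convolution: "h $ n = (\<Sum>i\<le>n. (h * inverse v) $ i * v $ (n - i))"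
proof -
  have "h = h * inverse v * v"
    using v0 by (simp add: mult.assoc inverse_mult_eq_1)
  then show ?thesis
    by (metis fps_mult_nth atLeast0AtMost)
qed

lemma fps_quotient_nth_0: "(h * inverse v) $ 0 = 1"
  using h0 v0 by simp

private lemma quotient_convolution':
  assumes "n > 0"
  shows "h $ n = v $ n + (\<Sum>i=1..<n. (h * inverse v) $ i * v $ (n - i)) + (h * inverse v) $ n"
proof -
  have "{..n} = insert 0 (insert n {1..<n})" using assms by auto
  then show ?thesis
    using assms v0 by (simp add: quotient_convolution[of n] fps_quotient_nth_0 h0)
qed

text \<open>Kaluza's argument: log-convexity of \<open>v\<close> turns the convolution for index \<open>n\<close> into the one for
  index \<open>n - 1\<close>.\<close>

lemma fps_quotient_nth_neg: "n > 0 \<Longrightarrow> (h * inverse v) $ n < 0"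
proof (induction n rule: less_induct)
  case (less n)
  let ?q = "h * inverse v"
  obtain m where n: "n = Suc m" using less.prems by (cases n) auto
  have ratio: "v $ Suc j * v $ m \<le> v $ j * v $ Suc m" if "j \<le> m" for j
    using incseqD[OF v_ratio that] v_pos[of j] v_pos[of m] by (simp add: field_simps)
  have "(\<Sum>i=1..<Suc m. ?q $ i * v $ (m - i)) * v $ Suc m
          \<le> (\<Sum>i=1..<Suc m. ?q $ i * v $ (Suc m - i)) * v $ m"
    unfolding sum_distrib_right
  proof (rule sum_mono)
    fix i assume i: "i \<in> {1..<Suc m}"
    then have "?q $ i < 0" using less.IH n by auto
    moreover have "v $ (Suc m - i) * v $ m \<le> v $ (m - i) * v $ Suc m"
      using ratio[of "m - i"] i by (simp add: Suc_diff_le)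
    ultimately show "?q $ i * v $ (m - i) * v $ Suc m \<le> ?q $ i * v $ (Suc m - i) * v $ m"
      by (simp add: mult.assoc mult_left_mono_neg)
  qed
  moreover have "h $ m = v $ m + (\<Sum>i=1..<Suc m. ?q $ i * v $ (m - i))"
  proof (cases m)
    case (Suc k)
    then have "{1..<Suc m} = insert m {1..<m}" by auto
    then show ?thesis using quotient_convolution'[of m] Suc v0 by simp
  qed (use h0 v0 in auto)
  moreover have "h $ Suc m = v $ Suc m + (\<Sum>i=1..<Suc m. ?q $ i * v $ (Suc m - i)) + ?q $ Suc m"
    by (rule quotient_convolution') auto
  moreover have "h $ Suc m * v $ m < h $ m * v $ Suc m"
    using hv_ratio[of m] v_pos[of m] v_pos[of "Suc m"] by (simp add: field_simps)
  ultimately have "?q $ Suc m * v $ m < 0"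
    by (simp add: algebra_simps)
  then show ?case
    using v_pos[of m] n by (simp add: mult_less_0_iff)
qed

lemma fps_quotient_nth_ge: "- v $ n \<le> (h * inverse v) $ n"
proof (cases "n = 0")
  case False
  have "(\<Sum>i=1..<n. (h * inverse v) $ i * v $ (n - i)) \<le> 0"
    using v_pos by (intro sum_nonpos mult_nonpos_nonneg less_imp_le[OF fps_quotient_nth_neg])
      (auto intro: less_imp_le)
  then show ?thesis
    using quotient_convolution'[of n] False h_pos[of n] by simp
qed (use h0 v0 in auto)

end

subsection \<open>Hypergeometric series\<close>

definition hyp_fps :: "real \<Rightarrow> real \<Rightarrow> real \<Rightarrow> real fps" where
  "hyp_fps a b c = Abs_fps (\<lambda>n. pochhammer a n * pochhammer b n / (pochhammer c n * fact n))"

lemma hypF_eq_eval_hyp_fps: "hypF a b c x = eval_fps (hyp_fps a b c) x"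
  by (simp add: hypF_def eval_fps_def hyp_fps_def)

lemma hyp_fps_nth_0 [simp]: "hyp_fps a b c $ 0 = 1"
  by (simp add: hyp_fps_def)

lemma hyp_fps_nth_Suc:
  "hyp_fps a b c $ Suc n = hyp_fps a b c $ n * ((a + n) * (b + n) / ((c + n) * (real n + 1)))"
  by (simp add: hyp_fps_def pochhammer_Suc mult_ac)

lemma hyp_fps_nth_pos: "a > 0 \<Longrightarrow> b > 0 \<Longrightarrow> c > 0 \<Longrightarrow> hyp_fps a b c $ n > 0"
  by (simp add: hyp_fps_def pochhammer_pos)

lemma fps_conv_radius_hyp_fps:
  assumes "a \<notin> \<int>\<^sub>\<le>\<^sub>0" "b \<notin> \<int>\<^sub>\<le>\<^sub>0" "c \<notin> \<int>\<^sub>\<le>\<^sub>0"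
  shows "fps_conv_radius (hyp_fps a b c) = 1"
  unfolding fps_conv_radius_def
proof (rule conv_radius_ratio_limit_nonzero)
  have nz: "hyp_fps a b c $ n \<noteq> 0" for n
    using assms by (auto simp: hyp_fps_def pochhammer_eq_0_iff)
  have "x + real n \<noteq> 0" if "x \<notin> \<int>\<^sub>\<le>\<^sub>0" for x n
    using that by (metis add_eq_0_iff2 minus_of_nat_in_nonpos_Ints minus_minus)
  then have "\<bar>(c + n) * (n + 1) / ((a + n) * (b + n))\<bar> =
      norm (hyp_fps a b c $ n) / norm (hyp_fps a b c $ Suc n)" for n
    using assms nz[of n] by (simp add: hyp_fps_nth_Suc abs_mult)
  moreover have "(\<lambda>n. \<bar>(c + real n) * (real n + 1) / ((a + n) * (b + n))\<bar>) \<longlonglongrightarrow> \<bar>1\<bar>"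
    by (rule tendsto_rabs) real_asymp
  ultimately show "(\<lambda>n. norm (hyp_fps a b c $ n) / norm (hyp_fps a b c $ Suc n)) \<longlonglongrightarrow> 1"
    by (simp only: abs_one)
qed (auto simp: one_ereal_def)

lemma pos_notin_nonpos_Ints: "x > 0 \<Longrightarrow> x \<notin> \<int>\<^sub>\<le>\<^sub>0" for x :: real
  by (auto simp: nonpos_Ints_def)

lemma fps_conv_radius_hyp_fps_pos:
  "a > 0 \<Longrightarrow> b > 0 \<Longrightarrow> c > 0 \<Longrightarrow> fps_conv_radius (hyp_fps a b c) = 1"
  by (rule fps_conv_radius_hyp_fps) (auto simp: nonpos_Ints_def)

lemma eval_hyp_fps_ge_1:
  assumes "a > 0" "b > 0" "c > 0" "0 \<le> x" "x < 1"
  shows "eval_fps (hyp_fps a b c) x \<ge> 1"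
proof -
  have "eval_fps (hyp_fps a b c) 0 \<le> eval_fps (hyp_fps a b c) x"
    using assms by (intro eval_fps_mono less_imp_le[OF hyp_fps_nth_pos])
      (auto simp: fps_conv_radius_hyp_fps_pos)
  then show ?thesis by (simp add: eval_fps_at_0)
qed

lemma fps_deriv_hyp_fps:
  "c \<noteq> 0 \<Longrightarrow> fps_deriv (hyp_fps a b c) = fps_const (a * b / c) * hyp_fps (a + 1) (b + 1) (c + 1)"
  by (rule fps_ext) (simp add: hyp_fps_def pochhammer_rec divide_simps)

subsection \<open>Zero-balanced hypergeometric series\<close>

context
  fixes a b :: real
  assumes a: "a > 0" and b: "b > 0"
begin


lemma hyp_fps_balanced_plus1_nth:
  "hyp_fps a b (a + b + 1) $ n = hyp_fps a b (a + b) $ n * ((a + b) / (a + b + n))"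
proof (induction n)
  case (Suc n)
  show ?case unfolding hyp_fps_nth_Suc Suc.IH by (simp add: add_ac mult_ac)
qed (use a b in auto)

lemma hyp_fps_balanced_Suc:
  "real (Suc n) * hyp_fps a b (a + b) $ Suc n =
     real n * hyp_fps a b (a + b) $ n + a * b / (a + b) * hyp_fps a b (a + b + 1) $ n"
proof -
  note hyp_fps_balanced_plus1_nth[of n]
  moreover have "a + b + n > 0" using a b by simp
  moreover have "(a + n) * (b + n) / (a + b + n) = n + a * b / (a + b + n)"
    using a b by (simp add: field_simps)
  moreover have "real (Suc n) * hyp_fps a b (a + b) $ Suc n =
      hyp_fps a b (a + b) $ n * ((a + n) * (b + n) / (a + b + n))"
  proof -
    have "x * (z * (p / (m * x))) = z * (p / m)" if "x \<noteq> 0" for x z p m :: real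
      using that by simp
    from this[of "real (Suc n)"] show ?thesis
      unfolding hyp_fps_nth_Suc by (simp add: add_ac)
  qed
  ultimately show ?thesis
    using a b by (simp only: ring_distribs) (simp add: add_pos_pos)
qed

lemma sum_hyp_fps_balanced:
  "a * b / (a + b) * (\<Sum>k\<le>n. hyp_fps a b (a + b + 1) $ k) =
     real (Suc n) * hyp_fps a b (a + b) $ Suc n"
proof (induction n)
  case (Suc n)
  then show ?case
    using hyp_fps_balanced_Suc[of "Suc n"] by (simp add: ring_distribs)
qed (use hyp_fps_balanced_Suc[of 0] in simp)

lemma fps_deriv_hyp_fps_balanced:
  "fps_deriv (hyp_fps a b (a + b)) * (1 - fps_X) =
     fps_const (a * b / (a + b)) * hyp_fps a b (a + b + 1)"
proof (rule fps_ext)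
  fix n show "(fps_deriv (hyp_fps a b (a + b)) * (1 - fps_X)) $ n =
    (fps_const (a * b / (a + b)) * hyp_fps a b (a + b + 1)) $ n"
    using hyp_fps_balanced_Suc[of n] by (cases n) (simp_all add: ring_distribs)
qed

lemma hyp_fps_balanced_asymp:
  "(\<lambda>n. real (Suc n) * hyp_fps a b (a + b) $ Suc n) \<longlonglongrightarrow> 1 / Beta a b"
proof -
  have "a + b \<notin> \<int>\<^sub>\<le>\<^sub>0" "a \<notin> \<int>\<^sub>\<le>\<^sub>0" "b \<notin> \<int>\<^sub>\<le>\<^sub>0" using a b by (auto simp: nonpos_Ints_def)
  then have lim: "(\<lambda>n. Gamma_series (a + b) n / (Gamma_series a n * Gamma_series b n))
      \<longlonglongrightarrow> Gamma (a + b) / (Gamma a * Gamma b)"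
    by (intro tendsto_intros) (auto simp: Gamma_eq_zero_iff)
  have eq: "Gamma_series (a + b) n / (Gamma_series a n * Gamma_series b n) =
      real (Suc n) * hyp_fps a b (a + b) $ Suc n" for n
  proof -
    define A B C where "A = pochhammer a (n + 1)" "B = pochhammer b (n + 1)"
      "C = pochhammer (a + b) (n + 1)"
    have "A \<noteq> 0" "B \<noteq> 0" "C \<noteq> 0"
      using a b by (auto simp: A_B_C_def pochhammer_eq_0_iff add_nonneg_eq_0_iff)
    then have "Gamma_series (a + b) n / (Gamma_series a n * Gamma_series b n) = A * B / (C * fact n)"
      unfolding Gamma_series_def A_B_C_def[symmetric]
      by (simp add: ring_distribs exp_add field_simps)
    also have "\<dots> = real (Suc n) * (A * B / (C * (real (Suc n) * fact n)))"
      by (simp del: of_nat_Suc)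
    finally show ?thesis
      by (simp add: hyp_fps_def A_B_C_def)
  qed
  show ?thesis using lim unfolding eq by (simp add: Beta_def)
qed

lemma hyp_fps_balanced_plus1_sums: "hyp_fps a b (a + b + 1) $ n \<ge> 0"
  "fps_nth (hyp_fps a b (a + b + 1)) sums ((a + b) / (a * b * Beta a b))"
proof -
  show "hyp_fps a b (a + b + 1) $ n \<ge> 0"
    using hyp_fps_nth_pos[of a b "a + b + 1" n] a b by simp
  have "(\<lambda>n. (a + b) / (a * b) * (real (Suc n) * hyp_fps a b (a + b) $ Suc n))
      \<longlonglongrightarrow> (a + b) / (a * b) * (1 / Beta a b)"
    by (intro tendsto_mult_left hyp_fps_balanced_asymp)
  then show "fps_nth (hyp_fps a b (a + b + 1)) sums ((a + b) / (a * b * Beta a b))"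
    using a b unfolding sums_def_le sum_hyp_fps_balanced[symmetric] by simp
qed

lemma hyp_fps_balanced_not_summable: "\<not> summable (fps_nth (hyp_fps a b (a + b)))"
proof
  assume "summable (fps_nth (hyp_fps a b (a + b)))"
  then have "summable (\<lambda>n. hyp_fps a b (a + b) $ Suc n)"
    by (subst summable_Suc_iff)
  then have "summable (\<lambda>n. (a + b) / (a * b) * hyp_fps a b (a + b) $ Suc n)"
    by (rule summable_mult)
  moreover have "norm (1 / real (Suc n)) \<le> (a + b) / (a * b) * hyp_fps a b (a + b) $ Suc n" for n
  proof -
    have "(\<Sum>k\<in>{0}. hyp_fps a b (a + b + 1) $ k) \<le> (\<Sum>k\<le>n. hyp_fps a b (a + b + 1) $ k)"
      using hyp_fps_balanced_plus1_sums(1) by (intro sum_mono2) auto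
    then have "a * b / (a + b) * 1 \<le> a * b / (a + b) * (\<Sum>k\<le>n. hyp_fps a b (a + b + 1) $ k)"
      using a b by (intro mult_left_mono) auto
    then have "1 \<le> (a + b) / (a * b) * (real (Suc n) * hyp_fps a b (a + b) $ Suc n)"
      unfolding sum_hyp_fps_balanced using a b by (simp add: divide_simps mult_ac del: of_nat_Suc)
    then show ?thesis
      by (simp add: divide_le_eq mult_ac del: of_nat_Suc)
  qed
  ultimately have "summable (\<lambda>n. 1 / real (Suc n))"
    by (rule summable_comparison_test'[where N = 0])
  then have "summable (\<lambda>n. 1 / real n)" 
    by (subst (asm) summable_Suc_iff)
  then show False
    using not_summable_harmonic[where 'a = real] by (simp add: inverse_eq_divide)
qed

lemma Beta_plus_of_nat:
  "Beta a b * hyp_fps a b (a + b) $ n = pochhammer a n / fact n * Beta a (b + n)"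
proof (induction n)
  case (Suc n)
  have "b + real n \<notin> \<int>\<^sub>\<le>\<^sub>0" using b by (auto simp: nonpos_Ints_def)
  from Beta_plus1_right[OF this, of a]
  have "Beta a (b + n + 1) = (b + n) / (a + b + n) * Beta a (b + n)"
    using a b by (simp add: field_simps add_ac)
  moreover have "Beta a b * hyp_fps a b (a + b) $ Suc n =
      pochhammer a n / fact n * Beta a (b + n) * ((a + n) * (b + n) / ((a + b + n) * (n + 1)))"
    unfolding hyp_fps_nth_Suc Suc.IH[symmetric] by (simp add: add_ac mult_ac)
  ultimately show ?case
    by (simp add: pochhammer_Suc add_ac mult_ac)
qed auto

end

lemma hypF_balanced_Suc_eq:
  assumes "a > 0" "b > 0" "0 \<le> x" "x < 1"
  shows "hypF (a + 1) (b + 1) (a + b + 1) x * (1 - x) = hypF a b (a + b + 1) x"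
proof -
  have "fps_conv_radius (1 - fps_X :: real fps) = \<infinity>"
    using fps_conv_radius_diff[of "1 :: real fps" fps_X] by simp
  moreover have "hyp_fps (a + 1) (b + 1) (a + b + 1) * (1 - fps_X) = hyp_fps a b (a + b + 1)"
  proof -
    have c: "fps_const (a * b / (a + b)) \<noteq> 0" using assms by simp
    have "fps_const (a * b / (a + b)) * (hyp_fps (a + 1) (b + 1) (a + b + 1) * (1 - fps_X)) =
        fps_const (a * b / (a + b)) * hyp_fps a b (a + b + 1)"
      using fps_deriv_hyp_fps_balanced[OF assms(1,2)] fps_deriv_hyp_fps[of "a + b" a b] assms
      by (simp add: mult.assoc)
    then show ?thesis by (simp only: mult_left_cancel[OF c])
  qed
  ultimately have "eval_fps (hyp_fps (a + 1) (b + 1) (a + b + 1)) x * (1 - x) = eval_fps (hyp_fps a b (a + b + 1)) x"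
    using assms eval_fps_mult[of x "hyp_fps (a + 1) (b + 1) (a + b + 1)" "1 - fps_X"]
    by (simp add: fps_conv_radius_hyp_fps_pos eval_fps_diff)
  then show ?thesis by (simp add: hypF_eq_eval_hyp_fps)
qed

lemma Beta_real_pos: "a > 0 \<Longrightarrow> b > 0 \<Longrightarrow> Beta a b > (0::real)"
  by (simp add: Beta_def Gamma_real_pos)

context
  fixes a d :: real
  assumes a: "a > 0" and d: "0 \<le> d" "d \<le> 1"
begin


private definition s :: "real \<Rightarrow> nat \<Rightarrow> real" where
  "s b n = pochhammer a n / fact n * (Beta a (b + n) - Beta a (b + 1 + n))"

private definition t :: "real \<Rightarrow> nat \<Rightarrow> real" where
  "t b n = pochhammer a n / fact n * (Beta a (b + n) - Beta a (b + d + n))"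

private lemma s_sums:
  assumes b: "b > 0"
  shows "s b sums (1 / b)"
proof -
  have "s b n = a * Beta a b / (a + b) * hyp_fps a b (a + b + 1) $ n" for n
  proof -
    have "b + real n \<notin> \<int>\<^sub>\<le>\<^sub>0" using b by (auto simp: nonpos_Ints_def)
    from Beta_plus1_right[OF this, of a]
    have "Beta a (b + n + 1) = (b + n) / (a + b + n) * Beta a (b + n)"
      using a b by (simp add: field_simps add_ac)
    then have "Beta a (b + n) - Beta a (b + 1 + n) = a / (a + b + n) * Beta a (b + n)"
      using a b by (simp add: field_simps add_ac)
    then have "s b n = a / (a + b + n) * (Beta a b * hyp_fps a b (a + b) $ n)"
      unfolding s_def Beta_plus_of_nat[OF a b] by (simp add: mult_ac)
    also have "\<dots> = a * Beta a b / (a + b) * hyp_fps a b (a + b + 1) $ n"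
      using a b by (simp add: hyp_fps_balanced_plus1_nth[OF a b])
    finally show ?thesis .
  qed
  moreover have "(\<lambda>n. a * Beta a b / (a + b) * hyp_fps a b (a + b + 1) $ n)
      sums (a * Beta a b / (a + b) * ((a + b) / (a * b * Beta a b)))"
    by (intro sums_mult hyp_fps_balanced_plus1_sums a b)
  moreover have "a * Beta a b / (a + b) * ((a + b) / (a * b * Beta a b)) = 1 / b"
    using a b Beta_real_pos[OF a b] by simp
  ultimately have "(\<lambda>n. s b n) sums (1 / b)" by (simp only: )
  then show ?thesis by simp
qed

private lemma t_bounds:
  assumes "b > 0"
  shows "0 \<le> t b n" "t b n \<le> s b n"
proof -
  have "Beta a (b + d + n) \<le> Beta a (b + n)" "Beta a (b + 1 + n) \<le> Beta a (b + d + n)"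
    using assms a d by (auto intro!: Beta_real_mono)
  then show "0 \<le> t b n" "t b n \<le> s b n"
    unfolding t_def s_def using a
    by (intro mult_nonneg_nonneg mult_left_mono divide_nonneg_pos pochhammer_nonneg; simp)+
qed

private lemma t_summable:
  assumes "b > 0"
  shows "summable (t b)"
  by (rule summable_comparison_test'[OF sums_summable[OF s_sums[OF assms]], of 0])
     (use t_bounds[OF assms] in auto)

text \<open>Both sides have the same increment under \<open>b \<mapsto> b + 1\<close> and lie in \<open>[0, 1/b]\<close>.\<close>

private lemma suminf_t:
  assumes b: "b > 0"
  shows "suminf (t b) = Digamma (b + d) - Digamma b"
proof -
  define E where "E b = suminf (t b) - (Digamma (b + d) - Digamma b)" for b
  have step: "E (b + 1) = E b" if b: "b > 0" for b
  proof -
    have "(\<lambda>n. t b n - t (b + 1) n) sums (suminf (t b) - suminf (t (b + 1)))"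
      using b by (intro sums_diff summable_sums t_summable) auto
    moreover have "(\<lambda>n. s b n - s (b + d) n) sums (1 / b - 1 / (b + d))"
      using b d by (intro sums_diff s_sums) auto
    moreover have "t b n - t (b + 1) n = s b n - s (b + d) n" for n
      by (simp add: s_def t_def algebra_simps)
    ultimately have "suminf (t b) - suminf (t (b + 1)) = 1 / b - 1 / (b + d)"
      by (simp add: sums_iff)
    moreover have "Digamma (b + 1) = Digamma b + 1 / b"
      "Digamma (b + d + 1) = Digamma (b + d) + 1 / (b + d)"
      using b d by (auto intro!: Digamma_plus1)
    ultimately show ?thesis
      by (simp add: E_def add_ac)
  qed
  have bound: "\<bar>E b\<bar> \<le> 1 / b" if b: "b > 0" for b
  proof -
    have "0 \<le> suminf (t b)" "suminf (t b) \<le> suminf (s b)"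
      using b by (intro suminf_nonneg suminf_le t_bounds t_summable sums_summable[OF s_sums]; assumption)+
    moreover have "suminf (s b) = 1 / b" using s_sums[OF b] by (simp add: sums_iff)
    moreover have "Digamma b \<le> Digamma (b + d)" "Digamma (b + d) \<le> Digamma (b + 1)"
      using b d by (auto intro!: Digamma_real_mono)
    moreover have "Digamma (b + 1) = Digamma b + 1 / b"
      using b by (auto intro!: Digamma_plus1)
    ultimately show ?thesis unfolding E_def by linarith
  qed
  have "E (b + real k) = E b" for k
    using step[of "b + real k" for k] b by (induction k) (auto simp: add_ac)
  then have "\<bar>E b\<bar> \<le> 1 / (b + real k)" for k
    using bound[of "b + real k"] b by simp
  moreover have "(\<lambda>k. 1 / (b + real k)) \<longlonglongrightarrow> 0" by real_asymp
  ultimately have "\<bar>E b\<bar> \<le> 0"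
    by (intro tendsto_lowerbound[where f = "\<lambda>k. 1 / (b + real k)" and F = sequentially]) auto
  then show ?thesis by (simp add: E_def)
qed

lemma hyp_fps_balanced_diff_sums_Digamma:
  assumes "b > 0"
  shows "Beta a (b + d) * hyp_fps a (b + d) (a + (b + d)) $ n \<le> Beta a b * hyp_fps a b (a + b) $ n"
    and "(\<lambda>n. Beta a b * hyp_fps a b (a + b) $ n - Beta a (b + d) * hyp_fps a (b + d) (a + (b + d)) $ n)
      sums (Digamma (b + d) - Digamma b)"
proof -
  have eq: "Beta a b * hyp_fps a b (a + b) $ n - Beta a (b + d) * hyp_fps a (b + d) (a + (b + d)) $ n = t b n" for n
    using Beta_plus_of_nat[of a b n] Beta_plus_of_nat[of a "b + d" n] a d assms
    by (simp add: t_def right_diff_distrib)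
  show "Beta a (b + d) * hyp_fps a (b + d) (a + (b + d)) $ n \<le> Beta a b * hyp_fps a b (a + b) $ n"
    using t_bounds(1)[OF assms, of n] eq[of n] by simp
  show "(\<lambda>n. Beta a b * hyp_fps a b (a + b) $ n - Beta a (b + d) * hyp_fps a (b + d) (a + (b + d)) $ n)
      sums (Digamma (b + d) - Digamma b)"
    unfolding eq using summable_sums[OF t_summable[OF assms]] by (simp add: suminf_t[OF assms])
qed

end

subsection \<open>The series of the theorem\<close>

abbreviation G_fps :: "real \<Rightarrow> real fps" where "G_fps a \<equiv> hyp_fps a (1 - a) 1"
abbreviation H_fps :: "real \<Rightarrow> real fps" where "H_fps a \<equiv> hyp_fps a (1 - a) 2"
abbreviation M_fps :: "real \<Rightarrow> real fps" where "M_fps a \<equiv> hyp_fps a (3 / 2 - a) (3 / 2)"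
abbreviation N_fps :: "real \<Rightarrow> real fps" where "N_fps a \<equiv> hyp_fps a (3 / 2 - a) (5 / 2)"

definition q_fps :: "real \<Rightarrow> real fps" where
  "q_fps a = H_fps a * inverse (N_fps a)"

definition f2_fps :: "real \<Rightarrow> real fps" where
  "f2_fps a = fps_const (alpha a) * G_fps a - q_fps a * M_fps a"

lemma alpha_minus_1: "0 < a \<Longrightarrow> a < 1 \<Longrightarrow> alpha a - 1 = a / (3 * (1 - a))"
  by (simp add: alpha_def field_simps)

context
  fixes a :: real
  assumes a: "0 < a" "a < 1"
begin

private abbreviation "G \<equiv> G_fps a"
private abbreviation "H \<equiv> H_fps a"
private abbreviation "M \<equiv> M_fps a"
private abbreviation "N \<equiv> N_fps a"
private abbreviation "q \<equiv> q_fps a"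
private abbreviation "A \<equiv> f2_fps a"

lemma alpha_gt_1: "alpha a > 1"
  using a by (simp add: alpha_def field_simps)

lemma GHMN_nth_pos: "G $ n > 0" "H $ n > 0" "M $ n > 0" "N $ n > 0"
  using a by (auto intro!: hyp_fps_nth_pos)

lemma GHMN_radius:
  "fps_conv_radius G = 1" "fps_conv_radius H = 1" "fps_conv_radius M = 1" "fps_conv_radius N = 1"
  using a by (auto intro!: fps_conv_radius_hyp_fps_pos)

lemma GHMN_ge_1:
  assumes "0 \<le> x" "x < 1"
  shows "eval_fps G x \<ge> 1" "eval_fps H x \<ge> 1" "eval_fps M x \<ge> 1" "eval_fps N x \<ge> 1"
  using a assms by (auto intro!: eval_hyp_fps_ge_1)

lemma N_ratio: "incseq (\<lambda>n. N $ Suc n / N $ n)"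
proof (rule incseq_SucI)
  fix n
  have ratio: "N $ Suc n / N $ n = (a + n) / (real n + 1) * ((3 / 2 - a + n) / (5 / 2 + n))" for n
    using GHMN_nth_pos(4)[of n] by (simp add: hyp_fps_nth_Suc mult_ac)
  have "(a + n) / (real n + 1) \<le> (a + Suc n) / (Suc n + 1)"
    "(3 / 2 - a + n) / (5 / 2 + n) \<le> (3 / 2 - a + Suc n) / (5 / 2 + Suc n)"
    using a by (simp_all add: divide_simps) (simp_all add: algebra_simps)
  then show "N $ Suc n / N $ n \<le> N $ Suc (Suc n) / N $ Suc n"
    unfolding ratio using a by (intro mult_mono) auto
qed

lemma HN_ratio: "H $ Suc n / N $ Suc n < H $ n / N $ n"
proof -
  have pos: "2 + real n > 0" "3 / 2 - a + n > 0" "a + n > 0" "5 / 2 + real n > 0" "real n + 1 > 0"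
    using a by auto
  have "H $ Suc n / N $ Suc n = H $ n / N $ n *
      (((a + n) * (1 - a + n) / ((2 + real n) * (real n + 1))) / ((a + n) * (3 / 2 - a + n) / ((5 / 2 + n) * (real n + 1))))"
    unfolding hyp_fps_nth_Suc by (rule times_divide_times_eq[symmetric])
  also have "((a + n) * (1 - a + n) / ((2 + real n) * (real n + 1))) / ((a + n) * (3 / 2 - a + n) / ((5 / 2 + n) * (real n + 1)))
      = ((1 - a + n) * (5 / 2 + n)) / ((2 + real n) * (3 / 2 - a + n))"
    using pos by (simp add: divide_simps)
  also have "H $ n / N $ n * \<dots> < H $ n / N $ n * 1"
  proof (rule mult_strict_left_mono)
    have "(2 + real n) * (3 / 2 - a + n) - (1 - a + n) * (5 / 2 + n) = (a + 1) / 2"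
      by (simp add: field_simps)
    then have "(1 - a + n) * (5 / 2 + n) < (2 + real n) * (3 / 2 - a + n)"
      using a by simp
    then show "((1 - a + n) * (5 / 2 + n)) / ((2 + real n) * (3 / 2 - a + n)) < 1"
      using pos by (simp add: divide_simps)
  qed (use GHMN_nth_pos in simp)
  finally show ?thesis by simp
qed

lemma q_nth_0: "q $ 0 = 1"
  unfolding q_fps_def
  by (rule fps_quotient_nth_0) (use N_ratio HN_ratio GHMN_nth_pos in auto)

lemma q_nth_neg: "n > 0 \<Longrightarrow> q $ n < 0"
  unfolding q_fps_def
  by (rule fps_quotient_nth_neg) (use N_ratio HN_ratio GHMN_nth_pos in auto)

lemma q_nth_ge: "- N $ n \<le> q $ n"
  unfolding q_fps_def
  by (rule fps_quotient_nth_ge) (use N_ratio HN_ratio GHMN_nth_pos in auto)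

lemma q_mult_N: "q * N = H"
  by (simp add: q_fps_def mult.assoc inverse_mult_eq_1)

lemma N_sums: "fps_nth N sums (3 / (a * (3 - 2 * a) * Beta a (3 / 2 - a)))"
proof -
  have eq: "2 * (a * (3 / 2 - a) * Beta a (3 / 2 - a)) = a * (3 - 2 * a) * Beta a (3 / 2 - a)"
    by (simp add: algebra_simps)
  have "fps_nth N sums (3 / (2 * (a * (3 / 2 - a) * Beta a (3 / 2 - a))))"
    using hyp_fps_balanced_plus1_sums(2)[of a "3/2 - a"] a by simp
  then show ?thesis by (simp only: eq)
qed

lemma H_sums: "fps_nth H sums (1 / (a * (1 - a) * Beta a (1 - a)))"
  using hyp_fps_balanced_plus1_sums(2)[of a "1 - a"] a by simp

lemma q_radius: "fps_conv_radius q \<ge> 1"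
proof (rule fps_conv_radius_ge_1I)
  fix n
  have "\<bar>q $ n\<bar> \<le> N $ n"
    using q_nth_ge[of n] q_nth_neg[of n] q_nth_0 by (cases "n = 0") auto
  also have "\<dots> \<le> suminf (fps_nth N)"
    using sum_le_suminf[OF sums_summable[OF N_sums], of "{n}"] GHMN_nth_pos(4)
    by (auto intro: less_imp_le)
  finally show "\<bar>q $ n\<bar> \<le> suminf (fps_nth N)" .
qed

lemma in_q_radius: "\<bar>x\<bar> < 1 \<Longrightarrow> ereal \<bar>x\<bar> < fps_conv_radius q"
  by (rule less_le_trans[OF _ q_radius]) auto

lemma eval_q_mult_N: "\<bar>x\<bar> < 1 \<Longrightarrow> eval_fps q x * eval_fps N x = eval_fps H x"
  using in_q_radius[of x] by (simp add: q_mult_N[symmetric] eval_fps_mult GHMN_radius)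

lemma f2_fps_radius: "fps_conv_radius A \<ge> 1"
proof -
  have "1 \<le> min (fps_conv_radius q) (fps_conv_radius M)"
    using q_radius GHMN_radius by simp
  also have "\<dots> \<le> fps_conv_radius (q * M)" by (rule fps_conv_radius_mult)
  finally have "1 \<le> min (fps_conv_radius (fps_const (alpha a) * G)) (fps_conv_radius (q * M))"
    using alpha_gt_1 GHMN_radius by (simp add: fps_conv_radius_cmult_left)
  also have "\<dots> \<le> fps_conv_radius A"
    unfolding f2_fps_def by (rule fps_conv_radius_diff)
  finally show ?thesis .
qed

lemma in_f2_radius: "\<bar>x\<bar> < 1 \<Longrightarrow> ereal \<bar>x\<bar> < fps_conv_radius A"
  by (rule less_le_trans[OF _ f2_fps_radius]) auto

lemma eval_f2_fps:
  assumes "\<bar>x\<bar> < 1"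
  shows "eval_fps A x = alpha a * eval_fps G x - eval_fps q x * eval_fps M x"
proof -
  have "ereal \<bar>x\<bar> < fps_conv_radius (q * M)"
    using assms in_q_radius[of x] by (intro less_le_trans[OF _ fps_conv_radius_mult]) (auto simp: GHMN_radius)
  then show ?thesis
    using assms in_q_radius[of x] alpha_gt_1 unfolding f2_fps_def
    by (simp add: eval_fps_diff eval_fps_mult GHMN_radius fps_conv_radius_cmult_left)
qed

lemma f2_eq_eval_if_nz:
  assumes "\<bar>x\<bar> < 1" "eval_fps G x \<noteq> 0" "eval_fps N x \<noteq> 0"
  shows "f2 a x = eval_fps A x"
    "hypF a (1 - a) 2 x / hypF a (3 / 2 - a) (5 / 2) x = eval_fps q x"
proof -
  have quot: "eval_fps q x = eval_fps H x / eval_fps N x"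
    using eval_q_mult_N[OF assms(1)] assms(3) by (simp add: eq_divide_eq)
  then show "hypF a (1 - a) 2 x / hypF a (3 / 2 - a) (5 / 2) x = eval_fps q x"
    by (simp add: hypF_eq_eval_hyp_fps)
  have "Lambda1 a x = eval_fps q x * eval_fps M x"
    using assms(2) by (simp add: quot Lambda1_def Lambda_def hypF_eq_eval_hyp_fps)
  then show "f2 a x = eval_fps A x"
    by (simp add: f2_def hypF_eq_eval_hyp_fps eval_f2_fps[OF assms(1)])
qed

lemma f2_eq_eval: "0 \<le> x \<Longrightarrow> x < 1 \<Longrightarrow> f2 a x = eval_fps A x"
  using GHMN_ge_1[of x] by (intro f2_eq_eval_if_nz) auto

lemma f2_eq_eval_near_0:
  obtains e where "0 < e" "e \<le> 1" "\<And>x. \<bar>x\<bar> < e \<Longrightarrow> f2 a x = eval_fps A x"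
    "\<And>x. \<bar>x\<bar> < e \<Longrightarrow> hypF a (1 - a) 2 x / hypF a (3 / 2 - a) (5 / 2) x = eval_fps q x"
proof -
  have "isCont (eval_fps G) 0" "isCont (eval_fps N) 0"
    by (auto intro!: continuous_eval_fps simp: GHMN_radius)
  then have "\<forall>\<^sub>F x in nhds 0. eval_fps G x \<noteq> 0" "\<forall>\<^sub>F x in nhds 0. eval_fps N x \<noteq> 0"
    unfolding isCont_def tendsto_at_iff_tendsto_nhds
    by (auto intro!: tendsto_imp_eventually_ne simp: eval_fps_at_0)
  then have "\<forall>\<^sub>F x in nhds 0. eval_fps G x \<noteq> 0 \<and> eval_fps N x \<noteq> 0"
    by (rule eventually_conj)
  then obtain e where e: "e > 0" "\<And>x. \<bar>x\<bar> < e \<Longrightarrow> eval_fps G x \<noteq> 0 \<and> eval_fps N x \<noteq> 0"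
    by (auto simp: eventually_nhds_metric)
  show thesis
    by (rule that[of "min e 1"]) (use e f2_eq_eval_if_nz in auto)
qed

lemma acoeff_eq: "acoeff a n = A $ n"
proof -
  obtain e where "0 < e" "e \<le> 1" "\<And>x. \<bar>x\<bar> < e \<Longrightarrow> f2 a x = eval_fps A x"
    "\<And>x. \<bar>x\<bar> < e \<Longrightarrow> hypF a (1 - a) 2 x / hypF a (3 / 2 - a) (5 / 2) x = eval_fps q x"
    using f2_eq_eval_near_0 by blast
  then show ?thesis
    unfolding acoeff_def using f2_fps_radius
    by (intro maclaurin_coeff_eqI) (auto intro: less_le_trans[of 0 1])
qed

lemma acoeff1_eq: "acoeff1 a n = q $ n"
proof -
  obtain e where "0 < e" "e \<le> 1"
    "\<And>x. \<bar>x\<bar> < e \<Longrightarrow> f2 a x = eval_fps A x"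
    "\<And>x. \<bar>x\<bar> < e \<Longrightarrow> hypF a (1 - a) 2 x / hypF a (3 / 2 - a) (5 / 2) x = eval_fps q x"
    using f2_eq_eval_near_0 by blast
  then show ?thesis
    unfolding acoeff1_def using q_radius
    by (intro maclaurin_coeff_eqI) (auto intro: less_le_trans[of 0 1])
qed

text \<open>Both sides of \<open>\<alpha> G' = q M'\<close> equal \<open>a (3 - 2 a) / 3\<close> times \<open>H / (1 - x)\<close>.\<close>

lemma fps_deriv_f2_fps: "fps_deriv A = - (fps_deriv q * M)"
proof -
  have "(fps_const (alpha a) * fps_deriv G) * (1 - fps_X) = fps_const (a * (3 - 2 * a) / 3) * H"
  proof -
    have "alpha a * (a * (1 - a)) = a * (3 - 2 * a) / 3"
      using a by (simp add: alpha_def field_simps)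
    moreover have "fps_deriv G * (1 - fps_X) = fps_const (a * (1 - a)) * H"
      using fps_deriv_hyp_fps_balanced[of a "1 - a"] a by simp
    ultimately show ?thesis
      by (simp only: mult.assoc) (simp only: mult.assoc[symmetric] fps_const_mult)
  qed
  moreover have "(q * fps_deriv M) * (1 - fps_X) = fps_const (a * (3 - 2 * a) / 3) * H"
  proof -
    have "a * (3 / 2 - a) / (3 / 2) = a * (3 - 2 * a) / 3" by (simp add: field_simps)
    moreover have "a + (3/2 - a) = 3/2" "a + (3/2 - a) + 1 = 5 / 2" by auto
    ultimately have "fps_deriv M * (1 - fps_X) = fps_const (a * (3 - 2 * a) / 3) * N"
      using fps_deriv_hyp_fps_balanced[of a "3/2 - a"] a by simp
    then show ?thesis
      by (simp add: mult.assoc) (simp add: q_mult_N[symmetric] mult_ac)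
  qed
  moreover have "1 - fps_X \<noteq> (0 :: real fps)"
    by (metis eq_iff_diff_eq_0 fps_X_neq_one)
  ultimately have "fps_const (alpha a) * fps_deriv G = q * fps_deriv M"
    by (metis mult_right_cancel)
  then show ?thesis
    by (simp add: f2_fps_def algebra_simps)
qed

lemma f2_fps_nth_0: "A $ 0 = alpha a - 1"
  by (simp add: f2_fps_def q_nth_0)

lemma f2_fps_nth:
  assumes "k > 0"
  shows "A $ k = 1 / real k * (\<Sum>i<k. (real i + 1) * M $ (k - i - 1) * \<bar>q $ (i + 1)\<bar>)"
proof -
  obtain m where k: "k = Suc m" using assms by (cases k) auto
  have "real k * A $ k = fps_deriv A $ m" by (simp add: k)
  also have "\<dots> = (\<Sum>i<k. - (real (i + 1) * q $ (i + 1) * M $ (m - i)))"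
    by (simp add: fps_deriv_f2_fps fps_mult_nth k lessThan_Suc_atMost atLeast0AtMost sum_negf
        del: sum.lessThan_Suc sum.atMost_Suc of_nat_Suc)
  also have "\<dots> = (\<Sum>i<k. (real i + 1) * M $ (k - i - 1) * \<bar>q $ (i + 1)\<bar>)"
    by (rule sum.cong) (use q_nth_neg in \<open>auto simp: k abs_of_neg add_ac mult_ac\<close>)
  finally show ?thesis
    using assms by (simp add: field_simps)
qed

lemma f2_fps_nth_pos: "A $ k > 0"
proof (cases "k = 0")
  case False
  have "(\<Sum>i<k. (real i + 1) * M $ (k - i - 1) * \<bar>q $ (i + 1)\<bar>) > 0"
  proof (rule sum_pos)
    fix i
    have "q $ (i + 1) \<noteq> 0" using q_nth_neg[of "i + 1"] by auto
    then show "(real i + 1) * M $ (k - i - 1) * \<bar>q $ (i + 1)\<bar> > 0"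
      using GHMN_nth_pos(3)[of "k - i - 1"] by auto
  qed (use False in auto)
  then show ?thesis
    using False by (subst f2_fps_nth) auto
qed (use f2_fps_nth_0 alpha_gt_1 in auto)

lemma q_nth_1: "q $ 1 = - (a * (a + 1) / 10)"
proof -
  have "H $ 1 = N $ 1 + q $ 1"
    by (simp add: q_mult_N[symmetric] fps_mult_nth q_nth_0)
  then have "q $ 1 = H $ 1 - N $ 1" by simp
  also have "\<dots> = - (a * (a + 1) / 10)"
    by (simp add: hyp_fps_nth_Suc) (simp add: field_simps)
  finally show ?thesis .
qed

lemma q_nth_2: "q $ 2 = a * (a + 1) * ((1 - a) * (2 - a) / 12 - (3 - 2 * a) * (5 - 2 * a) / 70
    + a * (3 - 2 * a) / 50)"
proof -
  have "H $ 2 = N $ 2 + q $ 1 * N $ 1 + q $ 2"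
    by (simp add: q_mult_N[symmetric] fps_mult_nth q_nth_0 numeral_2_eq_2)
  then have "q $ 2 = H $ 2 - N $ 2 - q $ 1 * N $ 1" by simp
  also have "H $ 2 = a * (1 - a) / 2 * ((a + 1) * (2 - a) / 6)"
    by (simp add: numeral_2_eq_2 hyp_fps_nth_Suc field_simps)
  also have "N $ 2 = a * (3 - 2 * a) / 5 * ((a + 1) * (5 - 2 * a) / 14)"
    by (simp add: numeral_2_eq_2 hyp_fps_nth_Suc field_simps)
  also have "N $ 1 = a * (3 - 2 * a) / 5"
    by (simp add: hyp_fps_nth_Suc field_simps)
  finally show ?thesis
    unfolding q_nth_1 by (simp add: field_simps)
qed

lemma f2_fps_nth_1: "A $ 1 = a * (a + 1) / 10"
  using f2_fps_nth[of 1] q_nth_1 a by simp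

lemma f2_fps_nth_2: "A $ 2 = a * (a + 1) * (- 41 * a\<^sup>2 + 24 * a + 100) / 2100"
proof -
  have "A $ 2 = 1 / 2 * (M $ 1 * \<bar>q $ 1\<bar> + 2 * \<bar>q $ 2\<bar>)"
    using f2_fps_nth[of 2] by (simp add: numeral_2_eq_2)
  also have "\<bar>q $ 1\<bar> = - (q $ 1)"
    using q_nth_neg[of 1] by auto
  also have "\<bar>q $ 2\<bar> = - (q $ 2)"
    using q_nth_neg[of 2] by auto
  also have "M $ 1 = a * (3 - 2 * a) / 3"
    by (simp add: hyp_fps_nth_Suc field_simps)
  finally have eq: "A $ 2 = 1 / 2 * (a * (3 - 2 * a) / 3 * - (q $ 1) + 2 * - (q $ 2))" .
  show ?thesis
    unfolding eq q_nth_1 q_nth_2 by (simp add: field_simps power2_eq_square)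
qed

lemma eval_q_antimono:
  assumes "0 \<le> x" "x \<le> y" "y < 1"
  shows "eval_fps q y \<le> eval_fps q x"
proof -
  have "1 \<le> min (fps_conv_radius (1 :: real fps)) (fps_conv_radius q)"
    using q_radius by simp
  also have "\<dots> \<le> fps_conv_radius (1 - q)"
    by (rule fps_conv_radius_diff)
  finally have "1 \<le> fps_conv_radius (1 - q)" .
  then have "ereal y < fps_conv_radius (1 - q)"
    using assms by (intro less_le_trans[of "ereal y" 1 "fps_conv_radius (1 - q)"]) simp_all
  moreover have "(1 - q) $ k \<ge> 0" for k
    using q_nth_neg[of k] q_nth_0 by (cases "k = 0") auto
  ultimately have "eval_fps (1 - q) x \<le> eval_fps (1 - q) y"
    using assms by (intro eval_fps_mono)
  then show ?thesis
    using in_q_radius[of x] in_q_radius[of y] assms by (simp add: eval_fps_diff)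
qed

private definition q1 :: real where
  "q1 = alpha a * Beta a (3 / 2 - a) / Beta a (1 - a)"

private lemma q_tendsto: "(eval_fps q \<longlongrightarrow> q1) (at_left 1)"
proof -
  have "Beta a (1 - a) > 0" "Beta a (3 / 2 - a) > 0"
    using a by (auto intro!: Beta_real_pos)
  then have "1 / (a * (1 - a) * Beta a (1 - a)) / (3 / (a * (3 - 2 * a) * Beta a (3 / 2 - a))) = q1"
    using a by (simp add: q1_def alpha_def)
  moreover have "(eval_fps H \<longlongrightarrow> 1 / (a * (1 - a) * Beta a (1 - a))) (at_left 1)"
    "(eval_fps N \<longlongrightarrow> 3 / (a * (3 - 2 * a) * Beta a (3 / 2 - a))) (at_left 1)"
    using eval_fps_tendsto_at_left_1[of H, OF less_imp_le[OF GHMN_nth_pos(2)]] H_sums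
      eval_fps_tendsto_at_left_1[of N, OF less_imp_le[OF GHMN_nth_pos(4)]] N_sums
    by (simp_all add: sums_iff)
  ultimately have "((\<lambda>x. eval_fps H x / eval_fps N x) \<longlongrightarrow> q1) (at_left 1)"
    using a \<open>Beta a (3 / 2 - a) > 0\<close> by (auto intro!: tendsto_eq_intros)
  moreover have "\<forall>\<^sub>F x in at_left 1. eval_fps H x / eval_fps N x = eval_fps q x"
    using eventually_at_left_1
  proof eventually_elim
    case (elim x)
    then show ?case
      using eval_q_mult_N[of x] GHMN_ge_1(4)[of x] by (simp add: divide_eq_eq)
  qed
  ultimately show ?thesis
    by (rule Lim_transform_eventually)
qed

private lemma q_ge_q1:
  assumes "0 \<le> x" "x < 1"
  shows "q1 \<le> eval_fps q x"
proof (rule tendsto_upperbound[OF q_tendsto])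
  show "\<forall>\<^sub>F y in at_left 1. eval_fps q y \<le> eval_fps q x"
    using eventually_at_left_real[OF assms(2)]
    by eventually_elim (use assms in \<open>auto intro!: eval_q_antimono\<close>)
qed auto

private definition D :: "real fps" where
  "D = fps_const (Beta a (1 - a)) * G - fps_const (Beta a (3 / 2 - a)) * M"

private lemma D_sums:
  "D $ n \<ge> 0" "fps_nth D sums (beta a * Beta a (1 - a))"
proof -
  have "1 - a + 1/2 = 3/2 - a" "a + (3 / 2 - a) = 3/2" by simp_all
  moreover have "fps_nth D = (\<lambda>n. Beta a (1 - a) * G $ n - Beta a (3 / 2 - a) * M $ n)"
    by (simp add: D_def fun_eq_iff)
  ultimately show "D $ n \<ge> 0" "fps_nth D sums (beta a * Beta a (1 - a))"
    using hyp_fps_balanced_diff_sums_Digamma(1)[of a "1/2" "1 - a" n]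
      hyp_fps_balanced_diff_sums_Digamma(2)[of a "1/2" "1 - a"] Beta_real_pos[of a "1 - a"] a
    by (simp_all add: beta_def)
qed

private lemma eval_D:
  assumes "0 \<le> x" "x < 1"
  shows "alpha a / Beta a (1 - a) * eval_fps D x = alpha a * eval_fps G x - q1 * eval_fps M x"
proof -
  have B: "Beta a (1 - a) > 0" "Beta a (3 / 2 - a) > 0"
    using a by (auto intro!: Beta_real_pos)
  then have "eval_fps D x = Beta a (1 - a) * eval_fps G x - Beta a (3 / 2 - a) * eval_fps M x"
    using assms unfolding D_def
    by (subst eval_fps_diff) (auto simp: eval_fps_mult GHMN_radius fps_conv_radius_cmult_left)
  then show ?thesis
    using B by (simp add: q1_def right_diff_distrib)
qed

lemma eval_f2_fps_le:
  assumes "0 \<le> x" "x < 1"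
  shows "eval_fps A x \<le> alpha a * beta a"
proof -
  have B: "Beta a (1 - a) > 0" using a by (auto intro!: Beta_real_pos)
  have "eval_fps A x \<le> alpha a * eval_fps G x - q1 * eval_fps M x"
    using assms q_ge_q1[OF assms] GHMN_ge_1[OF assms]
    by (simp add: eval_f2_fps mult_right_mono)
  also have "\<dots> = alpha a / Beta a (1 - a) * eval_fps D x"
    by (rule eval_D[OF assms, symmetric])
  also have "eval_fps D x \<le> beta a * Beta a (1 - a)"
    using eval_fps_le_suminf[of D x] D_sums assms by (simp add: sums_iff)
  then have "alpha a / Beta a (1 - a) * eval_fps D x
      \<le> alpha a / Beta a (1 - a) * (beta a * Beta a (1 - a))"
    using B alpha_gt_1 by (intro mult_left_mono) auto
  finally show ?thesis using B by simp
qed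

lemma f2_fps_summable: "summable (fps_nth A)"
  and f2_fps_suminf_le: "(\<Sum>k. A $ k) \<le> alpha a * beta a"
proof -
  have "\<And>x. 0 < x \<Longrightarrow> x < 1 \<Longrightarrow> eval_fps A x \<le> alpha a * beta a"
    by (intro eval_f2_fps_le) auto
  from summable_fps_nth_if_bounded[OF less_imp_le[OF f2_fps_nth_pos] f2_fps_radius this]
  show "summable (fps_nth A)" "(\<Sum>k. A $ k) \<le> alpha a * beta a" by auto
qed

text \<open>The function \<open>A + M(x) q\<close> has derivative \<open>(M(x) - M) q' \<ge> 0\<close> to the right of \<open>x\<close>.\<close>

private lemma q_diff_mult_M_le:
  assumes "0 \<le> x" "x \<le> y" "y < 1"
  shows "(eval_fps q x - eval_fps q y) * eval_fps M x \<le> eval_fps A y - eval_fps A x"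
proof -
  have "eval_fps A x + eval_fps M x * eval_fps q x \<le> eval_fps A y + eval_fps M x * eval_fps q y"
  proof (rule DERIV_nonneg_imp_nondecreasing[OF assms(2)])
    fix t assume t: "x \<le> t" "t \<le> y"
    then have t1: "\<bar>t\<bar> < 1" using assms by auto
    have rad: "ereal \<bar>t\<bar> < fps_conv_radius (fps_deriv q)"
      by (rule less_le_trans[OF in_q_radius[OF t1] fps_conv_radius_deriv])
    have "(eval_fps A has_real_derivative eval_fps (fps_deriv A) t) (at t)"
      "(eval_fps q has_real_derivative eval_fps (fps_deriv q) t) (at t)"
      using in_f2_radius[OF t1] in_q_radius[OF t1] by (auto intro!: has_field_derivative_eval_fps)
    then have "((\<lambda>t. eval_fps A t + eval_fps M x * eval_fps q t) has_real_derivative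
        eval_fps (fps_deriv A) t + eval_fps M x * eval_fps (fps_deriv q) t) (at t)"
      by (auto intro!: derivative_eq_intros)
    moreover have "eval_fps (fps_deriv A) t = - (eval_fps (fps_deriv q) t * eval_fps M t)"
    proof -
      have "ereal \<bar>t\<bar> < min (fps_conv_radius (fps_deriv q)) (fps_conv_radius M)"
        using rad t1 by (simp add: GHMN_radius)
      also have "\<dots> \<le> fps_conv_radius (fps_deriv q * M)" by (rule fps_conv_radius_mult)
      finally show ?thesis
        using rad t1 by (simp add: fps_deriv_f2_fps eval_fps_minus eval_fps_mult GHMN_radius)
    qed
    moreover have "eval_fps (fps_deriv q) t \<le> 0"
    proof -
      have "eval_fps (- fps_deriv q) t \<ge> 0"
      proof (rule eval_fps_nonneg)
        show "(- fps_deriv q) $ k \<ge> 0" for k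
          using q_nth_neg[of "k + 1"] by (auto simp: mult_nonneg_nonpos)
        show "ereal t < fps_conv_radius (- fps_deriv q)"
          using rad t assms by simp
      qed (use t assms in auto)
      then show ?thesis using rad by (simp add: eval_fps_minus)
    qed
    moreover have "eval_fps M x \<le> eval_fps M t"
      using t assms GHMN_nth_pos by (intro eval_fps_mono) (auto simp: GHMN_radius intro: less_imp_le)
    ultimately show "\<exists>z. ((\<lambda>t. eval_fps A t + eval_fps M x * eval_fps q t) has_real_derivative z) (at t)
        \<and> 0 \<le> z"
      by (intro exI conjI) (assumption, auto simp: mult.commute mult_left_mono_neg)
  qed
  then show ?thesis by (simp add: algebra_simps)
qed

lemma f2_fps_sums: "fps_nth A sums (alpha a * beta a)"
proof -
  have B: "Beta a (1 - a) > 0" using a by (auto intro!: Beta_real_pos)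
  have le: "alpha a / Beta a (1 - a) * eval_fps D x \<le> (\<Sum>k. A $ k)" if x: "0 \<le> x" "x < 1" for x
  proof -
    have "(eval_fps q x - q1) * eval_fps M x \<le> (\<Sum>k. A $ k) - eval_fps A x"
    proof (rule tendsto_upperbound)
      show "((\<lambda>y. (eval_fps q x - eval_fps q y) * eval_fps M x) \<longlongrightarrow>
          (eval_fps q x - q1) * eval_fps M x) (at_left 1)"
        by (intro tendsto_intros q_tendsto)
      show "\<forall>\<^sub>F y in at_left 1. (eval_fps q x - eval_fps q y) * eval_fps M x
          \<le> (\<Sum>k. A $ k) - eval_fps A x"
        using eventually_at_left_real[OF x(2)]
      proof eventually_elim
        case (elim y)
        have "eval_fps A y \<le> (\<Sum>k. A $ k)"
          using elim x f2_fps_nth_pos by (intro eval_fps_le_suminf f2_fps_summable) (auto intro: less_imp_le)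
        then show ?case using q_diff_mult_M_le[of x y] elim x by auto
      qed
    qed auto
    then show ?thesis
      unfolding eval_D[OF x] using x by (simp add: eval_f2_fps algebra_simps)
  qed
  have "alpha a / Beta a (1 - a) * (beta a * Beta a (1 - a)) \<le> (\<Sum>k. A $ k)"
  proof (rule tendsto_upperbound)
    have "(eval_fps D \<longlongrightarrow> beta a * Beta a (1 - a)) (at_left 1)"
      using eval_fps_tendsto_at_left_1[of D] D_sums by (simp add: sums_iff)
    then show "((\<lambda>x. alpha a / Beta a (1 - a) * eval_fps D x) \<longlongrightarrow>
        alpha a / Beta a (1 - a) * (beta a * Beta a (1 - a))) (at_left 1)"
      by (rule tendsto_mult_left)
    show "\<forall>\<^sub>F x in at_left 1. alpha a / Beta a (1 - a) * eval_fps D x \<le> (\<Sum>k. A $ k)"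
      using eventually_at_left_1 by eventually_elim (rule le, auto)
  qed auto
  then have "(\<Sum>k. A $ k) = alpha a * beta a"
    using f2_fps_suminf_le B by simp
  then show ?thesis
    using f2_fps_summable by (simp add: sums_iff)
qed

end

subsection \<open>Bounds for \<open>f\<^sub>2\<close>\<close>

lemma eval_fps_tail_bounds:
  fixes F :: "real fps"
  assumes pos: "\<And>k. F $ k > 0" and sums: "fps_nth F sums S" and x: "0 < x" "x < 1"
  shows "F $ m * x ^ m < eval_fps F x - (\<Sum>k<m. F $ k * x ^ k)"
    and "eval_fps F x - (\<Sum>k<m. F $ k * x ^ k) < (S - (\<Sum>k<m. F $ k)) * x ^ m"
proof -
  define g where "g k = F $ (k + m)" for k
  have g: "summable g" "g k > 0" for k
    using sums_summable[OF sums] pos unfolding g_def[abs_def] by (simp_all only: summable_iff_shift)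
  have gx: "summable (\<lambda>k. g k * x ^ k)"
    by (rule summable_comparison_test'[OF g(1), of 0])
      (use g(2) x in \<open>auto simp: less_imp_le abs_mult intro!: mult_left_le power_le_one\<close>)
  have Fx: "summable (\<lambda>k. F $ k * x ^ k)"
    by (rule summable_comparison_test'[OF sums_summable[OF sums], of 0])
      (use pos x in \<open>auto simp: less_imp_le abs_mult intro!: mult_left_le power_le_one\<close>)
  have eq: "eval_fps F x - (\<Sum>k<m. F $ k * x ^ k) = x ^ m * (\<Sum>k. g k * x ^ k)"
    unfolding eval_fps_def suminf_minus_initial_segment[OF Fx, symmetric]
    by (subst suminf_mult[OF gx, symmetric]) (simp add: g_def power_add mult_ac)
  have "(\<Sum>k. g (Suc k) * x ^ Suc k) > 0"
  proof (rule suminf_pos)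
    show "summable (\<lambda>k. g (Suc k) * x ^ Suc k)"
      using gx by (subst summable_Suc_iff)
  qed (use g x in auto)
  then have "g 0 < (\<Sum>k. g k * x ^ k)"
    using suminf_split_head[OF gx] by simp
  then show "F $ m * x ^ m < eval_fps F x - (\<Sum>k<m. F $ k * x ^ k)"
    unfolding eq using x by (simp add: g_def)
  have "(\<Sum>k. g k - g k * x ^ k) > 0"
  proof (rule suminf_pos2[where i = 1])
    show "0 \<le> g k - g k * x ^ k" for k
      using g(2)[of k] x by (simp add: mult_left_le power_le_one less_imp_le)
    show "0 < g 1 - g 1 * x ^ 1"
      using g(2)[of 1] x by (simp add: mult_left_le power_le_one less_imp_le)
  qed (intro summable_diff g gx)
  then have "(\<Sum>k. g k * x ^ k) < suminf g"
    using suminf_diff[OF g(1) gx] by simp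
  also have "suminf g = S - (\<Sum>k<m. F $ k)"
    unfolding g_def using suminf_minus_initial_segment[OF sums_summable[OF sums], of m] sums
    by (simp add: sums_iff)
  finally show "eval_fps F x - (\<Sum>k<m. F $ k * x ^ k) < (S - (\<Sum>k<m. F $ k)) * x ^ m"
    unfolding eq using x by (simp add: mult.commute)
qed

lemma eval_fps_strict_mono_near_0:
  fixes F :: "real fps"
  assumes rad: "fps_conv_radius F \<ge> 1" and pos: "F $ 1 > 0"
  obtains r where "0 < r" "r < 1" "strict_mono_on {0..r} (eval_fps F)"
proof -
  have rad': "fps_conv_radius (fps_deriv F) \<ge> 1"
    using rad fps_conv_radius_deriv[of F] by (rule order_trans)
  then have "isCont (eval_fps (fps_deriv F)) 0"
    by (intro continuous_eval_fps less_le_trans[OF _ rad']) auto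
  then have "\<forall>\<^sub>F x in nhds 0. eval_fps (fps_deriv F) x > 0"
    unfolding isCont_def tendsto_at_iff_tendsto_nhds
    by (rule order_tendstoD) (use pos in \<open>auto simp: eval_fps_at_0\<close>)
  then obtain e where e: "e > 0" "\<And>x. \<bar>x\<bar> < e \<Longrightarrow> eval_fps (fps_deriv F) x > 0"
    by (auto simp: eventually_nhds_metric)
  define r where "r = min (1/2) (e/2)"
  have r: "0 < r" "r < 1" "r < e" using e by (auto simp: r_def)
  have "strict_mono_on {0..r} (eval_fps F)"
  proof (rule strict_mono_onI)
    fix x y assume xy: "x \<in> {0..r}" "y \<in> {0..r}" "x < y"
    show "eval_fps F x < eval_fps F y"
    proof (rule DERIV_pos_imp_increasing[OF xy(3)])
      fix t assume t: "x \<le> t" "t \<le> y"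
      then have "ereal (norm t) < fps_conv_radius F"
        using xy r by (intro less_le_trans[OF _ rad]) auto
      then show "\<exists>z. (eval_fps F has_real_derivative z) (at t) \<and> 0 < z"
        using e(2)[of t] t xy r by (intro exI[of _ "eval_fps (fps_deriv F) t"])
          (auto intro!: has_field_derivative_eval_fps)
    qed
  qed
  then show thesis using r that by blast
qed

lemma Beta_ge_inverse_right:
  assumes "0 < a" "a \<le> 1" "0 < b"
  shows "Beta a b \<ge> 1 / (b :: real)"
proof -
  have "b \<notin> \<int>\<^sub>\<le>\<^sub>0" using assms by (auto simp: nonpos_Ints_def)
  then have "Beta 1 b = 1 / b"
    using assms Gamma_plus1[of b] by (simp add: Beta_def add.commute Gamma_eq_zero_iff)
  then show ?thesis
    using Beta_real_mono[of a 1 b b] assms by simp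
qed

lemma Digamma_diff_bounds:
  assumes "a < 1"
  shows "0 < Digamma (3 / 2 - a) - Digamma (1 - a)"
    "Digamma (3 / 2 - a) - Digamma (1 - a) < 1 / (1 - a :: real)"
proof -
  have "Digamma (3 / 2 - a) < Digamma (1 - a + 1)" "Digamma (1 - a) < Digamma (3 / 2 - a)"
    using assms by (auto intro!: Digamma_real_strict_mono)
  moreover have "Digamma (1 - a + 1) = Digamma (1 - a) + 1 / (1 - a)"
    using assms by (intro Digamma_plus1) auto
  ultimately show "0 < Digamma (3 / 2 - a) - Digamma (1 - a)"
    "Digamma (3 / 2 - a) - Digamma (1 - a) < 1 / (1 - a)" by auto
qed

lemma beta_bounds:
  assumes "0 < a" "a < 1"
  shows "0 < beta a" "beta a < 1" "beta a \<le> a / (1 - a)"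
proof -
  note \<psi> = Digamma_diff_bounds[OF assms(2)]
  have B: "Beta a (1 - a) \<ge> 1 / (1 - a)" "Beta a (1 - a) \<ge> 1 / a"
    using Beta_ge_inverse_right[of a "1 - a"] Beta_ge_inverse_right[of "1 - a" a] assms
    by (auto simp: Beta_commute)
  have pos: "Beta a (1 - a) > 0" using assms by (auto intro: Beta_real_pos)
  show "0 < beta a" using \<psi>(1) pos by (simp add: beta_def)
  show "beta a < 1" using \<psi>(2) pos B(1) by (simp add: beta_def)
  have "beta a \<le> (1 / (1 - a)) / (1 / a)"
    unfolding beta_def using \<psi> B assms by (intro frac_le) auto
  then show "beta a \<le> a / (1 - a)" by simp
qed

lemma alpha_beta_tendsto_0:
  "(alpha \<longlongrightarrow> 1) (at_right 0)" "((\<lambda>a. alpha a * beta a) \<longlongrightarrow> 0) (at_right 0)"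
proof -
  have ev: "\<forall>\<^sub>F a in at_right (0::real). a \<in> {0<..<1}"
    by (rule eventually_at_right_real) simp
  show lim: "(alpha \<longlongrightarrow> 1) (at_right 0)"
    unfolding alpha_def by (auto intro!: tendsto_eq_intros)
  have "((\<lambda>a::real. a / (1 - a)) \<longlongrightarrow> 0) (at_right 0)"
    by (auto intro!: tendsto_eq_intros)
  then have "(beta \<longlongrightarrow> 0) (at_right 0)"
    by (rule tendsto_sandwich[OF _ _ tendsto_const, rotated 2])
      (use ev in \<open>auto elim!: eventually_mono intro: less_imp_le beta_bounds\<close>)
  then show "((\<lambda>a. alpha a * beta a) \<longlongrightarrow> 0) (at_right 0)"
    using tendsto_mult[OF lim] by fastforce
qed

context
  fixes a :: real
  assumes a: "0 < a" "a < 1"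
begin

lemma hypF_G_gt_1:
  assumes "0 < r" "r < 1"
  shows "hypF a (1 - a) 1 r > 1"
proof -
  have "hyp_fps a (1 - a) 1 $ 0 * r ^ 0 + hyp_fps a (1 - a) 1 $ 1 * r ^ 1 =
      (\<Sum>k<2. hyp_fps a (1 - a) 1 $ k * r ^ k)" 
    by (simp add: numeral_2_eq_2)
  also have "\<dots> \<le> hypF a (1 - a) 1 r"
    unfolding hypF_eq_eval_hyp_fps eval_fps_def
    using summable_fps[of r "G_fps a"] GHMN_radius(1)[OF a] GHMN_nth_pos(1)[OF a] assms
    by (intro sum_le_suminf) (auto intro: less_imp_le)
  finally show ?thesis
    using mult_pos_pos[OF GHMN_nth_pos(1)[OF a, of 1] assms(1)] by simp
qed

lemma acoeff_pos: "acoeff a k > 0"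
  using a by (simp add: acoeff_eq f2_fps_nth_pos)

lemma acoeff_0: "acoeff a 0 = alpha a - 1"
  using a by (simp add: acoeff_eq f2_fps_nth_0)

lemma acoeff_sums: "acoeff a sums (alpha a * beta a)"
  using f2_fps_sums[OF a] acoeff_eq[OF a] by (metis ext)

lemma sum_acoeff_less: "(\<Sum>k<m. acoeff a k) < alpha a * beta a"
  using sum_less_suminf[of "acoeff a" m] acoeff_sums acoeff_pos by (simp add: sums_iff)

lemma acoeff_less: "acoeff a k < alpha a * beta a"
proof -
  have "acoeff a k \<le> (\<Sum>i<Suc k. acoeff a i)"
    using acoeff_pos by (intro member_le_sum) (auto intro: less_imp_le)
  also have "\<dots> < alpha a * beta a" by (rule sum_acoeff_less)
  finally show ?thesis .
qed

lemma f2_sums: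
  assumes "0 \<le> r" "r < 1"
  shows "(\<lambda>k. acoeff a k * r ^ k) sums f2 a r"
  using sums_eval_fps[of r "f2_fps a"] in_f2_radius[OF a, of r] assms
  by (simp add: f2_eq_eval[OF a] acoeff_eq[OF a])

lemma f2_0: "f2 a 0 = alpha a - 1"
  using a by (simp add: f2_eq_eval eval_fps_at_0 f2_fps_nth_0)

lemma f2_tail_bounds:
  assumes "0 < r" "r < 1"
  shows "acoeff a m * r ^ m < f2 a r - (\<Sum>k<m. acoeff a k * r ^ k)"
    and "f2 a r - (\<Sum>k<m. acoeff a k * r ^ k) < (alpha a * beta a - (\<Sum>k<m. acoeff a k)) * r ^ m"
  using eval_fps_tail_bounds[OF f2_fps_nth_pos[OF a] f2_fps_sums[OF a] assms, of m] assms
  by (auto simp: acoeff_eq[OF a] f2_eq_eval[OF a])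

lemma f2_bounds:
  assumes "0 < r" "r < 1"
  shows "alpha a - 1 < f2 a r" "f2 a r < alpha a * beta a"
  using f2_tail_bounds(1)[OF assms, of 0] f2_tail_bounds(2)[OF assms, of 0] by (auto simp: acoeff_0)

lemma f2_tendsto: "(f2 a \<longlongrightarrow> alpha a * beta a) (at_left 1)"
proof -
  have "(eval_fps (f2_fps a) \<longlongrightarrow> alpha a * beta a) (at_left 1)"
    using eval_fps_tendsto_at_left_1[OF less_imp_le[OF f2_fps_nth_pos[OF a]] f2_fps_summable[OF a]]
      f2_fps_sums[OF a] by (simp add: sums_iff)
  moreover have "\<forall>\<^sub>F x in at_left 1. eval_fps (f2_fps a) x = f2 a x"
    using eventually_at_left_1 by eventually_elim (auto simp: f2_eq_eval[OF a])
  ultimately show ?thesis by (rule Lim_transform_eventually)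
qed

lemma f2_image: "f2 a ` {0<..<1} = {alpha a - 1<..<alpha a * beta a}"
proof (intro equalityI subsetI)
  fix y assume y: "y \<in> {alpha a - 1<..<alpha a * beta a}"
  then have "\<forall>\<^sub>F x in at_left 1. f2 a x > y"
    by (intro order_tendstoD(1)[OF f2_tendsto]) auto
  then have "\<forall>\<^sub>F x in at_left 1. f2 a x > y \<and> 0 < x \<and> x < 1"
    using eventually_at_left_1 by (rule eventually_conj)
  then obtain x where x: "f2 a x > y" "0 < x" "x < 1"
    using eventually_happens[of _ "at_left (1::real)"] by auto
  have "{0..x} \<subseteq> eball 0 (fps_conv_radius (f2_fps a))"
  proof
    fix t assume "t \<in> {0..x}"
    then show "t \<in> eball 0 (fps_conv_radius (f2_fps a))"
      using x in_f2_radius[OF a, of t] by simp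
  qed
  then have "continuous_on {0..x} (eval_fps (f2_fps a))"
    by (rule continuous_on_subset[OF continuous_on_eval_fps])
  then obtain t where "0 \<le> t" "t \<le> x" "eval_fps (f2_fps a) t = y"
    using IVT'[of "eval_fps (f2_fps a)" 0 y x] x y f2_0 by (auto simp: f2_eq_eval[OF a, symmetric])
  then show "y \<in> f2 a ` {0<..<1}"
    using x y f2_0 by (intro image_eqI[of _ _ t]) (auto simp: f2_eq_eval[OF a] less_le)
qed (auto intro: f2_bounds)

lemma f2_absolutely_monotone: "absolutely_monotone_on {0<..<1} (f2 a)"
  unfolding absolutely_monotone_on_def
proof (intro allI ballI conjI)
  fix n x assume x: "x \<in> {0<..<1::real}"
  let ?F = "fps_nth_deriv n (f2_fps a)"
  have rad: "ereal \<bar>t\<bar> < fps_conv_radius (f2_fps a)" if "t \<in> {0<..<1}" for t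
    using that by (intro in_f2_radius a) auto
  have rad': "ereal \<bar>x\<bar> < fps_conv_radius ?F"
    by (rule less_le_trans[OF rad[OF x] fps_conv_radius_nth_deriv])
  have eq: "(deriv ^^ n) (f2 a) t = eval_fps ?F t" if "t \<in> {0<..<1}" for t
    by (rule nth_deriv_eq_eval_fps[of "{0<..<1}"]) (use that rad f2_eq_eval[OF a] in auto)
  have "(eval_fps ?F has_real_derivative eval_fps (fps_deriv ?F) x) (at x)"
    using rad' by (intro has_field_derivative_eval_fps) auto
  then have "((deriv ^^ n) (f2 a) has_real_derivative eval_fps (fps_deriv ?F) x) (at x)"
    by (rule has_field_derivative_transform_within_open[where S = "{0<..<1}"]) (use x eq in auto)
  then show "(deriv ^^ n) (f2 a) differentiable at x"
    by (auto simp: differentiable_def has_field_derivative_def)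
  have "eval_fps ?F x \<ge> 0"
    using x rad' f2_fps_nth_pos[OF a]
    by (intro eval_fps_nonneg fps_nth_deriv_nonneg) (auto intro: less_imp_le)
  then show "0 \<le> (deriv ^^ n) (f2 a) x" by (simp add: eq[OF x])
qed

lemma delta_eq: "delta n a = alpha a * beta a - (\<Sum>k<n + 2. acoeff a k)"
  by (simp add: delta_def lessThan_Suc_atMost)

lemma delta_pos: "delta n a > 0"
  using sum_acoeff_less by (simp add: delta_eq del: sum.lessThan_Suc)

lemma delta_less: "delta n a < alpha a * beta a"
proof -
  have "(\<Sum>k<n + 2. acoeff a k) > 0" by (rule sum_pos) (auto intro: acoeff_pos)
  then show ?thesis unfolding delta_eq by simp
qed

lemma delta_strict_antimono: "m < n \<Longrightarrow> delta n a < delta m a"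
  unfolding delta_eq using acoeff_pos by (intro diff_strict_left_mono sum_strict_mono2[of _ _ "m + 2"])
    (auto intro: less_imp_le)

lemma delta_tendsto: "(\<lambda>n. delta n a) \<longlonglongrightarrow> 0"
proof -
  have "(\<lambda>n. \<Sum>k<n + 2. acoeff a k) \<longlonglongrightarrow> alpha a * beta a"
    using acoeff_sums unfolding sums_def by (rule LIMSEQ_ignore_initial_segment)
  from tendsto_diff[OF tendsto_const[of "alpha a * beta a"] this] show ?thesis
    unfolding delta_eq by simp
qed

lemma G_filterlim: "filterlim (hypF a (1 - a) 1) at_top (at_left 1)"
proof -
  have "\<not> summable (fps_nth (G_fps a))"
    using hyp_fps_balanced_not_summable[of a "1 - a"] a by simp
  then have "filterlim (eval_fps (G_fps a)) at_top (at_left 1)"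
    using GHMN_nth_pos(1)[OF a] by (intro filterlim_eval_fps_at_top) (auto simp: GHMN_radius[OF a] less_imp_le)
  then show ?thesis by (simp add: hypF_eq_eval_hyp_fps[abs_def])
qed

lemma f1_eq: "f1 a r = (alpha a - 1) * hypF a (1 - a) 1 r - f2 a r"
  by (simp add: f1_def f2_def algebra_simps)

lemma Lambda_gt_1_iff:
  assumes "0 < r" "r < 1"
  shows "Lambda a r > 1 \<longleftrightarrow> f1 a r > 0"
  using hypF_G_gt_1[OF assms] by (simp add: f1_def Lambda1_def)

lemma Lambda_less_1_iff:
  assumes "0 < r" "r < 1"
  shows "Lambda a r < 1 \<longleftrightarrow> f1 a r < 0"
  using hypF_G_gt_1[OF assms] by (simp add: f1_def Lambda1_def)

definition f1_fps :: "real fps" where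
  "f1_fps = fps_const (alpha a - 1) * G_fps a - f2_fps a"

lemma f1_fps_radius: "fps_conv_radius f1_fps \<ge> 1"
proof -
  have "1 \<le> min (fps_conv_radius (fps_const (alpha a - 1) * G_fps a)) (fps_conv_radius (f2_fps a))"
    using alpha_gt_1[OF a] by (simp add: GHMN_radius[OF a] f2_fps_radius[OF a] fps_conv_radius_cmult_left)
  also have "\<dots> \<le> fps_conv_radius f1_fps" unfolding f1_fps_def by (rule fps_conv_radius_diff)
  finally show ?thesis .
qed

lemma f1_eq_eval:
  assumes "0 \<le> r" "r < 1"
  shows "f1 a r = eval_fps f1_fps r"
  using assms alpha_gt_1[OF a] in_f2_radius[OF a, of r] unfolding f1_fps_def
  by (subst eval_fps_diff) (auto simp: f1_eq hypF_eq_eval_hyp_fps f2_eq_eval[OF a] eval_fps_mult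
    GHMN_radius[OF a] fps_conv_radius_cmult_left)

lemma f1_0: "f1 a 0 = 0"
  by (simp add: f1_eq f2_0 hypF_eq_eval_hyp_fps eval_fps_at_0)

lemma f1_fps_nth_1: "f1_fps $ 1 = a * (7 * a - 3) / 30"
proof -
  have "(alpha a - 1) * (a * (1 - a)) = a ^ 2 / 3"
    using a by (simp add: alpha_def field_simps power2_eq_square)
  then show ?thesis
    using f2_fps_nth_1[OF a] by (simp add: f1_fps_def hyp_fps_nth_Suc) (simp add: field_simps power2_eq_square)
qed

end

lemma not_ratio_gt_if_Lambda_less_1:
  assumes a: "0 < a" "a < 1" and r: "0 < r" "r < 1" and less: "Lambda a r < 1"
  shows "\<not> hypF (a + 1) (2 - a) 2 r / hypF a (1 - a) 1 r
      > hypF (a + 1) (5/2 - a) (5/2) r / hypF a (3/2 - a) (3/2) r"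
proof
  let ?X = "hypF (a + 1) (2 - a) 2 r" and ?Y = "hypF (a + 1) (5/2 - a) (5/2) r"
  let ?G = "hypF a (1 - a) 1 r" and ?H = "hypF a (1 - a) 2 r"
  let ?M = "hypF a (3/2 - a) (3/2) r" and ?N = "hypF a (3/2 - a) (5/2) r"
  assume "?X / ?G > ?Y / ?M"
  have pos: "?G > 0" "?M > 0" "?N > 0"
    using GHMN_ge_1[OF a, of r] r by (simp_all add: hypF_eq_eval_hyp_fps)
  have "?Y * ?G < ?X * ?M"
    using \<open>?X / ?G > ?Y / ?M\<close> pos by (simp add: field_simps)
  then have "(?Y * ?G) * (1 - r) < (?X * ?M) * (1 - r)"
    using r by (intro mult_strict_right_mono) auto
  then have "?G * (?Y * (1 - r)) < (?X * (1 - r)) * ?M"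
    by (simp only: mult_ac)
  moreover have "?X * (1 - r) = ?H"
    using hypF_balanced_Suc_eq[of a "1 - a" r] a r by simp
  moreover have "?Y * (1 - r) = ?N"
    using hypF_balanced_Suc_eq[of a "3/2 - a" r] a r by simp
  ultimately have "?G * ?N < ?H * ?M"
    by simp
  then have "Lambda a r > 1"
    using pos by (simp add: Lambda_def)
  with less show False by simp
qed

subsection \<open>Monotonicity of \<open>f\<^sub>1\<close>\<close>

lemma f1_strict_antimono_near_0:
  assumes "0 < a" "a < 3 / 7"
  obtains r where "r \<in> {0<..<1}" "strict_antimono_on {0<..r} (f1 a)" "\<And>x. x \<in> {0<..r} \<Longrightarrow> f1 a x < 0"
proof -
  have a: "0 < a" "a < 1" using assms by auto
  have "a * (7 * a - 3) < 0" using assms by (intro mult_pos_neg) auto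
  then have pos: "(- f1_fps a) $ 1 > 0"
    using f1_fps_nth_1[OF a] by simp
  have "fps_conv_radius (- f1_fps a) \<ge> 1" using f1_fps_radius[OF a] by simp
  from this pos obtain r where r: "0 < r" "r < 1" "strict_mono_on {0..r} (eval_fps (- f1_fps a))"
    by (rule eval_fps_strict_mono_near_0)
  have eq: "eval_fps (- f1_fps a) x = - f1 a x" if "x \<in> {0..r}" for x
    using that r f1_eq_eval[OF a, of x] less_le_trans[OF _ f1_fps_radius[OF a], of "ereal x"]
    by (subst eval_fps_minus) auto
  have less: "f1 a y < f1 a x" if "0 \<le> x" "x < y" "y \<le> r" for x y
    using strict_mono_onD[OF r(3), of x y] that eq[of x] eq[of y] by auto
  show thesis
  proof (rule that)
    show "strict_antimono_on {0<..r} (f1 a)"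
      by (rule monotone_onI) (use less in auto)
    show "f1 a x < 0" if "x \<in> {0<..r}" for x
      using less[of 0 x] that f1_0[OF a] by auto
  qed (use r in auto)
qed

lemma f1_strict_mono_near_0:
  assumes "3 / 7 < a" "a < 1"
  obtains r where "r \<in> {0<..<1}" "strict_mono_on {0<..r} (f1 a)" "\<And>x. x \<in> {0<..r} \<Longrightarrow> f1 a x > 0"
proof -
  have a: "0 < a" "a < 1" using assms by auto
  have "a * (7 * a - 3) > 0" using assms by (intro mult_pos_pos) auto
  then have pos: "f1_fps a $ 1 > 0"
    using f1_fps_nth_1[OF a] by simp
  from f1_fps_radius[OF a] pos obtain r
    where r: "0 < r" "r < 1" "strict_mono_on {0..r} (eval_fps (f1_fps a))"
    by (rule eval_fps_strict_mono_near_0)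
  have less: "f1 a x < f1 a y" if "0 \<le> x" "x < y" "y \<le> r" for x y
    using strict_mono_onD[OF r(3), of x y] that r f1_eq_eval[OF a, of x] f1_eq_eval[OF a, of y] by auto
  show thesis
  proof (rule that)
    show "strict_mono_on {0<..r} (f1 a)"
      by (rule monotone_onI) (use less in auto)
    show "f1 a x > 0" if "x \<in> {0<..r}" for x
      using less[of 0 x] that f1_0[OF a] by auto
  qed (use r in auto)
qed

context
  fixes a :: real
  assumes a: "0 < a" "a < 1"
begin

lemma f1_filterlim: "filterlim (f1 a) at_top (at_left 1)"
proof -
  have "((\<lambda>r. - f2 a r) \<longlongrightarrow> - (alpha a * beta a)) (at_left 1)"
    by (intro tendsto_intros f2_tendsto a)
  moreover have "filterlim (\<lambda>r. (alpha a - 1) * hypF a (1 - a) 1 r) at_top (at_left 1)"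
    using alpha_gt_1[OF a] by (intro filterlim_tendsto_pos_mult_at_top[OF tendsto_const] G_filterlim a) auto
  ultimately have "filterlim (\<lambda>r. - f2 a r + (alpha a - 1) * hypF a (1 - a) 1 r) at_top (at_left 1)"
    by (rule filterlim_tendsto_add_at_top)
  also have "(\<lambda>r. - f2 a r + (alpha a - 1) * hypF a (1 - a) 1 r) = f1 a"
    by (auto simp: f1_eq[OF a] fun_eq_iff)
  finally show ?thesis .
qed

lemma deriv_f2_le:
  assumes "0 \<le> x" "x < 1"
  shows "(1 - x) * eval_fps (fps_deriv (f2_fps a)) x \<le> alpha a * beta a - f2 a x"
proof (rule tendsto_upperbound)
  let ?F' = "eval_fps (fps_deriv (f2_fps a))"
  show "((\<lambda>y. (y - x) * ?F' x) \<longlongrightarrow> (1 - x) * ?F' x) (at_left 1)"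
    by (intro tendsto_intros)
  show "\<forall>\<^sub>F y in at_left 1. (y - x) * ?F' x \<le> alpha a * beta a - f2 a x"
    using eventually_at_left_real[OF assms(2)]
  proof eventually_elim
    case (elim y)
    have "(eval_fps (f2_fps a) has_real_derivative ?F' t) (at t)" if "x \<le> t" "t \<le> y" for t
      using that elim assms in_f2_radius[OF a, of t] by (intro has_field_derivative_eval_fps) auto
    then obtain z where z: "x < z" "z < y"
      "eval_fps (f2_fps a) y - eval_fps (f2_fps a) x = (y - x) * ?F' z"
      using MVT2[of x y "eval_fps (f2_fps a)" ?F'] elim by auto
    have "?F' x \<le> ?F' z"
    proof (rule eval_fps_mono)
      show "fps_deriv (f2_fps a) $ k \<ge> 0" for k
        using f2_fps_nth_pos[OF a, of "k + 1"] by (auto simp: less_imp_le)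
      have "ereal \<bar>z\<bar> < fps_conv_radius (f2_fps a)"
        using z elim assms by (intro in_f2_radius a) auto
      then show "ereal z < fps_conv_radius (fps_deriv (f2_fps a))"
        using z assms fps_conv_radius_deriv[of "f2_fps a"] by auto
    qed (use z assms in auto)
    then have "(y - x) * ?F' x \<le> (y - x) * ?F' z"
      using elim by (intro mult_left_mono) auto
    also have "\<dots> = f2 a y - f2 a x"
      using z(3) elim assms by (simp add: f2_eq_eval[OF a])
    finally show ?case using f2_bounds(2)[OF a, of y] elim assms by auto
  qed
qed auto

lemma f1_strict_mono_near_1:
  obtains r where "r \<in> {0<..<1}" "strict_mono_on {r..<1} (f1 a)" "\<And>x. x \<in> {r..<1} \<Longrightarrow> f1 a x > 0"
proof -
  define c where "c = (alpha a - 1) * (a * (1 - a))"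
  have "c > 0" using alpha_gt_1[OF a] a by (simp add: c_def)
  then have "\<forall>\<^sub>F x in at_left 1. alpha a * beta a - c < f2 a x"
    by (intro order_tendstoD(1)[OF f2_tendsto[OF a]]) auto
  moreover have "\<forall>\<^sub>F x in at_left 1. f1 a x > 0"
    using f1_filterlim by (simp add: filterlim_at_top_dense)
  ultimately have "\<forall>\<^sub>F x in at_left 1. alpha a * beta a - c < f2 a x \<and> f1 a x > 0"
    by (rule eventually_conj)
  then obtain b where b: "b < 1" "\<And>x. b < x \<Longrightarrow> x < 1 \<Longrightarrow> alpha a * beta a - c < f2 a x \<and> f1 a x > 0"
    by (auto simp: eventually_at_left_field)
  define r where "r = max (1 / 2) ((1 + b) / 2)"
  have r: "0 < r" "r < 1" "b < r" using b(1) by (auto simp: r_def less_max_iff_disj)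
  have less: "f1 a x < f1 a y" if xy: "r \<le> x" "x < y" "y < 1" for x y
  proof -
    have "eval_fps (f1_fps a) x < eval_fps (f1_fps a) y"
    proof (rule DERIV_pos_imp_increasing[OF xy(2)])
      fix t assume "x \<le> t" "t \<le> y"
      then have t: "0 < t" "t < 1" "b < t" using xy r by auto
      have Frad: "ereal (norm t) < fps_conv_radius (f1_fps a)"
        using t by (intro less_le_trans[OF _ f1_fps_radius[OF a]]) auto
      have rads: "ereal (norm t) < fps_conv_radius (fps_deriv (f2_fps a))"
        "ereal (norm t) < fps_conv_radius (fps_deriv (G_fps a))"
        using t in_f2_radius[OF a, of t] GHMN_radius(1)[OF a]
        by (auto intro!: less_le_trans[OF _ fps_conv_radius_deriv])
      have "eval_fps (fps_deriv (G_fps a) * (1 - fps_X)) t = eval_fps (fps_const (a * (1 - a)) * H_fps a) t"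
        using fps_deriv_hyp_fps_balanced[of a "1 - a"] a by simp
      moreover have "fps_conv_radius (1 - fps_X :: real fps) = \<infinity>"
        using fps_conv_radius_diff[of "1 :: real fps" fps_X] by simp
      ultimately have G': "eval_fps (fps_deriv (G_fps a)) t * (1 - t) = a * (1 - a) * eval_fps (H_fps a) t"
        using rads t GHMN_radius(2)[OF a] by (simp add: eval_fps_mult eval_fps_diff)
      have "ereal (norm t) < fps_conv_radius (fps_const (alpha a - 1) * fps_deriv (G_fps a))"
        using rads alpha_gt_1[OF a] by (subst fps_conv_radius_cmult_left) auto
      then have f1': "eval_fps (fps_deriv (f1_fps a)) t =
          (alpha a - 1) * eval_fps (fps_deriv (G_fps a)) t - eval_fps (fps_deriv (f2_fps a)) t"
        using rads by (simp add: f1_fps_def[OF a] eval_fps_diff eval_fps_mult)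
      have "eval_fps (fps_deriv (f1_fps a)) t * (1 - t) =
          (alpha a - 1) * (eval_fps (fps_deriv (G_fps a)) t * (1 - t)) - (1 - t) * eval_fps (fps_deriv (f2_fps a)) t"
        unfolding f1' by (simp add: algebra_simps)
      also have "\<dots> = c * eval_fps (H_fps a) t - (1 - t) * eval_fps (fps_deriv (f2_fps a)) t"
        unfolding G' by (simp add: c_def mult_ac)
      also have "\<dots> > 0"
      proof -
        have "c * 1 \<le> c * eval_fps (H_fps a) t"
          using \<open>c > 0\<close> GHMN_ge_1(2)[OF a, of t] t by (intro mult_left_mono) auto
        then show ?thesis
          using b(2)[of t] deriv_f2_le[of t] t by auto
      qed
      finally have "eval_fps (fps_deriv (f1_fps a)) t > 0"
        using t by (simp add: zero_less_mult_iff)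
      then show "\<exists>z. (eval_fps (f1_fps a) has_real_derivative z) (at t) \<and> 0 < z"
        using Frad by (blast intro: has_field_derivative_eval_fps)
    qed
    then show ?thesis
      using xy r by (simp add: f1_eq_eval[OF a])
  qed
  show thesis
  proof (rule that)
    show "strict_mono_on {r..<1} (f1 a)"
      by (rule monotone_onI) (use less in auto)
  qed (use r b in auto)
qed

subsection \<open>Elliptic integrals\<close>

lemma ellE_minus_ellK:
  assumes "0 < r" "r < 1"
  shows "(ellE a r - (1 - r\<^sup>2) * ellK a r) / (a * r\<^sup>2) = pi / 2 * hypF a (1 - a) 2 (r\<^sup>2)"
proof -
  define E where "E = hyp_fps (a - 1) (1 - a) 1"
  have x: "0 < r\<^sup>2" "r\<^sup>2 < 1" using assms by (auto simp: power_less_one_iff)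
  have "a - 1 \<notin> \<int>\<^sub>\<le>\<^sub>0"
  proof
    assume "a - 1 \<in> \<int>\<^sub>\<le>\<^sub>0"
    then obtain n :: nat where "a - 1 = - real n" by (elim nonpos_Ints_cases')
    then show False using a by (cases n) auto
  qed
  then have E_rad: "fps_conv_radius E = 1"
    unfolding E_def using a by (intro fps_conv_radius_hyp_fps[OF \<open>a - 1 \<notin> \<int>\<^sub>\<le>\<^sub>0\<close>] pos_notin_nonpos_Ints) auto
  have "E = (1 - fps_X) * G_fps a + fps_const a * (fps_X * H_fps a)"
  proof (rule fps_ext)
    fix n
    show "E $ n = ((1 - fps_X) * G_fps a + fps_const a * (fps_X * H_fps a)) $ n"
    proof (cases n)
      case (Suc m)
      have Hm: "H_fps a $ m = G_fps a $ m / (1 + real m)"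
        using hyp_fps_balanced_plus1_nth[of a "1 - a" m] a by simp
      have Em: "E $ Suc m = G_fps a $ m * ((a - 1) * (1 - a + m) / ((1 + real m) * (1 + real m)))"
        by (simp add: E_def hyp_fps_def pochhammer_rec[of "a - 1"] pochhammer_Suc[of "1 - a"]
            pochhammer_Suc[of 1] mult_ac)
      have Y: "(a - 1) * (1 - a + m) / ((1 + real m) * (1 + real m)) =
          (a + m) * (1 - a + m) / ((1 + real m) * (1 + real m)) - 1 + a / (1 + real m)"
      proof -
        have "(a - 1) * (s - a) / (s * s) = (a + s - 1) * (s - a) / (s * s) - 1 + a / s"
          if "s > 0" for s :: real
          using that by (simp add: field_simps)
        from this[of "1 + real m"] show ?thesis by (simp add: algebra_simps)
      qed
      have Gm: "G_fps a $ Suc m = G_fps a $ m * ((a + m) * (1 - a + m) / ((1 + real m) * (1 + real m)))"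
        by (simp add: hyp_fps_nth_Suc[of a "1 - a"] add_ac)
      have "g * (X - 1 + a / s) = g * X - g + a * (g / s)" for g X s :: real
        by (simp add: right_diff_distrib distrib_left)
      then have "E $ Suc m = G_fps a $ Suc m - G_fps a $ m + a * H_fps a $ m"
        unfolding Em Gm Hm Y .
      then show ?thesis
        using Suc by (simp add: left_diff_distrib)
    qed (simp add: E_def)
  qed
  moreover have "fps_conv_radius (1 - fps_X :: real fps) = \<infinity>"
    using fps_conv_radius_diff[of "1 :: real fps" fps_X] by simp
  moreover have "ereal (r\<^sup>2) < fps_conv_radius (fps_X * H_fps a)"
    using x GHMN_radius(2)[OF a] by (intro less_le_trans[OF _ fps_conv_radius_mult]) auto
  moreover have "ereal (r\<^sup>2) < fps_conv_radius (fps_const a * (fps_X * H_fps a))"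
    using calculation(3) a by (simp add: fps_conv_radius_cmult_left)
  moreover have "ereal (r\<^sup>2) < fps_conv_radius ((1 - fps_X) * G_fps a)"
    using x GHMN_radius(1)[OF a] calculation(2) by (intro less_le_trans[OF _ fps_conv_radius_mult]) auto
  ultimately have eq: "eval_fps E (r\<^sup>2) = (1 - r\<^sup>2) * eval_fps (G_fps a) (r\<^sup>2) + a * (r\<^sup>2 * eval_fps (H_fps a) (r\<^sup>2))"
    using x GHMN_radius[OF a] by (simp add: eval_fps_add eval_fps_mult eval_fps_diff)
  have "(pi / 2 * e - s * (pi / 2 * g)) / z = pi / 2 * h"
    if "e = s * g + z * h" "z \<noteq> 0" for e s g z h :: real
    using that by (simp add: field_simps)
  from this[of "eval_fps E (r\<^sup>2)" "1 - r\<^sup>2" "eval_fps (G_fps a) (r\<^sup>2)" "a * r\<^sup>2" "eval_fps (H_fps a) (r\<^sup>2)"]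
  show ?thesis
    unfolding ellE_def ellK_def hypF_eq_eval_hyp_fps E_def[symmetric]
    using eq assms a by (simp only: mult.assoc) simp
qed

lemma alpha_ellK_eq:
  assumes "0 < r" "r < 1"
  shows "alpha a * ellK a r = (ellE a r - (1 - r\<^sup>2) * ellK a r) / (a * r\<^sup>2)
          * (hypF a (3/2 - a) (3/2) (r\<^sup>2) / hypF a (3/2 - a) (5/2) (r\<^sup>2))
          + pi / 2 * (\<Sum>k. acoeff a k * r ^ (2 * k))"
proof -
  have x: "0 < r\<^sup>2" "r\<^sup>2 < 1" using assms by (auto simp: power_less_one_iff)
  have S: "(\<Sum>k. acoeff a k * r ^ (2 * k)) = f2 a (r\<^sup>2)"
    using f2_sums[OF a, of "r\<^sup>2"] x by (simp add: sums_iff power_mult)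
  define L where "L = hypF a (3/2 - a) (3/2) (r\<^sup>2) / hypF a (3/2 - a) (5/2) (r\<^sup>2)"
  have f2: "f2 a (r\<^sup>2) = alpha a * hypF a (1 - a) 1 (r\<^sup>2) - hypF a (1 - a) 2 (r\<^sup>2) * L"
    using hypF_G_gt_1[OF a x] by (simp add: f2_def Lambda1_def Lambda_def L_def)
  show ?thesis
    unfolding ellE_minus_ellK[OF assms] S f2 L_def[symmetric] by (simp add: ellK_def algebra_simps)
qed

end

subsection \<open>The case \<open>a = 1/2\<close>\<close>

lemma M_half_nth: "M_fps (1/2) $ n = 1 / (2 * real n + 1)"
proof (induction n)
  case (Suc n)
  have "M_fps (1/2) $ Suc n = 1 / (2 * real n + 1) * ((1/2 + real n) * (1 + real n) / ((3/2 + real n) * (real n + 1)))"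
    using Suc by (simp add: hyp_fps_nth_Suc add_ac)
  also have "(1/2 + real n) * (1 + real n) / ((3/2 + real n) * (real n + 1)) = (1/2 + real n) / (3/2 + real n)"
    by (simp add: add.commute[of "real n" 1])
  also have "1 / (2 * real n + 1) * \<dots> = (1/2 + real n) / ((2 * real n + 1) * (3/2 + real n))"
    by simp
  also have "\<dots> = 1 / (2 * real (Suc n) + 1)"
  proof (subst frac_eq_eq)
    have "2 * real n + 1 > 0" "3/2 + real n > 0" by auto
    then show "(2 * real n + 1) * (3/2 + real n) \<noteq> 0" by simp
  qed (auto simp: field_simps)
  finally show ?case .
qed simp

lemma N_half_nth: "N_fps (1/2) $ n = 3 / ((2 * real n + 1) * (2 * real n + 3))"
proof -
  have "N_fps (1/2) $ n = 1 / (2 * real n + 1) * (3/2 / (3/2 + n))"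
    using hyp_fps_balanced_plus1_nth[of "1/2" 1 n] M_half_nth[of n] by simp
  also have "\<dots> = 3 / ((2 * real n + 1) * (2 * real n + 3))" by (simp add: field_simps)
  finally show ?thesis .
qed

lemma fps_X_mult_N_half:
  "fps_X * N_fps (1/2) = fps_const (3/2) * (1 - (1 - fps_X) * M_fps (1/2))"
proof (rule fps_ext)
  fix n
  show "(fps_X * N_fps (1/2)) $ n = (fps_const (3/2) * (1 - (1 - fps_X) * M_fps (1/2))) $ n"
  proof (cases n)
    case (Suc m)
    have "(fps_X * N_fps (1/2)) $ n = 3 / ((2 * real m + 1) * (2 * real m + 3))"
      using N_half_nth[of m] Suc by simp
    also have "\<dots> = 3/2 * (1 / (2 * real m + 1) - 1 / (2 * real (Suc m) + 1))"
      by (simp add: divide_simps)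
    also have "\<dots> = (fps_const (3/2) * (1 - (1 - fps_X) * M_fps (1/2))) $ n"
      using M_half_nth[of m] M_half_nth[of "Suc m"] Suc by (simp add: left_diff_distrib)
    finally show ?thesis .
  qed simp
qed

lemma eval_N_half:
  assumes "\<bar>x\<bar> < 1"
  shows "x * eval_fps (N_fps (1/2)) x = 3/2 * (1 - (1 - x) * eval_fps (M_fps (1/2)) x)"
proof -
  have rad1: "fps_conv_radius (1 - fps_X :: real fps) = \<infinity>"
    using fps_conv_radius_diff[of "1 :: real fps" fps_X] by simp
  have rad2: "ereal \<bar>x\<bar> < fps_conv_radius ((1 - fps_X) * M_fps (1/2))"
    using assms GHMN_radius(3)[of "1/2"] rad1 by (intro less_le_trans[OF _ fps_conv_radius_mult]) auto
  have rad3: "ereal \<bar>x\<bar> < fps_conv_radius (1 - (1 - fps_X) * M_fps (1/2))"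
    using rad2 by (intro less_le_trans[OF _ fps_conv_radius_diff]) auto
  have "eval_fps (fps_X * N_fps (1/2)) x = eval_fps (fps_const (3/2) * (1 - (1 - fps_X) * M_fps (1/2))) x"
    by (simp only: fps_X_mult_N_half)
  then show ?thesis
    using assms GHMN_radius(3,4)[of "1/2"] rad1 rad2 rad3 by (simp add: eval_fps_mult eval_fps_diff)
qed

lemma eval_M_half:
  assumes "0 < r" "r < 1"
  shows "eval_fps (M_fps (1/2)) (r\<^sup>2) = artanh r / r"
proof -
  let ?M = "eval_fps (M_fps (1/2))" and ?M' = "eval_fps (fps_deriv (M_fps (1/2)))"
  have "r * ?M (r\<^sup>2) - artanh r = 0 * ?M (0\<^sup>2) - artanh 0"
  proof (rule DERIV_isconst_end[OF assms(1)])
    have deriv: "((\<lambda>x. x * ?M (x\<^sup>2) - artanh x) has_real_derivative 0) (at x)" if "\<bar>x\<bar> < 1" for x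
    proof -
      have x: "\<bar>x\<^sup>2\<bar> < 1" "0 \<le> x\<^sup>2" using that by (auto simp: abs_square_less_1)
      have rad: "ereal (norm (x\<^sup>2)) < fps_conv_radius (M_fps (1/2))"
        using x GHMN_radius(3)[of "1/2"] by simp
      then have rad': "ereal (norm (x\<^sup>2)) < fps_conv_radius (fps_deriv (M_fps (1/2)))"
        by (rule less_le_trans[OF _ fps_conv_radius_deriv])
      have "fps_conv_radius (1 - fps_X :: real fps) = \<infinity>"
        using fps_conv_radius_diff[of "1 :: real fps" fps_X] by simp
      moreover have "eval_fps (fps_deriv (M_fps (1/2)) * (1 - fps_X)) (x\<^sup>2) =
          eval_fps (fps_const (1/3) * N_fps (1/2)) (x\<^sup>2)"
        using fps_deriv_hyp_fps_balanced[of "1/2" 1] by simp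
      ultimately have h: "?M' (x\<^sup>2) * (1 - x\<^sup>2) = 1/3 * eval_fps (N_fps (1/2)) (x\<^sup>2)"
        using x rad' GHMN_radius(4)[of "1/2"] by (simp add: eval_fps_mult eval_fps_diff)
      have "2 * (x\<^sup>2 * ?M' (x\<^sup>2)) * (1 - x\<^sup>2) = 2 * x\<^sup>2 * (?M' (x\<^sup>2) * (1 - x\<^sup>2))"
        by (simp only: mult_ac)
      also have "\<dots> = 2/3 * (x\<^sup>2 * eval_fps (N_fps (1/2)) (x\<^sup>2))"
        unfolding h by simp
      also have "\<dots> = 1 - (1 - x\<^sup>2) * ?M (x\<^sup>2)"
        unfolding eval_N_half[OF x(1)] by simp
      finally have "2 * (x\<^sup>2 * ?M' (x\<^sup>2)) = (1 - (1 - x\<^sup>2) * ?M (x\<^sup>2)) / (1 - x\<^sup>2)"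
        using x by (subst eq_divide_eq) auto
      also have "\<dots> = 1 / (1 - x\<^sup>2) - ?M (x\<^sup>2)"
        using x by (simp add: diff_divide_distrib)
      finally have eq: "?M (x\<^sup>2) + x * (?M' (x\<^sup>2) * (2 * x)) - 1 / (1 - x\<^sup>2) = 0"
        by (simp add: power2_eq_square algebra_simps)
      have "((\<lambda>x. ?M (x\<^sup>2)) has_real_derivative ?M' (x\<^sup>2) * (2 * x)) (at x)"
        by (rule DERIV_chain2[where f = ?M and g = "\<lambda>x. x\<^sup>2"])
           (use rad in \<open>auto intro!: has_field_derivative_eval_fps derivative_eq_intros\<close>)
      then have "((\<lambda>x. x * ?M (x\<^sup>2) - artanh x) has_real_derivative
          ?M (x\<^sup>2) + x * (?M' (x\<^sup>2) * (2 * x)) - 1 / (1 - x\<^sup>2)) (at x)"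
        using that by (auto intro!: derivative_eq_intros)
      then show ?thesis unfolding eq .
    qed
    show "continuous_on {0..r} (\<lambda>x. x * ?M (x\<^sup>2) - artanh x)"
      using assms by (intro continuous_at_imp_continuous_on ballI DERIV_isCont[OF deriv]) auto
    show "((\<lambda>x. x * ?M (x\<^sup>2) - artanh x) has_real_derivative 0) (at x)" if "0 < x" "x < r" for x
      using that assms by (intro deriv) auto
  qed
  then show ?thesis using assms by (simp add: field_simps)
qed

lemma acoeff2_eq: "acoeff2 k = q_fps (1/2) $ k"
proof (induction k rule: less_induct)
  case (less k)
  show ?case
  proof (cases k)
    case (Suc m)
    have "H_fps (1/2) $ k = (\<Sum>i\<le>k. q_fps (1/2) $ i * N_fps (1/2) $ (k - i))"
      by (subst q_mult_N[of "1/2", symmetric]) (simp_all add: fps_mult_nth atLeast0AtMost)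
    also have "\<dots> = (\<Sum>i<k. q_fps (1/2) $ i * N_fps (1/2) $ (k - i)) + q_fps (1/2) $ k"
      by (simp add: lessThan_Suc_atMost[symmetric])
    also have "(\<Sum>i<k. q_fps (1/2) $ i * N_fps (1/2) $ (k - i)) =
        3 * (\<Sum>j<k. acoeff2 j / ((2 * real (k - j) + 1) * (2 * real (k - j) + 3)))"
      unfolding sum_distrib_left
    proof (rule sum.cong)
      fix i assume "i \<in> {..<k}"
      then show "q_fps (1/2) $ i * N_fps (1/2) $ (k - i) =
          3 * (acoeff2 i / ((2 * real (k - i) + 1) * (2 * real (k - i) + 3)))"
        unfolding N_half_nth using less[of i] by simp
    qed simp
    finally have "q_fps (1/2) $ k = H_fps (1/2) $ k -
        3 * (\<Sum>j<k. acoeff2 j / ((2 * real (k - j) + 1) * (2 * real (k - j) + 3)))" by simp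
    moreover have "H_fps (1/2) $ k = 1 / (real k + 1) * (pochhammer (1/2) k / fact k)\<^sup>2"
    proof -
      have "H_fps (1/2) $ k = 1 / (real k + 1) * hyp_fps (1/2) (1/2) 1 $ k"
        using hyp_fps_balanced_plus1_nth[of "1/2" "1/2" k] by (simp add: add.commute)
      also have "hyp_fps (1/2) (1/2) 1 $ k = (pochhammer (1/2) k / fact k)\<^sup>2"
        by (simp add: hyp_fps_def pochhammer_fact[symmetric] power2_eq_square)
      finally show ?thesis .
    qed
    ultimately show ?thesis
      unfolding Suc by (simp only: acoeff2.simps)
  qed (simp add: q_nth_0)
qed

lemma ellK_half_eq:
  assumes "0 < r" "r < 1"
  shows "ellK (1/2) r =
          (ellE (1/2) r - (1 - r\<^sup>2) * ellK (1/2) r) / (1 - ((1 - r\<^sup>2) * artanh r) / r) * (artanh r / r)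
          + 3 * pi / 8 * (\<Sum>k. acoeff (1/2) k * r ^ (2 * k))"
    and "summable (\<lambda>k. acoeff2 k * r ^ (2 * k))"
    and "ellK (1/2) r = 3 * pi / 8 * ((\<Sum>k. acoeff2 k * r ^ (2 * k)) * (artanh r / r)
                        + (\<Sum>k. acoeff (1/2) k * r ^ (2 * k)))"
proof -
  have x: "0 < r\<^sup>2" "r\<^sup>2 < 1" using assms by (auto simp: power_less_one_iff)
  let ?S = "\<Sum>k. acoeff (1/2) k * r ^ (2 * k)"
  define W where "W = ellE (1/2) r - (1 - r\<^sup>2) * ellK (1/2) r"
  have N: "hypF (1/2) 1 (5/2) (r\<^sup>2) = 3/2 * (1 - ((1 - r\<^sup>2) * artanh r) / r) / r\<^sup>2"
    using eval_N_half[of "r\<^sup>2"] eval_M_half[OF assms] x by (simp add: hypF_eq_eval_hyp_fps field_simps)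
  have M: "hypF (1/2) 1 (3/2) (r\<^sup>2) = artanh r / r"
    using eval_M_half[OF assms] by (simp add: hypF_eq_eval_hyp_fps)
  have alpha: "alpha (1/2) = 4/3" by (simp add: alpha_def)
  have K: "ellK (1/2) r = 3/4 * (W / (1/2 * r\<^sup>2) * (hypF (1/2) 1 (3/2) (r\<^sup>2) / hypF (1/2) 1 (5/2) (r\<^sup>2)))
      + 3 * pi / 8 * ?S"
  proof -
    have "alpha (1/2) * ellK (1/2) r =
        W / (1/2 * r\<^sup>2) * (hypF (1/2) 1 (3/2) (r\<^sup>2) / hypF (1/2) 1 (5/2) (r\<^sup>2)) + pi / 2 * ?S"
      using alpha_ellK_eq[of "1/2" r] assms by (simp add: W_def)
    then show ?thesis unfolding alpha by linarith
  qed
  have "eval_fps (N_fps (1/2)) (r\<^sup>2) \<ge> 1" using GHMN_ge_1(4)[of "1/2" "r\<^sup>2"] x by simp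
  then have "1 - ((1 - r\<^sup>2) * artanh r) / r \<noteq> 0"
    using N by (auto simp: hypF_eq_eval_hyp_fps)
  then show "ellK (1/2) r = W / (1 - ((1 - r\<^sup>2) * artanh r) / r) * (artanh r / r) + 3 * pi / 8 * ?S"
    using x unfolding K M N by (simp add: field_simps)
  have q: "(\<lambda>k. acoeff2 k * r ^ (2 * k)) sums eval_fps (q_fps (1/2)) (r\<^sup>2)"
    using sums_eval_fps[of "r\<^sup>2" "q_fps (1/2)"] in_q_radius[of "1/2" "r\<^sup>2"] x
    by (simp add: acoeff2_eq power_mult)
  then show "summable (\<lambda>k. acoeff2 k * r ^ (2 * k))" by (rule sums_summable)
  have "eval_fps (q_fps (1/2)) (r\<^sup>2) = hypF (1/2) (1/2) 2 (r\<^sup>2) / hypF (1/2) 1 (5/2) (r\<^sup>2)"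
    using eval_q_mult_N[of "1/2" "r\<^sup>2"] x \<open>eval_fps (N_fps (1/2)) (r\<^sup>2) \<ge> 1\<close>
    by (simp add: hypF_eq_eval_hyp_fps eq_divide_eq)
  with q have q': "(\<Sum>k. acoeff2 k * r ^ (2 * k)) = hypF (1/2) (1/2) 2 (r\<^sup>2) / hypF (1/2) 1 (5/2) (r\<^sup>2)"
    by (simp only: sums_iff)
  have W: "W / (1/2 * r\<^sup>2) = pi / 2 * hypF (1/2) (1/2) 2 (r\<^sup>2)"
    using ellE_minus_ellK[of "1/2" r] assms by (simp add: W_def)
  show "ellK (1/2) r = 3 * pi / 8 * ((\<Sum>k. acoeff2 k * r ^ (2 * k)) * (artanh r / r) + ?S)"
    unfolding K W q' M by (simp add: algebra_simps)
qed

subsection \<open>The inequalities (A), (B), (C) and (D)\<close>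

lemma acoeff_tendsto_0: "((\<lambda>a. acoeff a k) \<longlongrightarrow> 0) (at_right 0)"
proof (rule tendsto_sandwich[OF _ _ tendsto_const alpha_beta_tendsto_0(2)])
  have "\<forall>\<^sub>F a in at_right (0::real). a \<in> {0<..<1}"
    by (rule eventually_at_right_real) simp
  then show "\<forall>\<^sub>F a in at_right 0. 0 \<le> acoeff a k" "\<forall>\<^sub>F a in at_right 0. acoeff a k \<le> alpha a * beta a"
    by (auto elim!: eventually_mono intro: less_imp_le acoeff_pos acoeff_less)
qed

context
  fixes a :: real and n :: nat
  assumes a: "0 < a" "a < 1"
begin

definition f2_tail :: "real \<Rightarrow> real" where
  "f2_tail x = f2 a x - (\<Sum>k<n + 2. acoeff a k * x ^ k)"

lemma f2_tail_between:
  assumes "0 < x" "x < 1"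
  shows "acoeff a (n + 2) * x ^ (n + 2) < f2_tail x" "f2_tail x < delta n a * x ^ (n + 2)" "0 < f2_tail x" "f2_tail x < delta n a"
proof -
  show 1: "acoeff a (n + 2) * x ^ (n + 2) < f2_tail x" and 2: "f2_tail x < delta n a * x ^ (n + 2)"
    using f2_tail_bounds[OF a assms, of "n + 2"] unfolding f2_tail_def delta_eq[OF a] by auto
  have "acoeff a (n + 2) * x ^ (n + 2) > 0"
    using acoeff_pos[OF a] assms by simp
  with 1 show "0 < f2_tail x" by linarith
  have "delta n a * x ^ (n + 2) \<le> delta n a"
    using delta_pos[OF a, of n] assms by (intro mult_left_le power_le_one) auto
  with 2 show "f2_tail x < delta n a" by linarith
qed

lemma P_sqrt: "0 \<le> r \<Longrightarrow> P n a (sqrt r) = (\<Sum>k<n + 2. acoeff a k * r ^ k)"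
  by (simp add: P_def power_mult lessThan_Suc_atMost del: sum.lessThan_Suc sum.atMost_Suc)

lemma P_eq: "P n a r = (\<Sum>k<n + 2. acoeff a k * (r\<^sup>2) ^ k)"
  by (simp add: P_def power_mult lessThan_Suc_atMost del: sum.lessThan_Suc sum.atMost_Suc)

lemma Lambda1_eq: "Lambda1 a r = alpha a * hypF a (1 - a) 1 r - f2 a r"
  by (simp add: f2_def)

lemma A_mid_eq:
  assumes "0 < r" "r < 1"
  shows "A_mid n c a r = (c - alpha a) * hypF a (1 - a) 1 (r\<^sup>2) + f2_tail (r\<^sup>2)"
proof -
  have x: "0 < r\<^sup>2" "r\<^sup>2 < 1" using assms by (auto simp: power_less_one_iff)
  have "(ellE a r - (1 - r\<^sup>2) * ellK a r) / (pi * a * r\<^sup>2) = 1 / 2 * hypF a (1 - a) 2 (r\<^sup>2)"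
    using ellE_minus_ellK[OF a assms] a assms by (simp add: field_simps)
  moreover have "hypF a (1 - a) 2 (r\<^sup>2) * (hypF a (3 / 2 - a) (3 / 2) (r\<^sup>2) / hypF a (3 / 2 - a) (5 / 2) (r\<^sup>2))
      = alpha a * hypF a (1 - a) 1 (r\<^sup>2) - f2 a (r\<^sup>2)"
    using hypF_G_gt_1[OF a x] unfolding Lambda1_eq[symmetric] by (simp add: Lambda1_def Lambda_def)
  ultimately show ?thesis
    unfolding A_mid_def P_eq f2_tail_def by (simp add: ellK_def algebra_simps)
qed

lemma B_mid_eq:
  assumes "0 < r" "r < 1"
  shows "B_mid n c a r = (c - alpha a) * hypF a (1 - a) 1 r + f2_tail r"
  using assms unfolding B_mid_def f2_tail_def Lambda1_eq by (simp add: P_sqrt algebra_simps)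

lemma A_mid_bounds:
  assumes "0 < r" "r < 1"
  shows "0 < A_mid n (alpha a) a r" "A_mid n (alpha a) a r < delta n a * r ^ (2 * (n + 2))"
    "A_mid n (alpha a) a r < delta n a"
  using f2_tail_between[of "r\<^sup>2"] assms unfolding A_mid_eq[OF assms] power_mult
  by (auto simp: power_less_one_iff)

lemma B_mid_bounds:
  assumes "0 < r" "r < 1"
  shows "acoeff a (n + 2) * r ^ (n + 2) < B_mid n (alpha a) a r"
    "B_mid n (alpha a) a r < delta n a * r ^ (n + 2)"
  using f2_tail_between[of r] assms unfolding B_mid_eq[OF assms] by auto

lemma Q_eq:
  assumes r: "0 < r" "r < 1"
  shows "Q n a r = a * ((hypF a (1 - a) 1 r - 1 - a * (1 - a) * r) / (3 * (1 - a) * r))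
    - (\<Sum>k=1..n. acoeff a (k + 1) * r ^ k)"
proof -
  let ?G = "hyp_fps a (1 - a) 1"
  have sum: "summable (\<lambda>k. ?G $ k * r ^ k)"
    using summable_fps[of r ?G] GHMN_radius(1)[OF a] r by simp
  have coeff: "pochhammer a k * pochhammer (1 - a) k / (fact k)\<^sup>2 = ?G $ k" for k
    by (simp add: hyp_fps_def pochhammer_fact[symmetric] power2_eq_square)
  have "(\<Sum>k. ?G $ (k + 2) * r ^ (k + 1)) * r = (\<Sum>k. ?G $ (k + 2) * r ^ (k + 2))"
  proof -
    have "summable (\<lambda>k. ?G $ (k + 2) * r ^ (k + 2))"
      using sum summable_iff_shift[of "\<lambda>k. ?G $ k * r ^ k" 2] by simp
    then have "summable (\<lambda>k. 1 / r * (?G $ (k + 2) * r ^ (k + 2)))"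
      by (rule summable_mult)
    then have "summable (\<lambda>k. ?G $ (k + 2) * r ^ (k + 1))"
      using r by (simp add: mult_ac)
    from suminf_mult2[OF this, of r] show ?thesis by (simp add: mult_ac)
  qed
  also have "\<dots> = hypF a (1 - a) 1 r - 1 - a * (1 - a) * r"
    using suminf_minus_initial_segment[OF sum, of 2]
    by (simp add: hypF_eq_eval_hyp_fps eval_fps_def numeral_2_eq_2 hyp_fps_nth_Suc)
  finally have "(\<Sum>k. ?G $ (k + 2) * r ^ (k + 1)) = (hypF a (1 - a) 1 r - 1 - a * (1 - a) * r) / r"
    using r by (simp add: eq_divide_eq)
  then show ?thesis
    unfolding Q_def coeff by simp
qed

lemma C_bounds:
  assumes r: "0 < r" "r < 1"
  defines "C \<equiv> (Lambda1 a r - hypF a (1 - a) 1 r) / r - a * (7 * a - 3) / 30 - Q n a r"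
  shows "- delta n a * r ^ (n + 1) < C" "C < - acoeff a (n + 2) * r ^ (n + 1)"
proof -
  have shift: "(\<Sum>k<n + 2. acoeff a k * r ^ k) =
      acoeff a 0 + acoeff a 1 * r + r * (\<Sum>k=1..n. acoeff a (k + 1) * r ^ k)" for n
    by (induction n) (simp_all add: algebra_simps)
  have "alpha a - 1 = a / (3 * (1 - a))" using a by (simp add: alpha_def field_simps)
  then have Q: "Q n a r = (alpha a - 1) * ((hypF a (1 - a) 1 r - 1 - a * (1 - a) * r) / r)
      - (\<Sum>k=1..n. acoeff a (k + 1) * r ^ k)"
    using Q_eq[OF r] by simp
  have c1: "(alpha a - 1) * (a * (1 - a)) - acoeff a 1 = a * (7 * a - 3) / 30"
    using f1_fps_nth_1[OF a] acoeff_eq[OF a, of 1] by (simp add: f1_fps_def[OF a] hyp_fps_nth_Suc)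
  have "f2_tail r = r * - C"
  proof -
    have "r * C = f1 a r - a * (7 * a - 3) / 30 * r - r * Q n a r"
      unfolding C_def f1_def right_diff_distrib using r by simp
    also have "r * Q n a r = (alpha a - 1) * (hypF a (1 - a) 1 r - 1 - a * (1 - a) * r)
        - r * (\<Sum>k=1..n. acoeff a (k + 1) * r ^ k)"
    proof -
      have "r * (p * (X / r) - S) = p * X - r * S" for p X S :: real
        using r by (simp add: right_diff_distrib)
      then show ?thesis unfolding Q .
    qed
    finally show ?thesis
      unfolding f2_tail_def shift f1_eq[OF a] c1[symmetric] acoeff_0[OF a] by (simp add: algebra_simps)
  qed
  then have "acoeff a (n + 2) * r ^ (n + 1) * r < (- C) * r" "(- C) * r < delta n a * r ^ (n + 1) * r"
    using f2_tail_between[OF r] by (simp_all add: mult_ac)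
  then have "acoeff a (n + 2) * r ^ (n + 1) < - C" "- C < delta n a * r ^ (n + 1)"
    using r by (metis mult_less_cancel_right_pos)+
  then show "- delta n a * r ^ (n + 1) < C" "C < - acoeff a (n + 2) * r ^ (n + 1)" by auto
qed

lemma D_terms_nth:
  fixes c :: real
  assumes r: "0 < r" "r < 1"
  defines "F \<equiv> hypF a (1 - a) 1 r"
  shows "D_terms n c a r ! 0 = c - c * beta a"
    "D_terms n c a r ! 1 = c - c * beta a / F"
    "D_terms n c a r ! 2 = c - c * beta a * r ^ (n + 2) / F"
    "D_terms n c a r ! 3 = c - (P n a (sqrt r) + delta n a * r ^ (n + 2)) / F"
    "D_terms n c a r ! 4 = alpha a - f2 a r / F"
    "D_terms n c a r ! 5 = c - P (n + 1) a (sqrt r) / F"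
    "D_terms n c a r ! 6 = c - (r ^ (n + 2) * (\<Sum>k\<le>n + 2. acoeff a k) + acoeff a 0 * (1 - r ^ (n + 2))) / F"
    "D_terms n c a r ! 7 = c - eta a / F"
    "D_terms n c a r ! 8 = c"
proof -
  have "F > 1" unfolding F_def by (rule hypF_G_gt_1[OF a r])
  then have "Lambda a r = alpha a - f2 a r / F"
    unfolding f2_def Lambda1_def F_def by (simp add: divide_simps algebra_simps)
  then show "D_terms n c a r ! 4 = alpha a - f2 a r / F"
    by (simp add: D_terms_def Let_def)
qed (simp_all add: D_terms_def Let_def F_def right_diff_distrib)

lemma P_Suc_sqrt: "0 \<le> r \<Longrightarrow> P (n + 1) a (sqrt r) = (\<Sum>k<n + 3. acoeff a k * r ^ k)"
proof -
  have "{..n + 1 + 1} = {..<n + 3}" by auto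
  then show "0 \<le> r \<Longrightarrow> ?thesis"
    by (simp add: P_def power_mult)
qed

lemma D_chain:
  assumes r: "0 < r" "r < 1"
  defines "F \<equiv> hypF a (1 - a) 1 r" and "S \<equiv> alpha a * beta a"
    and "x3 \<equiv> P n a (sqrt r) + delta n a * r ^ (n + 2)"
    and "x5 \<equiv> P (n + 1) a (sqrt r)"
    and "x6 \<equiv> r ^ (n + 2) * (\<Sum>k\<le>n + 2. acoeff a k) + acoeff a 0 * (1 - r ^ (n + 2))"
  shows "F > 1" "0 < S" "S * r ^ (n + 2) < S" "S * r ^ (n + 2) < x3" "x3 < S"
    "f2 a r < x3" "x5 < f2 a r" "x6 < x5" "eta a < x6" "0 < eta a"
proof -
  have S: "S > 0" using alpha_gt_1[OF a] beta_bounds[OF a] by (simp add: S_def)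
  have rn: "0 < r ^ (n + 2)" "r ^ (n + 2) < 1" using r by (auto simp: power_less_one_iff simp del: power_Suc)
  have A: "acoeff a k > 0" for k by (rule acoeff_pos[OF a])
  have d: "delta n a > 0" "S = delta n a + (\<Sum>k<n + 2. acoeff a k)"
    using delta_pos[OF a, of n] by (simp_all add: delta_eq[OF a] S_def)
  show "F > 1" unfolding F_def by (rule hypF_G_gt_1[OF a r])
  show "0 < S" by (rule S)
  show "S * r ^ (n + 2) < S" using S rn by auto
  have P: "P n a (sqrt r) = (\<Sum>k<n + 2. acoeff a k * r ^ k)" using r by (intro P_sqrt) auto
  have "(\<Sum>k<n + 2. acoeff a k * r ^ (n + 2)) < (\<Sum>k<n + 2. acoeff a k * r ^ k)"
    using A r by (intro sum_strict_mono mult_strict_left_mono power_strict_decreasing) auto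
  then show "S * r ^ (n + 2) < x3"
    unfolding x3_def P d by (simp only: distrib_right sum_distrib_right)
  have "(\<Sum>k<n + 2. acoeff a k * r ^ k) \<le> (\<Sum>k<n + 2. acoeff a k)"
    using A r by (intro sum_mono mult_left_le power_le_one) (auto intro: less_imp_le)
  moreover have "delta n a * r ^ (n + 2) < delta n a" using d rn by simp
  ultimately show "x3 < S" unfolding x3_def P d by linarith
  show "f2 a r < x3"
    using f2_tail_between(2)[OF r] unfolding x3_def P f2_tail_def by linarith
  have x5: "x5 = (\<Sum>k<n + 3. acoeff a k * r ^ k)"
    unfolding x5_def using r by (intro P_Suc_sqrt) auto
  show "x5 < f2 a r"
    using f2_tail_bounds(1)[OF a r, of "n + 3"] mult_pos_pos[OF A[of "n + 3"], of "r ^ (n + 3)"] r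
    unfolding x5 by auto
  have x6: "x6 = acoeff a 0 + (\<Sum>k<n + 2. acoeff a (Suc k) * r ^ (n + 2))"
  proof -
    have "{..n + 2} = {..<Suc (n + 2)}" by auto
    then show ?thesis
      unfolding x6_def by (simp only: sum.lessThan_Suc_shift sum_distrib_left sum_distrib_right)
        (simp add: algebra_simps sum_distrib_left)
  qed
  have "(\<Sum>k<n + 2. acoeff a (Suc k) * r ^ (n + 2)) < (\<Sum>k<n + 2. acoeff a (Suc k) * r ^ Suc k)"
  proof (rule sum_strict_mono_ex1)
    show "\<forall>k\<in>{..<n + 2}. acoeff a (Suc k) * r ^ (n + 2) \<le> acoeff a (Suc k) * r ^ Suc k"
      using A r by (intro ballI mult_left_mono power_decreasing) (auto intro: less_imp_le)
    show "\<exists>k\<in>{..<n + 2}. acoeff a (Suc k) * r ^ (n + 2) < acoeff a (Suc k) * r ^ Suc k"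
      using A r by (intro bexI[of _ 0] mult_strict_left_mono power_strict_decreasing) auto
  qed auto
  moreover have "x5 = acoeff a 0 + (\<Sum>k<n + 2. acoeff a (Suc k) * r ^ Suc k)"
  proof -
    have "n + 3 = Suc (n + 2)" by simp
    then show ?thesis unfolding x5 by (simp only: sum.lessThan_Suc_shift) simp
  qed
  ultimately show "x6 < x5" unfolding x6 by linarith
  have "(\<Sum>k<n + 2. acoeff a (Suc k) * r ^ (n + 2)) \<ge> 0"
    using A r by (intro sum_nonneg) (auto intro: less_imp_le)
  moreover have "eta a < acoeff a 0"
    using a by (simp add: acoeff_0[OF a] alpha_def eta_def divide_simps)
  ultimately show "eta a < x6" unfolding x6 by linarith
  show "0 < eta a" using a by (simp add: eta_def)
qed

lemma D_links_less:
  assumes r: "0 < r" "r < 1" and ij: "(i, j) \<in> D_links"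
  shows "D_terms n (alpha a) a r ! i < D_terms n (alpha a) a r ! j"
proof -
  note chain = D_chain[OF r]
  have F: "hypF a (1 - a) 1 r > 0" using chain(1) by simp
  have "alpha a * beta a / hypF a (1 - a) 1 r < alpha a * beta a"
    using F mult_strict_left_mono[OF chain(1,2)] by (simp add: divide_less_eq)
  then have 01: "alpha a - alpha a * beta a < alpha a - alpha a * beta a / hypF a (1 - a) 1 r"
    by simp
  have 78: "alpha a - eta a / hypF a (1 - a) 1 r < alpha a"
    using chain(10) F by simp
  have less: "alpha a - X / hypF a (1 - a) 1 r < alpha a - Y / hypF a (1 - a) 1 r" if "Y < X" for X Y
    using that F by (simp add: divide_strict_right_mono)
  from ij show ?thesis
    unfolding D_links_def
  proof (elim insertE emptyE Pair_inject)
    assume "i = 0" "j = 1"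
    then show ?thesis by (simp only: D_terms_nth[OF r]) (rule 01)
  next
    assume "i = 1" "j = 2"
    then show ?thesis by (simp only: D_terms_nth[OF r]) (rule less, use chain in linarith)
  next
    assume "i = 3" "j = 2"
    then show ?thesis by (simp only: D_terms_nth[OF r]) (rule less, use chain in linarith)
  next
    assume "i = 1" "j = 3"
    then show ?thesis by (simp only: D_terms_nth[OF r]) (rule less, use chain in linarith)
  next
    assume "i = 3" "j = 4"
    then show ?thesis by (simp only: D_terms_nth[OF r]) (rule less, use chain in linarith)
  next
    assume "i = 4" "j = 5"
    then show ?thesis by (simp only: D_terms_nth[OF r]) (rule less, use chain in linarith)
  next
    assume "i = 5" "j = 6"
    then show ?thesis by (simp only: D_terms_nth[OF r]) (rule less, use chain in linarith)
  next
    assume "i = 6" "j = 7"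
    then show ?thesis by (simp only: D_terms_nth[OF r]) (rule less, use chain in linarith)
  next
    assume "i = 7" "j = 8"
    then show ?thesis by (simp only: D_terms_nth[OF r]) (rule 78)
  qed
qed

lemma D_terms_range:
  assumes r: "0 < r" "r < 1" and i: "i \<le> 8"
  shows "alpha a - alpha a * beta a \<le> D_terms n (alpha a) a r ! i" "D_terms n (alpha a) a r ! i \<le> alpha a"
proof -
  note chain = D_chain[OF r]
  have F: "hypF a (1 - a) 1 r > 1" using chain(1) by simp
  have range: "alpha a - alpha a * beta a \<le> alpha a - X / hypF a (1 - a) 1 r \<and>
      alpha a - X / hypF a (1 - a) 1 r \<le> alpha a"
    if "0 < X" "X \<le> alpha a * beta a" for X
  proof -
    have "X / hypF a (1 - a) 1 r \<le> X / 1"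
      using that F by (intro divide_left_mono) auto
    moreover have "X / hypF a (1 - a) 1 r > 0" using that F by auto
    ultimately show ?thesis using that by auto
  qed
  have "i \<in> {0, 1, 2, 3, 4, 5, 6, 7, 8}" using i by auto
  then have "alpha a - alpha a * beta a \<le> D_terms n (alpha a) a r ! i \<and> D_terms n (alpha a) a r ! i \<le> alpha a"
  proof (elim insertE emptyE)
    assume "i = 0"
    then show ?thesis using chain(2) by (simp only: D_terms_nth[OF r]) simp
  next
    assume "i = 8"
    then show ?thesis using chain(2) by (simp only: D_terms_nth[OF r]) simp
  next
    assume "i = 1"
    then show ?thesis using chain by (simp only: D_terms_nth[OF r]) (rule range, linarith+)
  next
    assume "i = 2"
    then show ?thesis using chain r by (simp only: D_terms_nth[OF r]) (rule range, simp, linarith)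
  next
    assume "i = 3"
    then show ?thesis using chain by (simp only: D_terms_nth[OF r]) (rule range, linarith+)
  next
    assume "i = 4"
    then show ?thesis using chain by (simp only: D_terms_nth[OF r]) (rule range, linarith+)
  next
    assume "i = 5"
    then show ?thesis using chain by (simp only: D_terms_nth[OF r]) (rule range, linarith+)
  next
    assume "i = 6"
    then show ?thesis using chain by (simp only: D_terms_nth[OF r]) (rule range, linarith+)
  next
    assume "i = 7"
    then show ?thesis using chain by (simp only: D_terms_nth[OF r]) (rule range, linarith+)
  qed
  then show "alpha a - alpha a * beta a \<le> D_terms n (alpha a) a r ! i" "D_terms n (alpha a) a r ! i \<le> alpha a"
    by auto
qed

end

subsection \<open>Sharpness and optimality\<close>

lemma A_mid_tendsto_a_0:
  assumes r: "0 < r" "r < 1"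
  shows "((\<lambda>a. A_mid n (alpha a) a r) \<longlongrightarrow> 0) (at_right 0)"
    "((\<lambda>a. delta n a * r ^ (2 * (n + 2)) - A_mid n (alpha a) a r) \<longlongrightarrow> 0) (at_right 0)"
proof -
  have bounds: "0 < A_mid n (alpha a) a r" "A_mid n (alpha a) a r < delta n a * r ^ (2 * (n + 2))"
    "delta n a * r ^ (2 * (n + 2)) < alpha a * beta a" if a: "a \<in> {0<..<1}" for a
  proof -
    have "delta n a * r ^ (2 * (n + 2)) \<le> delta n a"
      using delta_pos[of a n] a r by (intro mult_left_le power_le_one) auto
    then show "delta n a * r ^ (2 * (n + 2)) < alpha a * beta a"
      using delta_less[of a n] a by auto
  qed (use A_mid_bounds[of a r n] a r in auto)
  have ev: "\<forall>\<^sub>F a in at_right (0::real). a \<in> {0<..<1}"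
    by (rule eventually_at_right_real) simp
  show "((\<lambda>a. A_mid n (alpha a) a r) \<longlongrightarrow> 0) (at_right 0)"
  proof (rule tendsto_sandwich[OF _ _ tendsto_const alpha_beta_tendsto_0(2)])
    show "\<forall>\<^sub>F a in at_right 0. 0 \<le> A_mid n (alpha a) a r"
      using ev by eventually_elim (rule less_imp_le[OF bounds(1)])
    show "\<forall>\<^sub>F a in at_right 0. A_mid n (alpha a) a r \<le> alpha a * beta a"
      using ev by eventually_elim (rule less_imp_le[OF less_trans[OF bounds(2,3)]])
  qed
  show "((\<lambda>a. delta n a * r ^ (2 * (n + 2)) - A_mid n (alpha a) a r) \<longlongrightarrow> 0) (at_right 0)"
  proof (rule tendsto_sandwich[OF _ _ tendsto_const alpha_beta_tendsto_0(2)])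
    show "\<forall>\<^sub>F a in at_right 0. 0 \<le> delta n a * r ^ (2 * (n + 2)) - A_mid n (alpha a) a r"
      using ev
    proof eventually_elim
      case (elim a)
      show ?case using bounds(2)[OF elim] by linarith
    qed
    show "\<forall>\<^sub>F a in at_right 0. delta n a * r ^ (2 * (n + 2)) - A_mid n (alpha a) a r \<le> alpha a * beta a"
      using ev
    proof eventually_elim
      case (elim a)
      show ?case using bounds(1,3)[OF elim] by linarith
    qed
  qed
qed

lemma D_terms_tendsto_a_0:
  assumes r: "0 < r" "r < 1" and ij: "i \<le> 8" "j \<le> 8"
  shows "((\<lambda>a. D_terms n (alpha a) a r ! j - D_terms n (alpha a) a r ! i) \<longlongrightarrow> 0) (at_right 0)"
proof (rule Lim_null_comparison[OF _ alpha_beta_tendsto_0(2)])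
  have "\<forall>\<^sub>F a in at_right (0::real). a \<in> {0<..<1}"
    by (rule eventually_at_right_real) simp
  then show "\<forall>\<^sub>F a in at_right 0. norm (D_terms n (alpha a) a r ! j - D_terms n (alpha a) a r ! i)
      \<le> alpha a * beta a"
  proof eventually_elim
    case (elim a)
    then show ?case
      using D_terms_range[of a r i n] D_terms_range[of a r j n] r ij by (auto simp: abs_le_iff)
  qed
qed

context
  fixes a :: real and n :: nat
  assumes a: "0 < a" "a < 1"
begin

lemma A_mid_tendsto_r:
  "((\<lambda>r. A_mid n (alpha a) a r) \<longlongrightarrow> 0) (at_right 0)"
  "((\<lambda>r. delta n a * r ^ (2 * (n + 2)) - A_mid n (alpha a) a r) \<longlongrightarrow> 0) (at_right 0)"
  "((\<lambda>r. delta n a * r ^ (2 * (n + 2)) - A_mid n (alpha a) a r) \<longlongrightarrow> 0) (at_left 1)"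
proof -
  have ev: "\<forall>\<^sub>F r in at_right (0::real). r \<in> {0<..<1}"
    by (rule eventually_at_right_real) simp
  have pow: "((\<lambda>r. delta n a * r ^ (2 * (n + 2))) \<longlongrightarrow> 0) (at_right 0)"
    by (auto intro!: tendsto_eq_intros)
  show lim: "((\<lambda>r. A_mid n (alpha a) a r) \<longlongrightarrow> 0) (at_right 0)"
  proof (rule tendsto_sandwich[OF _ _ tendsto_const pow])
    show "\<forall>\<^sub>F r in at_right 0. 0 \<le> A_mid n (alpha a) a r"
      using ev by eventually_elim (rule less_imp_le[OF A_mid_bounds(1)[OF a]]; simp)
    show "\<forall>\<^sub>F r in at_right 0. A_mid n (alpha a) a r \<le> delta n a * r ^ (2 * (n + 2))"
      using ev by eventually_elim (rule less_imp_le[OF A_mid_bounds(2)[OF a]]; simp)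
  qed
  show "((\<lambda>r. delta n a * r ^ (2 * (n + 2)) - A_mid n (alpha a) a r) \<longlongrightarrow> 0) (at_right 0)"
    using tendsto_diff[OF pow lim] by simp
  have "filterlim (\<lambda>r::real. r\<^sup>2) (at_left 1) (at_left 1)"
    unfolding filterlim_at
  proof
    show "((\<lambda>r::real. r\<^sup>2) \<longlongrightarrow> 1) (at_left 1)" by (auto intro!: tendsto_eq_intros)
    show "\<forall>\<^sub>F r::real in at_left 1. r\<^sup>2 \<in> {..<1} \<and> r\<^sup>2 \<noteq> 1"
      using eventually_at_left_1
    proof eventually_elim
      case (elim r)
      then have "r\<^sup>2 < 1" by (simp add: power_less_one_iff)
      then show ?case by simp
    qed
  qed
  then have "((\<lambda>r. f2 a (r\<^sup>2)) \<longlongrightarrow> alpha a * beta a) (at_left 1)"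
    by (rule filterlim_compose[OF f2_tendsto[OF a]])
  then have "((\<lambda>r. delta n a * r ^ (2 * (n + 2)) - f2_tail a n (r\<^sup>2)) \<longlongrightarrow>
      delta n a * 1 ^ (2 * (n + 2)) - (alpha a * beta a - (\<Sum>k<n + 2. acoeff a k * (1\<^sup>2) ^ k))) (at_left 1)"
    unfolding f2_tail_def[OF a] by (intro tendsto_intros)
  then have "((\<lambda>r. delta n a * r ^ (2 * (n + 2)) - f2_tail a n (r\<^sup>2)) \<longlongrightarrow> 0) (at_left 1)"
    by (simp add: delta_eq[OF a])
  moreover have "\<forall>\<^sub>F r in at_left 1. delta n a * r ^ (2 * (n + 2)) - f2_tail a n (r\<^sup>2) =
      delta n a * r ^ (2 * (n + 2)) - A_mid n (alpha a) a r"
    using eventually_at_left_1 by eventually_elim (simp add: A_mid_eq[OF a])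
  ultimately show "((\<lambda>r. delta n a * r ^ (2 * (n + 2)) - A_mid n (alpha a) a r) \<longlongrightarrow> 0) (at_left 1)"
    by (rule Lim_transform_eventually)
qed

lemma G_unbounded:
  obtains x where "0 < x" "x < 1" "K < hypF a (1 - a) 1 x"
proof -
  have "\<forall>\<^sub>F x in at_left 1. K < hypF a (1 - a) 1 x"
    using G_filterlim[OF a] by (simp add: filterlim_at_top_dense)
  then have "\<forall>\<^sub>F x in at_left 1. K < hypF a (1 - a) 1 x \<and> 0 < x \<and> x < 1"
    using eventually_at_left_1 by (rule eventually_conj)
  then show thesis
    using eventually_happens[of _ "at_left (1::real)"] that by auto
qed

lemma alpha_le_if_tail_pos:
  assumes "\<And>x. 0 < x \<Longrightarrow> x < 1 \<Longrightarrow> 0 < (c - alpha a) * hypF a (1 - a) 1 x + f2_tail a n x"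
  shows "alpha a \<le> c"
proof (rule ccontr)
  assume "\<not> alpha a \<le> c"
  obtain x where x: "0 < x" "x < 1" "delta n a / (alpha a - c) < hypF a (1 - a) 1 x"
    by (rule G_unbounded)
  then have "delta n a < (alpha a - c) * hypF a (1 - a) 1 x"
    using \<open>\<not> alpha a \<le> c\<close> by (simp add: divide_less_eq mult.commute)
  then show False
    using assms[OF x(1,2)] f2_tail_between(4)[OF a x(1,2), of n] by (simp add: algebra_simps)
qed

lemma le_alpha_if_tail_less:
  assumes "\<And>x. 0 < x \<Longrightarrow> x < 1 \<Longrightarrow> (c - alpha a) * hypF a (1 - a) 1 x + f2_tail a n x < delta n a"
  shows "c \<le> alpha a"
proof (rule ccontr)
  assume "\<not> c \<le> alpha a"
  obtain x where x: "0 < x" "x < 1" "delta n a / (c - alpha a) < hypF a (1 - a) 1 x"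
    by (rule G_unbounded)
  then have "delta n a < (c - alpha a) * hypF a (1 - a) 1 x"
    using \<open>\<not> c \<le> alpha a\<close> by (simp add: divide_less_eq mult.commute)
  then show False
    using assms[OF x(1,2)] f2_tail_between(3)[OF a x(1,2), of n] by simp
qed

lemma A_mid_best:
  "(\<forall>r\<in>{0<..<1}. 0 < A_mid n c a r) \<Longrightarrow> alpha a \<le> c"
  "(\<forall>r\<in>{0<..<1}. A_mid n c a r < delta n a * r ^ (2 * (n + 2))) \<Longrightarrow> c \<le> alpha a"
proof -
  have eq: "A_mid n c a (sqrt x) = (c - alpha a) * hypF a (1 - a) 1 x + f2_tail a n x"
    if "0 < x" "x < 1" for x
    using A_mid_eq[OF a, of "sqrt x" n c] that by simp
  {
    assume "\<forall>r\<in>{0<..<1}. 0 < A_mid n c a r"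
    then show "alpha a \<le> c"
    proof (intro alpha_le_if_tail_pos)
      fix x :: real assume x: "0 < x" "x < 1"
      then have "0 < A_mid n c a (sqrt x)"
        using \<open>\<forall>r\<in>{0<..<1}. 0 < A_mid n c a r\<close> by simp
      then show "0 < (c - alpha a) * hypF a (1 - a) 1 x + f2_tail a n x"
        by (simp only: eq[OF x])
    qed
  next
    assume *: "\<forall>r\<in>{0<..<1}. A_mid n c a r < delta n a * r ^ (2 * (n + 2))"
    show "c \<le> alpha a"
    proof (rule le_alpha_if_tail_less)
      fix x :: real assume x: "0 < x" "x < 1"
      have "A_mid n c a (sqrt x) < delta n a * sqrt x ^ (2 * (n + 2))" using * x by simp
      also have "\<dots> \<le> delta n a"
        using delta_pos[OF a, of n] x by (intro mult_left_le power_le_one) auto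
      finally show "(c - alpha a) * hypF a (1 - a) 1 x + f2_tail a n x < delta n a"
        by (simp add: eq[OF x])
    qed
  }
qed

lemma B_mid_best:
  "(\<forall>r\<in>{0<..<1}. acoeff a (n + 2) * r ^ (n + 2) < B_mid n c a r) \<Longrightarrow> alpha a \<le> c"
  "(\<forall>r\<in>{0<..<1}. B_mid n c a r < delta n a * r ^ (n + 2)) \<Longrightarrow> c \<le> alpha a"
proof -
  assume *: "\<forall>r\<in>{0<..<1}. acoeff a (n + 2) * r ^ (n + 2) < B_mid n c a r"
  show "alpha a \<le> c"
  proof (rule alpha_le_if_tail_pos)
    fix x :: real assume x: "0 < x" "x < 1"
    have "0 < acoeff a (n + 2) * x ^ (n + 2)" using acoeff_pos[OF a] x by simp
    also have "\<dots> < B_mid n c a x" using * x by simp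
    finally show "0 < (c - alpha a) * hypF a (1 - a) 1 x + f2_tail a n x"
      by (simp add: B_mid_eq[OF a x])
  qed
next
  assume *: "\<forall>r\<in>{0<..<1}. B_mid n c a r < delta n a * r ^ (n + 2)"
  show "c \<le> alpha a"
  proof (rule le_alpha_if_tail_less)
    fix x :: real assume x: "0 < x" "x < 1"
    have "B_mid n c a x < delta n a * x ^ (n + 2)" using * x by simp
    also have "\<dots> \<le> delta n a"
      using delta_pos[OF a, of n] x by (intro mult_left_le power_le_one) auto
    finally show "(c - alpha a) * hypF a (1 - a) 1 x + f2_tail a n x < delta n a"
      by (simp add: B_mid_eq[OF a x])
  qed
qed

lemma D_terms_tendsto:
  assumes "1 \<le> i" "i \<le> 8"
  shows "((\<lambda>r. D_terms n c a r ! i) \<longlongrightarrow> (if i = 4 then alpha a else c)) (at_left 1)"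
proof -
  let ?F = "hypF a (1 - a) 1"
  have quot: "((\<lambda>r. D_terms n c a r ! i) \<longlongrightarrow> d) (at_left 1)"
    if "\<And>r. 0 < r \<Longrightarrow> r < 1 \<Longrightarrow> D_terms n c a r ! i = d - X r / ?F r" "(X \<longlongrightarrow> L) (at_left 1)" for X L d
  proof (rule Lim_transform_eventually)
    have "((\<lambda>r. X r / ?F r) \<longlongrightarrow> 0) (at_left 1)"
      using that(2) filterlim_at_top_imp_at_infinity[OF G_filterlim[OF a]] by (rule tendsto_divide_0)
    from tendsto_diff[OF tendsto_const[of d] this]
    show "((\<lambda>r. d - X r / ?F r) \<longlongrightarrow> d) (at_left 1)" by simp
    show "\<forall>\<^sub>F r in at_left 1. d - X r / ?F r = D_terms n c a r ! i"
      using eventually_at_left_1 by eventually_elim (simp add: that(1))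
  qed
  have P: "((\<lambda>r. P m a (sqrt r)) \<longlongrightarrow> P m a (sqrt 1)) (at_left 1)" for m
    unfolding P_def by (intro tendsto_intros)
  have "i \<in> {1, 2, 3, 4, 5, 6, 7, 8}" using assms by auto
  then show ?thesis
  proof (elim insertE emptyE)
    assume i: "i = 1"
    have "((\<lambda>r. D_terms n c a r ! i) \<longlongrightarrow> c) (at_left 1)"
      by (rule quot[where X = "\<lambda>_. c * beta a"], simp only: i D_terms_nth[OF a], rule tendsto_const)
    then show ?thesis by (simp add: i)
  next
    assume i: "i = 2"
    have "((\<lambda>r. D_terms n c a r ! i) \<longlongrightarrow> c) (at_left 1)"
      by (rule quot[where X = "\<lambda>r. c * beta a * r ^ (n + 2)" and L = "c * beta a * 1 ^ (n + 2)"], simp only: i D_terms_nth[OF a], intro tendsto_intros)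
    then show ?thesis by (simp add: i)
  next
    assume i: "i = 3"
    have "((\<lambda>r. D_terms n c a r ! i) \<longlongrightarrow> c) (at_left 1)"
      by (rule quot[where X = "\<lambda>r. P n a (sqrt r) + delta n a * r ^ (n + 2)" and L = "P n a (sqrt 1) + delta n a * 1 ^ (n + 2)"], simp only: i D_terms_nth[OF a], intro tendsto_intros P)
    then show ?thesis by (simp add: i)
  next
    assume i: "i = 4"
    have "((\<lambda>r. D_terms n c a r ! i) \<longlongrightarrow> alpha a) (at_left 1)"
      by (rule quot[where X = "f2 a"], simp only: i D_terms_nth[OF a], rule f2_tendsto[OF a])
    then show ?thesis by (simp add: i)
  next
    assume i: "i = 5"
    have "((\<lambda>r. D_terms n c a r ! i) \<longlongrightarrow> c) (at_left 1)"
      by (rule quot[where X = "\<lambda>r. P (n + 1) a (sqrt r)"], simp only: i D_terms_nth[OF a], rule P)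
    then show ?thesis by (simp add: i)
  next
    assume i: "i = 6"
    have "((\<lambda>r. D_terms n c a r ! i) \<longlongrightarrow> c) (at_left 1)"
      by (rule quot[where X = "\<lambda>r. r ^ (n + 2) * (\<Sum>k\<le>n + 2. acoeff a k) + acoeff a 0 * (1 - r ^ (n + 2))" and L = "1 ^ (n + 2) * (\<Sum>k\<le>n + 2. acoeff a k) + acoeff a 0 * (1 - 1 ^ (n + 2))"], simp only: i D_terms_nth[OF a], intro tendsto_intros)
    then show ?thesis by (simp add: i)
  next
    assume i: "i = 7"
    have "((\<lambda>r. D_terms n c a r ! i) \<longlongrightarrow> c) (at_left 1)"
      by (rule quot[where X = "\<lambda>_. eta a"], simp only: i D_terms_nth[OF a], rule tendsto_const)
    then show ?thesis by (simp add: i)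
  next
    assume i: "i = 8"
    show ?thesis by (simp add: i D_terms_def Let_def)
  qed
qed

lemma D_term_1_tendsto: "((\<lambda>r. D_terms n c a r ! 1) \<longlongrightarrow> c * (1 - beta a)) (at_right 0)"
proof (rule Lim_transform_eventually)
  have "isCont (eval_fps (G_fps a)) 0"
    by (intro continuous_eval_fps) (simp add: GHMN_radius[OF a])
  then have "(hypF a (1 - a) 1 \<longlongrightarrow> 1) (at_right 0)"
    unfolding hypF_eq_eval_hyp_fps[abs_def] isCont_def
    by (auto simp: eval_fps_at_0 intro: tendsto_within_subset[where S = UNIV])
  then have "((\<lambda>r. c - c * beta a / hypF a (1 - a) 1 r) \<longlongrightarrow> c - c * beta a / 1) (at_right 0)"
    by (intro tendsto_intros) auto
  then show "((\<lambda>r. c - c * beta a / hypF a (1 - a) 1 r) \<longlongrightarrow> c * (1 - beta a)) (at_right 0)"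
    by (simp add: right_diff_distrib)
  have "\<forall>\<^sub>F r in at_right (0::real). r \<in> {0<..<1}"
    by (rule eventually_at_right_real) simp
  then show "\<forall>\<^sub>F r in at_right 0. c - c * beta a / hypF a (1 - a) 1 r = D_terms n c a r ! 1"
    by eventually_elim (simp only: D_terms_nth[OF a] greaterThanLessThan_iff)
qed

lemma D_terms_best:
  assumes ij: "(i, j) \<in> D_links \<union> {(1, 4), (4, 6), (4, 7), (4, 8)}"
  shows "i \<noteq> 4 \<Longrightarrow> (\<forall>r\<in>{0<..<1}. D_terms n c a r ! i < D_terms n (alpha a) a r ! j) \<Longrightarrow> c \<le> alpha a"
    and "j \<noteq> 4 \<Longrightarrow> (\<forall>r\<in>{0<..<1}. D_terms n (alpha a) a r ! i < D_terms n c a r ! j) \<Longrightarrow> alpha a \<le> c"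
proof -
  have key: "c1 \<le> c2"
    if less: "\<forall>r\<in>{0<..<1}. D_terms n c1 a r ! i < D_terms n c2 a r ! j"
      and "i = 4 \<Longrightarrow> c1 = alpha a" "j = 4 \<Longrightarrow> c2 = alpha a" for c1 c2
  proof (cases "i = 0")
    case True
    then have j: "j = 1" using ij by (auto simp: D_links_def)
    have "c1 * (1 - beta a) \<le> c2 * (1 - beta a)"
    proof (rule tendsto_lowerbound)
      show "((\<lambda>r. D_terms n c2 a r ! 1) \<longlongrightarrow> c2 * (1 - beta a)) (at_right 0)"
        by (rule D_term_1_tendsto)
      have "\<forall>\<^sub>F r in at_right (0::real). r \<in> {0<..<1}"
        by (rule eventually_at_right_real) simp
      then show "\<forall>\<^sub>F r in at_right 0. c1 * (1 - beta a) \<le> D_terms n c2 a r ! 1"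
      proof eventually_elim
        case (elim r)
        then have "D_terms n c1 a r ! 0 < D_terms n c2 a r ! 1"
          using less True j by blast
        then show ?case by (simp add: D_terms_def Let_def)
      qed
    qed auto
    then show ?thesis using beta_bounds[OF a] by simp
  next
    case False
    then have ij': "1 \<le> i" "i \<le> 8" "1 \<le> j" "j \<le> 8"
      using ij by (auto simp: D_links_def)
    have "(if i = 4 then alpha a else c1) \<le> (if j = 4 then alpha a else c2)"
    proof (rule tendsto_le[OF _ D_terms_tendsto[OF ij'(3,4)] D_terms_tendsto[OF ij'(1,2)]])
      show "\<forall>\<^sub>F r in at_left 1. D_terms n c1 a r ! i \<le> D_terms n c2 a r ! j"
        using eventually_at_left_1 by eventually_elim (rule less_imp_le[OF bspec[OF less]]; simp)
    qed simp
    then show ?thesis using that(2,3) by (auto split: if_splits)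
  qed
  show "i \<noteq> 4 \<Longrightarrow> (\<forall>r\<in>{0<..<1}. D_terms n c a r ! i < D_terms n (alpha a) a r ! j) \<Longrightarrow> c \<le> alpha a"
    by (rule key) auto
  show "j \<noteq> 4 \<Longrightarrow> (\<forall>r\<in>{0<..<1}. D_terms n (alpha a) a r ! i < D_terms n c a r ! j) \<Longrightarrow> alpha a \<le> c"
    by (rule key) auto
qed

end

subsection \<open>Differentiation with respect to a parameter\<close>

context
  fixes p d :: real
  assumes p: "p > 0" and d: "d > 0"
begin

private definition \<rho> :: "nat \<Rightarrow> real \<Rightarrow> real" where
  "\<rho> n s = pochhammer s n / pochhammer (s + d) n"

private lemma \<rho>_bounds: "s > 0 \<Longrightarrow> 0 \<le> \<rho> n s" "s > 0 \<Longrightarrow> \<rho> n s \<le> 1"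
proof -
  assume s: "s > 0"
  show "0 \<le> \<rho> n s"
    using s d by (auto simp: \<rho>_def intro!: divide_nonneg_nonneg pochhammer_nonneg)
  have "pochhammer s n \<le> pochhammer (s + d) n"
    unfolding pochhammer_prod using s d by (intro prod_mono) auto
  then show "\<rho> n s \<le> 1"
    using s d by (simp add: \<rho>_def pochhammer_pos divide_le_eq)
qed

private lemma \<rho>_deriv:
  assumes s: "s > 0"
  shows "(\<rho> n has_real_derivative deriv (\<rho> n) s) (at s)" "\<bar>deriv (\<rho> n) s\<bar> \<le> real n / d"
proof -
  have "\<exists>D. (\<rho> n has_real_derivative D) (at s) \<and> \<bar>D\<bar> \<le> real n / d"
  proof (induction n)
    case 0
    have "\<rho> 0 = (\<lambda>_. 1)" by (simp add: \<rho>_def fun_eq_iff)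
    then show ?case using d by (intro exI[of _ 0]) auto
  next
    case (Suc n)
    then obtain D where D: "(\<rho> n has_real_derivative D) (at s)" "\<bar>D\<bar> \<le> real n / d" by blast
    have pos: "s + d + n > 0" using s d by simp
    have eq: "\<rho> (Suc n) = (\<lambda>s. \<rho> n s * ((s + n) / (s + d + n)))"
      by (simp add: \<rho>_def pochhammer_Suc fun_eq_iff)
    have quot: "((\<lambda>s. (s + n) / (s + d + n)) has_real_derivative d / (s + d + n)\<^sup>2) (at s)"
      using pos by (auto intro!: derivative_eq_intros simp: power2_eq_square)
    have "(\<rho> (Suc n) has_real_derivative D * ((s + n) / (s + d + n)) + d / (s + d + n)\<^sup>2 * \<rho> n s) (at s)"
      unfolding eq by (rule DERIV_mult[OF D(1) quot])
    moreover have "\<bar>D * ((s + n) / (s + d + n)) + d / (s + d + n)\<^sup>2 * \<rho> n s\<bar> \<le> real (Suc n) / d"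
    proof -
      have 1: "\<bar>D * ((s + n) / (s + d + n))\<bar> \<le> \<bar>D\<bar>"
        unfolding abs_mult using s d by (intro mult_left_le) (auto simp: divide_simps)
      have "\<bar>d / (s + d + n)\<^sup>2 * \<rho> n s\<bar> \<le> d / (s + d + n)\<^sup>2"
        unfolding abs_mult using \<rho>_bounds[OF s, of n] d mult_left_le[of "\<rho> n s" "d / (s + d + n)\<^sup>2"] by simp
      also have "\<dots> \<le> d / d\<^sup>2"
        using s d by (intro divide_left_mono power_mono mult_pos_pos) auto
      also have "\<dots> = 1 / d" by (simp add: power2_eq_square)
      finally have 2: "\<bar>d / (s + d + n)\<^sup>2 * \<rho> n s\<bar> \<le> 1 / d" .
      have "\<bar>D * ((s + n) / (s + d + n)) + d / (s + d + n)\<^sup>2 * \<rho> n s\<bar> \<le> real n / d + 1 / d"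
        by (rule order_trans[OF abs_triangle_ineq add_mono[OF order_trans[OF 1 D(2)] 2]])
      then show ?thesis by (simp add: add_divide_distrib add.commute)
    qed
    ultimately show ?case by blast
  qed
  then obtain D where "(\<rho> n has_real_derivative D) (at s)" "\<bar>D\<bar> \<le> real n / d" by blast
  then show "(\<rho> n has_real_derivative deriv (\<rho> n) s) (at s)" "\<bar>deriv (\<rho> n) s\<bar> \<le> real n / d"
    by (simp_all add: DERIV_imp_deriv)
qed

private lemma pochhammer_le: "pochhammer p n / fact n \<le> (p + 1) ^ n"
proof (induction n)
  case (Suc n)
  have "pochhammer p (Suc n) / fact (Suc n) = (p + n) / (1 + n) * (pochhammer p n / fact n)"
    by (simp add: pochhammer_Suc)
  also have "\<dots> \<le> (p + 1) * (p + 1) ^ n"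
    using Suc p by (intro mult_mono) (auto simp: field_simps intro!: divide_nonneg_pos pochhammer_nonneg)
  finally show ?case by simp
qed simp

definition param_deriv_fps :: "real \<Rightarrow> real fps" where
  "param_deriv_fps s = Abs_fps (\<lambda>n. pochhammer p n / fact n * deriv (\<rho> n) s)"

lemma param_deriv_fps_nth_0: "param_deriv_fps s $ 0 = 0"
proof -
  have "\<rho> 0 = (\<lambda>_. 1)" by (simp add: \<rho>_def fun_eq_iff)
  then show ?thesis by (simp add: param_deriv_fps_def)
qed

lemma param_deriv_fps_nth_1:
  assumes "s > 0"
  shows "param_deriv_fps s $ 1 = p * d / (s + d)\<^sup>2"
proof -
  have "\<rho> 1 = (\<lambda>s. s / (s + d))" by (simp add: \<rho>_def fun_eq_iff)
  then have "(\<rho> 1 has_real_derivative d / (s + d)\<^sup>2) (at s)"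
    using assms d by (auto intro!: derivative_eq_intros simp: power2_eq_square)
  then show ?thesis
    by (simp add: param_deriv_fps_def DERIV_imp_deriv)
qed

private lemma param_deriv_fps_nth_le:
  assumes "s > 0"
  shows "\<bar>param_deriv_fps s $ n\<bar> \<le> (p + 1) ^ n * (real n / d)"
proof -
  have "\<bar>pochhammer p n / fact n * deriv (\<rho> n) s\<bar> \<le> (p + 1) ^ n * (real n / d)"
    unfolding abs_mult using \<rho>_deriv(2)[OF assms, of n] pochhammer_le[of n] p pochhammer_pos[OF p, of n]
    by (intro mult_mono) auto
  then show ?thesis by (simp add: param_deriv_fps_def)
qed

private lemma summable_majorant:
  assumes "0 \<le> r" "r < 1 / (p + 1)"
  shows "summable (\<lambda>n. (p + 1) ^ n * (real n / d) * r ^ n)"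
proof -
  have z: "(p + 1) * r < 1" "0 \<le> (p + 1) * r" using assms p by (auto simp: field_simps)
  then have "summable (\<lambda>n. of_nat (Suc n) * ((p + 1) * r) ^ n)"
    by (intro sums_summable[OF geometric_deriv_sums]) simp
  then have "summable (\<lambda>n. of_nat n * ((p + 1) * r) ^ n)"
    by (rule summable_comparison_test'[where N = 0]) (use z in \<open>auto simp: abs_mult intro!: mult_right_mono\<close>)
  then have "summable (\<lambda>n. 1 / d * (of_nat n * ((p + 1) * r) ^ n))"
    by (rule summable_mult)
  then show ?thesis by (simp add: power_mult_distrib mult_ac)
qed

lemma param_deriv_fps_radius:
  assumes "s > 0"
  shows "fps_conv_radius (param_deriv_fps s) \<ge> ereal (1 / (p + 1))"
  unfolding fps_conv_radius_def
proof (rule conv_radius_geI_ex')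
  fix r :: real assume r: "0 < r" "ereal r < ereal (1 / (p + 1))"
  show "summable (\<lambda>n. param_deriv_fps s $ n * of_real r ^ n)"
  proof (rule summable_comparison_test'[OF summable_majorant[of r], of 0])
    show "norm (param_deriv_fps s $ n * of_real r ^ n) \<le> (p + 1) ^ n * (real n / d) * r ^ n" for n
      using mult_right_mono[OF param_deriv_fps_nth_le[OF assms, of n], of "r ^ n"] r by (simp add: abs_mult)
  qed (use r in auto)
qed

lemma has_real_derivative_hypF_param:
  assumes s: "s > 0" and r: "0 \<le> r" "r < 1 / (p + 1)"
  shows "((\<lambda>s. hypF p s (s + d) r) has_real_derivative eval_fps (param_deriv_fps s) r) (at s)"
proof -
  have "1 / (p + 1) < 1" using p by simp
  then have r1: "r < 1" using r by linarith
  have "((\<lambda>s. \<Sum>n. hyp_fps p s (s + d) $ n * r ^ n) has_real_derivative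
      (\<Sum>n. param_deriv_fps s $ n * r ^ n)) (at s)"
  proof (rule has_field_derivative_series'(2)[where S = "{0<..}"])
    fix n and t :: real assume "t \<in> {0<..}"
    then have "(\<rho> n has_real_derivative deriv (\<rho> n) t) (at t within {0<..})"
      by (intro has_field_derivative_at_within[OF \<rho>_deriv(1)]) simp
    then have "((\<lambda>s. pochhammer p n / fact n * \<rho> n s * r ^ n) has_real_derivative
        pochhammer p n / fact n * deriv (\<rho> n) t * r ^ n) (at t within {0<..})"
      by (intro DERIV_cmult DERIV_cmult_right)
    then show "((\<lambda>s. hyp_fps p s (s + d) $ n * r ^ n) has_real_derivative
        param_deriv_fps t $ n * r ^ n) (at t within {0<..})"
      by (simp add: hyp_fps_def param_deriv_fps_def \<rho>_def mult_ac)
  next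
    show "uniformly_convergent_on {0<..} (\<lambda>n t. \<Sum>i<n. param_deriv_fps t $ i * r ^ i)"
    proof (rule Weierstrass_m_test'[OF _ summable_majorant[OF r]])
      fix n and t :: real assume "t \<in> {0<..}"
      then show "norm (param_deriv_fps t $ n * r ^ n) \<le> (p + 1) ^ n * (real n / d) * r ^ n"
        using mult_right_mono[OF param_deriv_fps_nth_le[of t n], of "r ^ n"] r by (simp add: abs_mult)
    qed
  next
    show "summable (\<lambda>n. hyp_fps p s (s + d) $ n * r ^ n)"
      using p s d r r1 by (intro summable_fps) (auto simp: fps_conv_radius_hyp_fps_pos)
  qed (use s in \<open>auto simp: interior_open\<close>)
  then show ?thesis
    by (simp add: hypF_eq_eval_hyp_fps eval_fps_def)
qed

end

lemma hypF_ratio_param_deriv_pos: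
  fixes a b :: real
  assumes a: "a > 0" and b: "b > 0" and ab: "b > sqrt (a * (a + 1))"
  obtains r D where "0 < r" "r < 1" "D > 0"
    "((\<lambda>t. hypF (a + 1) (t + 1) (a + t + 1) r / hypF a t (a + t) r) has_real_derivative D) (at b)"
proof -
  define X where "X = hyp_fps (a + 1) (b + 1) (b + 1 + a)"
  define Y where "Y = hyp_fps a b (b + a)"
  define X' where "X' = param_deriv_fps (a + 1) a (b + 1)"
  define Y' where "Y' = param_deriv_fps a a b"
  define R where "R = 1 / (a + 2)"
  have R: "0 < R" "R < 1" "R < 1 / (a + 1)" using a by (auto simp: R_def field_simps)
  have rad: "fps_conv_radius X \<ge> ereal R" "fps_conv_radius Y \<ge> ereal R"
    "fps_conv_radius X' \<ge> ereal R" "fps_conv_radius Y' \<ge> ereal R"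
  proof -
    show "fps_conv_radius X \<ge> ereal R" "fps_conv_radius Y \<ge> ereal R"
      using R a b by (simp_all add: X_def Y_def fps_conv_radius_hyp_fps_pos)
    show "fps_conv_radius X' \<ge> ereal R"
      using param_deriv_fps_radius[of "a + 1" a "b + 1"] a b by (simp add: X'_def R_def add_ac)
    have "ereal R \<le> ereal (1 / (a + 1))" using R by simp
    also have "\<dots> \<le> fps_conv_radius Y'"
      unfolding Y'_def by (rule param_deriv_fps_radius[OF a a b])
    finally show "fps_conv_radius Y' \<ge> ereal R" .
  qed
  define E where "E = X' * Y - X * Y'"
  have rad': "fps_conv_radius (X' * Y) \<ge> ereal R" "fps_conv_radius (X * Y') \<ge> ereal R"
    using rad by (intro order_trans[OF _ fps_conv_radius_mult]; simp)+
  then have E_rad: "fps_conv_radius E \<ge> ereal R"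
    unfolding E_def by (intro order_trans[OF _ fps_conv_radius_diff]) simp
  have eval_E: "eval_fps E r = eval_fps X' r * eval_fps Y r - eval_fps X r * eval_fps Y' r"
    if "\<bar>r\<bar> < R" for r
  proof -
    have *: "ereal \<bar>r\<bar> < c" if "ereal R \<le> c" for c
      using \<open>\<bar>r\<bar> < R\<close> that by (intro less_le_trans[OF _ that]) simp
    show ?thesis
      unfolding E_def using rad rad' by (simp add: eval_fps_diff eval_fps_mult *)
  qed
  have E0: "E $ 0 = 0" using a by (simp add: E_def X'_def Y'_def param_deriv_fps_nth_0)
  have E1: "E $ 1 > 0"
  proof -
    have "E $ 1 = X' $ 1 - Y' $ 1"
      using a by (simp add: E_def fps_mult_nth X'_def Y'_def param_deriv_fps_nth_0 X_def Y_def)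
    also have "\<dots> = (a + 1) * a / (b + 1 + a)\<^sup>2 - a * a / (b + a)\<^sup>2"
      using a b by (simp only: X'_def Y'_def param_deriv_fps_nth_1 add_pos_pos zero_less_one)
    also have "\<dots> > 0"
    proof -
      have "sqrt (a * (a + 1)) ^ 2 < b ^ 2"
        using ab a by (intro power_strict_mono) auto
      then have "a * (a + 1) < b\<^sup>2" using a by simp
      then have "a * (a * (b + 1 + a)\<^sup>2) < a * ((a + 1) * (b + a)\<^sup>2)"
        using a by (intro mult_strict_left_mono) (auto simp: power2_eq_square algebra_simps)
      then have "a * a * (b + 1 + a)\<^sup>2 < (a + 1) * a * (b + a)\<^sup>2"
        by (simp add: mult_ac)
      moreover have "(b + 1 + a)\<^sup>2 > 0" "(b + a)\<^sup>2 > 0" using a b by auto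
      ultimately have "a * a / (b + a)\<^sup>2 < (a + 1) * a / (b + 1 + a)\<^sup>2"
        by (subst frac_less_eq) (auto simp: divide_less_0_iff mult_ac)
      then show ?thesis by simp
    qed
    finally show ?thesis .
  qed
  have "ereal (norm (0::real)) < fps_conv_radius E"
    using R by (intro less_le_trans[OF _ E_rad]) simp
  then have "(eval_fps E has_real_derivative eval_fps (fps_deriv E) 0) (at 0)"
    by (rule has_field_derivative_eval_fps)
  then obtain e where e: "e > 0" "\<And>h. 0 < h \<Longrightarrow> h < e \<Longrightarrow> eval_fps E 0 < eval_fps E (0 + h)"
    using DERIV_pos_inc_right[of "eval_fps E" "eval_fps (fps_deriv E) 0" 0] E1 by (auto simp: eval_fps_at_0)
  define r where "r = min e R / 2"
  have r: "0 < r" "r < e" "r < R" using e(1) R by (auto simp: r_def)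
  then have E_pos: "eval_fps E r > 0" using e(2)[of r] by (simp add: eval_fps_at_0 E0)
  have Y_pos: "eval_fps Y r > 0"
    unfolding Y_def using eval_hyp_fps_ge_1[of a b "b + a" r] a b r R by simp
  have "r < 1 / (a + 1 + 1)" using r by (simp add: R_def add_ac)
  then have "((\<lambda>t. hypF (a + 1) t (t + a) r) has_real_derivative eval_fps X' r) (at (b + 1))"
    unfolding X'_def using r a b by (intro has_real_derivative_hypF_param) auto
  then have "((\<lambda>t. hypF (a + 1) (t + 1) (t + 1 + a) r) has_real_derivative eval_fps X' r) (at b)"
    by (simp only: DERIV_shift)
  moreover have "((\<lambda>t. hypF a t (t + a) r) has_real_derivative eval_fps Y' r) (at b)"
    unfolding Y'_def using r a b R by (intro has_real_derivative_hypF_param) auto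
  moreover have eval: "hypF a b (b + a) r = eval_fps Y r" "hypF (a + 1) (b + 1) (b + 1 + a) r = eval_fps X r"
    by (simp_all add: hypF_eq_eval_hyp_fps X_def Y_def)
  ultimately have "((\<lambda>t. hypF (a + 1) (t + 1) (t + 1 + a) r / hypF a t (t + a) r) has_real_derivative
      (eval_fps X' r * eval_fps Y r - eval_fps X r * eval_fps Y' r) / (eval_fps Y r * eval_fps Y r)) (at b)"
    using DERIV_divide[of "\<lambda>t. hypF (a + 1) (t + 1) (t + 1 + a) r" "eval_fps X' r" b UNIV
      "\<lambda>t. hypF a t (t + a) r" "eval_fps Y' r"] Y_pos by simp
  then have "((\<lambda>t. hypF (a + 1) (t + 1) (a + t + 1) r / hypF a t (a + t) r) has_real_derivative
      eval_fps E r / (eval_fps Y r * eval_fps Y r)) (at b)"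
    using eval_E[of r] r by (simp add: add_ac)
  moreover have "eval_fps E r / (eval_fps Y r * eval_fps Y r) > 0"
    using E_pos Y_pos by simp
  moreover have "r < 1" using r R by linarith
  ultimately show thesis
    using that[OF r(1)] by blast
qed



theorem theorem1p1:
  shows
    "\<comment> \<open>(1)\<close>
     (\<forall>a>0. \<forall>b>0. b > sqrt (a * (a + 1)) \<longrightarrow>
        \<not> (\<forall>r\<in>{0<..<1}. \<forall>D.
              ((\<lambda>t. hypF (a + 1) (t + 1) (a + t + 1) r / hypF a t (a + t) r)
                 has_real_derivative D) (at b) \<longrightarrow> D < 0))
   \<and> (\<forall>a\<in>{0<..<1/3}.
        \<not> (\<forall>r\<in>{0<..<1}.
              hypF (a + 1) (2 - a) 2 r / hypF a (1 - a) 1 r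
              > hypF (a + 1) (5/2 - a) (5/2) r / hypF a (3/2 - a) (3/2) r))

   \<comment> \<open>(2)\<close>
   \<and> (\<forall>a\<in>{0<..<3/7}. \<exists>r1\<in>{0<..<1}.
        strict_antimono_on {0<..r1} (f1 a) \<and> (\<forall>r\<in>{0<..r1}. Lambda a r < 1))
   \<and> (\<forall>a\<in>{3/7<..<1}. \<exists>r2\<in>{0<..<1}.
        strict_mono_on {0<..r2} (f1 a) \<and> (\<forall>r\<in>{0<..r2}. Lambda a r > 1))
   \<and> (\<forall>a\<in>{0<..<1}. \<exists>r3\<in>{0<..<1}.
        (\<forall>r\<in>{r3..<1}. f1 a r > 0) \<and> strict_mono_on {r3..<1} (f1 a)
        \<and> filterlim (f1 a) at_top (at_left 1)
        \<and> (\<forall>r\<in>{r3..<1}. Lambda a r > 1))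
   \<and> (\<forall>a\<in>{0<..<1}. \<forall>r\<in>{0<..<1}. Lambda a r > 1 \<longleftrightarrow> Lambda1 a r > hypF a (1 - a) 1 r)
   \<and> \<not> (\<forall>a\<in>{0<..<1}. \<forall>r\<in>{0<..<1}. Lambda a r > 1)
   \<and> \<not> (\<forall>a\<in>{0<..<1}. \<forall>r\<in>{0<..<1}. Lambda a r < 1)

   \<comment> \<open>(3): the coefficients of f2\<close>
   \<and> (\<forall>a\<in>{0<..<1}.
        (\<forall>r\<in>{0<..<1}. (\<lambda>k. acoeff a k * r ^ k) sums f2 a r)
        \<and> f2 a 0 = acoeff a 0 \<and> acoeff a 0 = alpha a - 1 \<and> alpha a - 1 = a / (3 * (1 - a))
        \<and> (f2 a \<longlongrightarrow> alpha a * beta a) (at_left 1)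
        \<and> (\<forall>k\<ge>1.
              acoeff a k = 1 / real k *
                (\<Sum>i<k. (real i + 1) * pochhammer a (k - i - 1) * pochhammer (3/2 - a) (k - i - 1)
                         / (pochhammer (3/2) (k - i - 1) * fact (k - i - 1))
                         * \<bar>acoeff1 a (i + 1)\<bar>)
              \<and> acoeff a k > 0)
        \<and> acoeff a 1 = a * (a + 1) / 10
        \<and> acoeff a 2 = a * (a + 1) * (- 41 * a\<^sup>2 + 24 * a + 100) / 2100)
   \<and> (\<forall>k. ((\<lambda>a. acoeff a k) \<longlongrightarrow> 0) (at_right 0))

   \<comment> \<open>(3): consequences\<close>
   \<and> (\<forall>a\<in>{0<..<1}.
        absolutely_monotone_on {0<..<1} (f2 a)
        \<and> f2 a ` {0<..<1} = {a / (3 * (1 - a))<..<alpha a * beta a}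
        \<and> (\<forall>m n. m < n \<longrightarrow> delta n a < delta m a)
        \<and> (\<lambda>n. delta n a) \<longlonglongrightarrow> 0)
   \<and> (\<forall>a\<in>{0<..<1}. \<forall>r\<in>{0<..<1}.
        alpha a * ellK a r =
          (ellE a r - (1 - r\<^sup>2) * ellK a r) / (a * r\<^sup>2)
          * (hypF a (3/2 - a) (3/2) (r\<^sup>2) / hypF a (3/2 - a) (5/2) (r\<^sup>2))
          + pi / 2 * (\<Sum>k. acoeff a k * r ^ (2 * k)))
   \<and> (\<forall>r\<in>{0<..<1}.
        ellK (1/2) r =
          (ellE (1/2) r - (1 - r\<^sup>2) * ellK (1/2) r) / (1 - ((1 - r\<^sup>2) * artanh r) / r)
          * (artanh r / r)
          + 3 * pi / 8 * (\<Sum>k. acoeff (1/2) k * r ^ (2 * k))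
        \<and> summable (\<lambda>k. acoeff2 k * r ^ (2 * k))
        \<and> ellK (1/2) r =
          3 * pi / 8 * ((\<Sum>k. acoeff2 k * r ^ (2 * k)) * (artanh r / r)
                        + (\<Sum>k. acoeff (1/2) k * r ^ (2 * k))))

   \<comment> \<open>(A)\<close>
   \<and> (\<forall>n. \<forall>a\<in>{0<..<1}. \<forall>r\<in>{0<..<1}.
        0 < A_mid n (alpha a) a r \<and> A_mid n (alpha a) a r < delta n a * r ^ (2 * (n + 2)))

   \<comment> \<open>(B)\<close>
   \<and> (\<forall>n. \<forall>a\<in>{0<..<1}. \<forall>r\<in>{0<..<1}.
        acoeff a (n + 2) * r ^ (n + 2) < B_mid n (alpha a) a r
        \<and> B_mid n (alpha a) a r < delta n a * r ^ (n + 2))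

   \<comment> \<open>(C)\<close>
   \<and> (\<forall>n. \<forall>a\<in>{0<..<1}. \<forall>r\<in>{0<..<1}.
        - delta n a * r ^ (n + 1)
          < (Lambda1 a r - hypF a (1 - a) 1 r) / r - a * (7 * a - 3) / 30 - Q n a r
        \<and> (Lambda1 a r - hypF a (1 - a) 1 r) / r - a * (7 * a - 3) / 30 - Q n a r
          < - acoeff a (n + 2) * r ^ (n + 1)
        \<and> Q n a r = a * ((hypF a (1 - a) 1 r - 1 - a * (1 - a) * r) / (3 * (1 - a) * r))
                    - (\<Sum>k=1..n. acoeff a (k + 1) * r ^ k))

   \<comment> \<open>(D)\<close>
   \<and> (\<forall>n. \<forall>a\<in>{0<..<1}. \<forall>r\<in>{0<..<1}. \<forall>(i, j)\<in>D_links.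
        D_terms n (alpha a) a r ! i < D_terms n (alpha a) a r ! j)

   \<comment> \<open>sharpness of (A) as r tends to 0, as r tends to 1, and as a tends to 0\<close>
   \<and> (\<forall>n. \<forall>a\<in>{0<..<1}.
        ((\<lambda>r. A_mid n (alpha a) a r) \<longlongrightarrow> 0) (at_right 0)
        \<and> ((\<lambda>r. delta n a * r ^ (2 * (n + 2)) - A_mid n (alpha a) a r) \<longlongrightarrow> 0) (at_right 0)
        \<and> ((\<lambda>r. delta n a * r ^ (2 * (n + 2)) - A_mid n (alpha a) a r) \<longlongrightarrow> 0) (at_left 1))
   \<and> (\<forall>n. \<forall>r\<in>{0<..<1}.
        ((\<lambda>a. A_mid n (alpha a) a r) \<longlongrightarrow> 0) (at_right 0)
        \<and> ((\<lambda>a. delta n a * r ^ (2 * (n + 2)) - A_mid n (alpha a) a r) \<longlongrightarrow> 0) (at_right 0))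

   \<comment> \<open>sharpness of (D) as a tends to 0\<close>
   \<and> (\<forall>n. \<forall>r\<in>{0<..<1}. \<forall>(i, j)\<in>D_links.
        ((\<lambda>a. D_terms n (alpha a) a r ! j - D_terms n (alpha a) a r ! i) \<longlongrightarrow> 0) (at_right 0))

   \<comment> \<open>no other constant can replace alpha in (A), (B), (D); index 4 of D_terms is Lambda,
       and the pairs added to D_links relate it to the bounds that are not adjacent to it\<close>
   \<and> (\<forall>n. \<forall>a\<in>{0<..<1}. \<forall>c.
        ((\<forall>r\<in>{0<..<1}. 0 < A_mid n c a r) \<longrightarrow> alpha a \<le> c)
        \<and> ((\<forall>r\<in>{0<..<1}. A_mid n c a r < delta n a * r ^ (2 * (n + 2))) \<longrightarrow> c \<le> alpha a)
        \<and> ((\<forall>r\<in>{0<..<1}. acoeff a (n + 2) * r ^ (n + 2) < B_mid n c a r) \<longrightarrow> alpha a \<le> c)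
        \<and> ((\<forall>r\<in>{0<..<1}. B_mid n c a r < delta n a * r ^ (n + 2)) \<longrightarrow> c \<le> alpha a)
        \<and> (\<forall>(i, j) \<in> D_links \<union> {(1, 4), (4, 6), (4, 7), (4, 8)}.
              (i \<noteq> 4 \<longrightarrow>
                 (\<forall>r\<in>{0<..<1}. D_terms n c a r ! i < D_terms n (alpha a) a r ! j) \<longrightarrow> c \<le> alpha a)
              \<and> (j \<noteq> 4 \<longrightarrow>
                 (\<forall>r\<in>{0<..<1}. D_terms n (alpha a) a r ! i < D_terms n c a r ! j) \<longrightarrow> alpha a \<le> c)))"
proof (intro conjI)
  have half: "0 < (1/2 :: real)" "(1/2 :: real) < 1" by auto
  show "\<forall>a>0. \<forall>b>0. b > sqrt (a * (a + 1)) \<longrightarrow>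
        \<not> (\<forall>r\<in>{0<..<1}. \<forall>D.
              ((\<lambda>t. hypF (a + 1) (t + 1) (a + t + 1) r / hypF a t (a + t) r)
                 has_real_derivative D) (at b) \<longrightarrow> D < 0)"
  proof (intro allI impI notI)
    fix a b :: real
    assume a: "a > 0" and b: "b > 0" "b > sqrt (a * (a + 1))"
      and neg: "\<forall>r\<in>{0<..<1}. \<forall>D.
              ((\<lambda>t. hypF (a + 1) (t + 1) (a + t + 1) r / hypF a t (a + t) r)
                 has_real_derivative D) (at b) \<longrightarrow> D < 0"
    obtain r D where "0 < r" "r < 1" "D > 0"
      "((\<lambda>t. hypF (a + 1) (t + 1) (a + t + 1) r / hypF a t (a + t) r) has_real_derivative D) (at b)"
      using hypF_ratio_param_deriv_pos[OF a b] .
    then have "D < 0" using neg by auto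
    with \<open>D > 0\<close> show False by simp
  qed
next
  show "\<forall>a\<in>{0<..<1/3}.
        \<not> (\<forall>r\<in>{0<..<1}.
              hypF (a + 1) (2 - a) 2 r / hypF a (1 - a) 1 r
              > hypF (a + 1) (5/2 - a) (5/2) r / hypF a (3/2 - a) (3/2) r)"
  proof
    fix a :: real assume "a \<in> {0<..<1/3}"
    then have a: "0 < a" "a < 3/7" "a < 1" by auto
    obtain r where r: "r \<in> {0<..<1}" "\<And>x. x \<in> {0<..r} \<Longrightarrow> f1 a x < 0"
      using f1_strict_antimono_near_0[OF a(1,2)] by blast
    then have "Lambda a r < 1" using Lambda_less_1_iff[OF a(1,3), of r] by simp
    then show "\<not> (\<forall>r\<in>{0<..<1}.
              hypF (a + 1) (2 - a) 2 r / hypF a (1 - a) 1 r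
              > hypF (a + 1) (5/2 - a) (5/2) r / hypF a (3/2 - a) (3/2) r)"
      using not_ratio_gt_if_Lambda_less_1[OF a(1,3), of r] r by auto
  qed
next
  show below: "\<forall>a\<in>{0<..<3/7}. \<exists>r1\<in>{0<..<1}.
        strict_antimono_on {0<..r1} (f1 a) \<and> (\<forall>r\<in>{0<..r1}. Lambda a r < 1)"
  proof
    fix a :: real assume "a \<in> {0<..<3/7}"
    then have a: "0 < a" "a < 3/7" "a < 1" by auto
    obtain r where r: "r \<in> {0<..<1}" "strict_antimono_on {0<..r} (f1 a)" "\<And>x. x \<in> {0<..r} \<Longrightarrow> f1 a x < 0"
      using f1_strict_antimono_near_0[OF a(1,2)] by blast
    then have "\<forall>x\<in>{0<..r}. Lambda a x < 1" using Lambda_less_1_iff[OF a(1,3)] by simp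
    with r show "\<exists>r1\<in>{0<..<1}. strict_antimono_on {0<..r1} (f1 a) \<and> (\<forall>r\<in>{0<..r1}. Lambda a r < 1)"
      by blast
  qed
  show above: "\<forall>a\<in>{3/7<..<1}. \<exists>r2\<in>{0<..<1}.
        strict_mono_on {0<..r2} (f1 a) \<and> (\<forall>r\<in>{0<..r2}. Lambda a r > 1)"
  proof
    fix a :: real assume "a \<in> {3/7<..<1}"
    then have a: "3/7 < a" "0 < a" "a < 1" by auto
    obtain r where r: "r \<in> {0<..<1}" "strict_mono_on {0<..r} (f1 a)" "\<And>x. x \<in> {0<..r} \<Longrightarrow> f1 a x > 0"
      using f1_strict_mono_near_0[OF a(1,3)] by blast
    then have "\<forall>x\<in>{0<..r}. Lambda a x > 1" using Lambda_gt_1_iff[OF a(2,3)] by simp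
    with r show "\<exists>r2\<in>{0<..<1}. strict_mono_on {0<..r2} (f1 a) \<and> (\<forall>r\<in>{0<..r2}. Lambda a r > 1)"
      by blast
  qed
  show "\<not> (\<forall>a\<in>{0<..<1}. \<forall>r\<in>{0<..<1}. Lambda a r > 1)"
  proof
    assume *: "\<forall>a\<in>{0<..<1}. \<forall>r\<in>{0<..<1}. Lambda a r > 1"
    obtain r where "r \<in> {0<..<1}" "Lambda (1/7) r < 1"
      using bspec[OF below, of "1/7"] by fastforce
    with bspec[OF bspec[OF *, of "1/7"], of r] show False by simp
  qed
  show "\<not> (\<forall>a\<in>{0<..<1}. \<forall>r\<in>{0<..<1}. Lambda a r < 1)"
  proof
    assume *: "\<forall>a\<in>{0<..<1}. \<forall>r\<in>{0<..<1}. Lambda a r < 1"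
    obtain r where "r \<in> {0<..<1}" "Lambda (1/2) r > 1"
      using bspec[OF above, of "1/2"] by fastforce
    with bspec[OF bspec[OF *, of "1/2"], of r] show False by simp
  qed
next
  show "\<forall>a\<in>{0<..<1}. \<exists>r3\<in>{0<..<1}.
        (\<forall>r\<in>{r3..<1}. f1 a r > 0) \<and> strict_mono_on {r3..<1} (f1 a)
        \<and> filterlim (f1 a) at_top (at_left 1)
        \<and> (\<forall>r\<in>{r3..<1}. Lambda a r > 1)"
  proof
    fix a :: real assume "a \<in> {0<..<1}"
    then have a: "0 < a" "a < 1" by auto
    obtain r where r: "r \<in> {0<..<1}" "strict_mono_on {r..<1} (f1 a)" "\<And>x. x \<in> {r..<1} \<Longrightarrow> f1 a x > 0"
      using f1_strict_mono_near_1[OF a] by blast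
    moreover have "\<forall>x\<in>{r..<1}. Lambda a x > 1"
      using r Lambda_gt_1_iff[OF a] by simp
    ultimately show "\<exists>r3\<in>{0<..<1}.
        (\<forall>r\<in>{r3..<1}. f1 a r > 0) \<and> strict_mono_on {r3..<1} (f1 a)
        \<and> filterlim (f1 a) at_top (at_left 1)
        \<and> (\<forall>r\<in>{r3..<1}. Lambda a r > 1)"
      using f1_filterlim[OF a] by blast
  qed
next
  show "\<forall>a\<in>{0<..<1}. \<forall>r\<in>{0<..<1}. Lambda a r > 1 \<longleftrightarrow> Lambda1 a r > hypF a (1 - a) 1 r"
    using Lambda_gt_1_iff by (auto simp: f1_def)
next
  show "\<forall>a\<in>{0<..<1}.
        (\<forall>r\<in>{0<..<1}. (\<lambda>k. acoeff a k * r ^ k) sums f2 a r)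
        \<and> f2 a 0 = acoeff a 0 \<and> acoeff a 0 = alpha a - 1 \<and> alpha a - 1 = a / (3 * (1 - a))
        \<and> (f2 a \<longlongrightarrow> alpha a * beta a) (at_left 1)
        \<and> (\<forall>k\<ge>1.
              acoeff a k = 1 / real k *
                (\<Sum>i<k. (real i + 1) * pochhammer a (k - i - 1) * pochhammer (3/2 - a) (k - i - 1)
                         / (pochhammer (3/2) (k - i - 1) * fact (k - i - 1))
                         * \<bar>acoeff1 a (i + 1)\<bar>)
              \<and> acoeff a k > 0)
        \<and> acoeff a 1 = a * (a + 1) / 10
        \<and> acoeff a 2 = a * (a + 1) * (- 41 * a\<^sup>2 + 24 * a + 100) / 2100"
  proof (intro ballI conjI allI impI)
    fix a :: real assume "a \<in> {0<..<1}"
    then have a: "0 < a" "a < 1" by auto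
    show "(\<lambda>k. acoeff a k * r ^ k) sums f2 a r" if "r \<in> {0<..<1}" for r
      using f2_sums[OF a, of r] that by simp
    show "f2 a 0 = acoeff a 0" "acoeff a 0 = alpha a - 1"
      by (simp_all add: f2_0[OF a] acoeff_0[OF a])
    show "alpha a - 1 = a / (3 * (1 - a))" using a by (rule alpha_minus_1)
    show "(f2 a \<longlongrightarrow> alpha a * beta a) (at_left 1)" by (rule f2_tendsto[OF a])
    show "acoeff a k > 0" for k by (rule acoeff_pos[OF a])
    show "acoeff a 1 = a * (a + 1) / 10"
      "acoeff a 2 = a * (a + 1) * (- 41 * a\<^sup>2 + 24 * a + 100) / 2100"
      unfolding acoeff_eq[OF a] by (rule f2_fps_nth_1[OF a], rule f2_fps_nth_2[OF a])
    show "acoeff a k = 1 / real k *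
        (\<Sum>i<k. (real i + 1) * pochhammer a (k - i - 1) * pochhammer (3/2 - a) (k - i - 1)
                 / (pochhammer (3/2) (k - i - 1) * fact (k - i - 1)) * \<bar>acoeff1 a (i + 1)\<bar>)"
      if "1 \<le> k" for k
      using f2_fps_nth[OF a, of k] that unfolding acoeff_eq[OF a] acoeff1_eq[OF a]
      by (simp add: hyp_fps_def mult.assoc)
  qed
next
  show "\<forall>k. ((\<lambda>a. acoeff a k) \<longlongrightarrow> 0) (at_right 0)"
    by (intro allI acoeff_tendsto_0)
next
  show "\<forall>a\<in>{0<..<1}.
        absolutely_monotone_on {0<..<1} (f2 a)
        \<and> f2 a ` {0<..<1} = {a / (3 * (1 - a))<..<alpha a * beta a}
        \<and> (\<forall>m n. m < n \<longrightarrow> delta n a < delta m a)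
        \<and> (\<lambda>n. delta n a) \<longlonglongrightarrow> 0"
  proof
    fix a :: real assume "a \<in> {0<..<1}"
    then have a: "0 < a" "a < 1" by auto
    show "absolutely_monotone_on {0<..<1} (f2 a)
        \<and> f2 a ` {0<..<1} = {a / (3 * (1 - a))<..<alpha a * beta a}
        \<and> (\<forall>m n. m < n \<longrightarrow> delta n a < delta m a)
        \<and> (\<lambda>n. delta n a) \<longlonglongrightarrow> 0"
      unfolding alpha_minus_1[OF a, symmetric]
      using f2_absolutely_monotone[OF a] f2_image[OF a] delta_strict_antimono[OF a] delta_tendsto[OF a]
      by blast
  qed
next
  show "\<forall>a\<in>{0<..<1}. \<forall>r\<in>{0<..<1}.
        alpha a * ellK a r =
          (ellE a r - (1 - r\<^sup>2) * ellK a r) / (a * r\<^sup>2)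
          * (hypF a (3/2 - a) (3/2) (r\<^sup>2) / hypF a (3/2 - a) (5/2) (r\<^sup>2))
          + pi / 2 * (\<Sum>k. acoeff a k * r ^ (2 * k))"
    by (intro ballI alpha_ellK_eq) auto
next
  show "\<forall>r\<in>{0<..<1}.
        ellK (1/2) r =
          (ellE (1/2) r - (1 - r\<^sup>2) * ellK (1/2) r) / (1 - ((1 - r\<^sup>2) * artanh r) / r)
          * (artanh r / r)
          + 3 * pi / 8 * (\<Sum>k. acoeff (1/2) k * r ^ (2 * k))
        \<and> summable (\<lambda>k. acoeff2 k * r ^ (2 * k))
        \<and> ellK (1/2) r =
          3 * pi / 8 * ((\<Sum>k. acoeff2 k * r ^ (2 * k)) * (artanh r / r)
                        + (\<Sum>k. acoeff (1/2) k * r ^ (2 * k)))"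
    by (intro ballI conjI ellK_half_eq) auto
next
  show "\<forall>n. \<forall>a\<in>{0<..<1}. \<forall>r\<in>{0<..<1}.
        0 < A_mid n (alpha a) a r \<and> A_mid n (alpha a) a r < delta n a * r ^ (2 * (n + 2))"
    by (intro allI ballI conjI A_mid_bounds) auto
next
  show "\<forall>n. \<forall>a\<in>{0<..<1}. \<forall>r\<in>{0<..<1}.
        acoeff a (n + 2) * r ^ (n + 2) < B_mid n (alpha a) a r
        \<and> B_mid n (alpha a) a r < delta n a * r ^ (n + 2)"
    by (intro allI ballI conjI B_mid_bounds) auto
next
  show "\<forall>n. \<forall>a\<in>{0<..<1}. \<forall>r\<in>{0<..<1}.
        - delta n a * r ^ (n + 1)
          < (Lambda1 a r - hypF a (1 - a) 1 r) / r - a * (7 * a - 3) / 30 - Q n a r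
        \<and> (Lambda1 a r - hypF a (1 - a) 1 r) / r - a * (7 * a - 3) / 30 - Q n a r
          < - acoeff a (n + 2) * r ^ (n + 1)
        \<and> Q n a r = a * ((hypF a (1 - a) 1 r - 1 - a * (1 - a) * r) / (3 * (1 - a) * r))
                    - (\<Sum>k=1..n. acoeff a (k + 1) * r ^ k)"
    by (intro allI ballI conjI C_bounds Q_eq) auto
next
  show "\<forall>n. \<forall>a\<in>{0<..<1}. \<forall>r\<in>{0<..<1}. \<forall>(i, j)\<in>D_links.
        D_terms n (alpha a) a r ! i < D_terms n (alpha a) a r ! j"
    using D_links_less by auto
next
  show "\<forall>n. \<forall>a\<in>{0<..<1}.
        ((\<lambda>r. A_mid n (alpha a) a r) \<longlongrightarrow> 0) (at_right 0)
        \<and> ((\<lambda>r. delta n a * r ^ (2 * (n + 2)) - A_mid n (alpha a) a r) \<longlongrightarrow> 0) (at_right 0)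
        \<and> ((\<lambda>r. delta n a * r ^ (2 * (n + 2)) - A_mid n (alpha a) a r) \<longlongrightarrow> 0) (at_left 1)"
    by (intro allI ballI conjI A_mid_tendsto_r) auto
next
  show "\<forall>n. \<forall>r\<in>{0<..<1}.
        ((\<lambda>a. A_mid n (alpha a) a r) \<longlongrightarrow> 0) (at_right 0)
        \<and> ((\<lambda>a. delta n a * r ^ (2 * (n + 2)) - A_mid n (alpha a) a r) \<longlongrightarrow> 0) (at_right 0)"
    by (intro allI ballI conjI A_mid_tendsto_a_0) auto
next
  show "\<forall>n. \<forall>r\<in>{0<..<1}. \<forall>(i, j)\<in>D_links.
        ((\<lambda>a. D_terms n (alpha a) a r ! j - D_terms n (alpha a) a r ! i) \<longlongrightarrow> 0) (at_right 0)"
  proof (intro allI ballI, clarify)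
    fix n i j and r :: real assume "r \<in> {0<..<1}" "(i, j) \<in> D_links"
    then show "((\<lambda>a. D_terms n (alpha a) a r ! j - D_terms n (alpha a) a r ! i) \<longlongrightarrow> 0) (at_right 0)"
      by (intro D_terms_tendsto_a_0) (auto simp: D_links_def)
  qed
next
  show "\<forall>n. \<forall>a\<in>{0<..<1}. \<forall>c.
        ((\<forall>r\<in>{0<..<1}. 0 < A_mid n c a r) \<longrightarrow> alpha a \<le> c)
        \<and> ((\<forall>r\<in>{0<..<1}. A_mid n c a r < delta n a * r ^ (2 * (n + 2))) \<longrightarrow> c \<le> alpha a)
        \<and> ((\<forall>r\<in>{0<..<1}. acoeff a (n + 2) * r ^ (n + 2) < B_mid n c a r) \<longrightarrow> alpha a \<le> c)
        \<and> ((\<forall>r\<in>{0<..<1}. B_mid n c a r < delta n a * r ^ (n + 2)) \<longrightarrow> c \<le> alpha a)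
        \<and> (\<forall>(i, j) \<in> D_links \<union> {(1, 4), (4, 6), (4, 7), (4, 8)}.
              (i \<noteq> 4 \<longrightarrow>
                 (\<forall>r\<in>{0<..<1}. D_terms n c a r ! i < D_terms n (alpha a) a r ! j) \<longrightarrow> c \<le> alpha a)
              \<and> (j \<noteq> 4 \<longrightarrow>
                 (\<forall>r\<in>{0<..<1}. D_terms n (alpha a) a r ! i < D_terms n c a r ! j) \<longrightarrow> alpha a \<le> c))"
  proof (intro allI ballI conjI)
    fix n :: nat and a c :: real assume "a \<in> {0<..<1}"
    then have a: "0 < a" "a < 1" by auto
    show "(\<forall>r\<in>{0<..<1}. 0 < A_mid n c a r) \<longrightarrow> alpha a \<le> c"
      "(\<forall>r\<in>{0<..<1}. A_mid n c a r < delta n a * r ^ (2 * (n + 2))) \<longrightarrow> c \<le> alpha a"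
      using A_mid_best[OF a] by blast+
    show "(\<forall>r\<in>{0<..<1}. acoeff a (n + 2) * r ^ (n + 2) < B_mid n c a r) \<longrightarrow> alpha a \<le> c"
      "(\<forall>r\<in>{0<..<1}. B_mid n c a r < delta n a * r ^ (n + 2)) \<longrightarrow> c \<le> alpha a"
      using B_mid_best[OF a] by blast+
    fix ij assume ij: "ij \<in> D_links \<union> {(1, 4), (4, 6), (4, 7), (4, 8)}"
    obtain i j where "ij = (i, j)" by fastforce
    with ij show "case ij of (i, j) \<Rightarrow>
              (i \<noteq> 4 \<longrightarrow>
                 (\<forall>r\<in>{0<..<1}. D_terms n c a r ! i < D_terms n (alpha a) a r ! j) \<longrightarrow> c \<le> alpha a)
              \<and> (j \<noteq> 4 \<longrightarrow>
                 (\<forall>r\<in>{0<..<1}. D_terms n (alpha a) a r ! i < D_terms n c a r ! j) \<longrightarrow> alpha a \<le> c)"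
      using D_terms_best[OF a, of i j n c] by (simp only: prod.case) blast
  qed
qed

end
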